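(* Assume $\alpha\in\ell^6$ and $(S-1)\alpha\in\ell^3$. Then $$\int_0^{2\pi}(1-\cos\theta)^3(1+\cos\theta)\log w(\theta)\frac{d\theta}{2\pi}>-\infty\iff(S-1)^3(S+1)\alpha\in\ell^2.$$
   Context: $\mu$ is a probability measure with infinite support on the unit circle (identified with $[0,2\pi]$ via $e^{i\theta}\mapsto\theta$), with Lebesgue decomposition $d\mu(\theta)=w(\theta)\frac{d\theta}{2\pi}+d\mu_s(\theta)$. $\Phi_n$ are its monic orthogonal polynomials, and its sequence of Verblunsky coefficients is $\alpha=(\alpha_n)_{n\ge0}$, $\alpha_n=-\overline{\Phi_{n+1}(0)}\in\mathbb{D}$. $S$ is the left shift on sequences, $(S\alpha)_n=\alpha_{n+1}$. The integral is well defined in $[-\infty,\infty)$. *)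

theory Defs
  imports "HOL-Probability.Probability" "HOL-Computational_Algebra.Polynomial"
begin

definition circle_prob_measure :: "complex measure \<Rightarrow> bool" where
  "circle_prob_measure \<mu> \<longleftrightarrow>
     prob_space \<mu> \<and> sets \<mu> = sets borel \<and> emeasure \<mu> (- sphere 0 1) = 0"

definition measure_supp :: "complex measure \<Rightarrow> complex set" where
  "measure_supp \<mu> = {z. \<forall>U. open U \<longrightarrow> z \<in> U \<longrightarrow> emeasure \<mu> U > 0}"

(* d\<theta> / 2\<pi> on [0, 2\<pi>]; its image under cis is normalised arc length. *)
definition angle_measure :: "real measure" where
  "angle_measure = uniform_measure lborel {0..2 * pi}"

(* d\<mu> = w d\<theta>/2\<pi> + d\<mu>s.  The density w is a function of the angle; only its values on
   [0, 2\<pi>] matter, and it is determined there up to null sets. *)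
definition circle_lebesgue_decomp ::
  "complex measure \<Rightarrow> (real \<Rightarrow> real) \<Rightarrow> complex measure \<Rightarrow> bool" where
  "circle_lebesgue_decomp \<mu> w \<mu>s \<longleftrightarrow>
     w \<in> borel_measurable borel \<and> (\<forall>\<theta>\<in>{0..2 * pi}. 0 \<le> w \<theta>) \<and>
     sets \<mu>s = sets borel \<and>
     (\<forall>A\<in>sets borel. emeasure \<mu> A =
        emeasure (distr (density angle_measure (\<lambda>\<theta>. ennreal (w \<theta>))) borel cis) A
        + emeasure \<mu>s A) \<and>
     (\<exists>N\<in>sets borel. emeasure (distr angle_measure borel cis) N = 0 \<and> emeasure \<mu>s (- N) = 0)"

(* Orthogonality to all lower powers of z is orthogonality to all polynomials of lower degree.
   For \<mu> of infinite support, \<Phi> exists and is unique. *)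
definition monic_orthogonal_polys :: "complex measure \<Rightarrow> (nat \<Rightarrow> complex poly) \<Rightarrow> bool" where
  "monic_orthogonal_polys \<mu> \<Phi> \<longleftrightarrow>
     (\<forall>n. degree (\<Phi> n) = n \<and> lead_coeff (\<Phi> n) = 1 \<and>
        (\<forall>k<n. (\<integral>z. cnj (z ^ k) * poly (\<Phi> n) z \<partial>\<mu>) = 0))"

definition verblunsky :: "(nat \<Rightarrow> complex poly) \<Rightarrow> nat \<Rightarrow> complex" where
  "verblunsky \<Phi> n = - cnj (poly (\<Phi> (Suc n)) 0)"

definition in_ell :: "nat \<Rightarrow> (nat \<Rightarrow> complex) \<Rightarrow> bool" where
  "in_ell p a \<longleftrightarrow> summable (\<lambda>n. norm (a n) ^ p)"

definition seq_shift :: "(nat \<Rightarrow> complex) \<Rightarrow> nat \<Rightarrow> complex" where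
  "seq_shift a n = a (Suc n)"

definition shift_minus_one :: "(nat \<Rightarrow> complex) \<Rightarrow> nat \<Rightarrow> complex" where
  "shift_minus_one a n = seq_shift a n - a n"

definition shift_plus_one :: "(nat \<Rightarrow> complex) \<Rightarrow> nat \<Rightarrow> complex" where
  "shift_plus_one a n = seq_shift a n + a n"

(* The library has ln 0 = 0, which would hide the divergence of log w where w vanishes. *)
definition ext_ln :: "real \<Rightarrow> ereal" where
  "ext_ln x = (if x \<le> 0 then - \<infinity> else ereal (ln x))"

(* Integral of the positive part minus integral of the negative part (e2ennreal truncates
   negative values to 0); meaningful unless both are infinite. *)
definition ext_integral :: "'a measure \<Rightarrow> ('a \<Rightarrow> ereal) \<Rightarrow> ereal" where
  "ext_integral M f =
     enn2ereal (\<integral>\<^sup>+ x. e2ennreal (f x) \<partial>M) - enn2ereal (\<integral>\<^sup>+ x. e2ennreal (- f x) \<partial>M)"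

end

theory Submission
  imports Defs "HOL-Complex_Analysis.Complex_Analysis"
begin

text \<open>
  Put \<open>W(\<theta>) = (1 - cos \<theta>)\<^sup>3 (1 + cos \<theta>)\<close> and let \<open>w\<^sub>n = \<parallel>\<Phi>\<^sub>n\<parallel>\<^sup>2 / \<bar>\<Phi>\<^sub>n\<bar>\<^sup>2\<close> be the Bernstein--Szego
  densities.  The entropy \<open>\<integral> W log w\<close> is finite iff the numbers \<open>\<integral> W log w\<^sub>n\<close> are bounded below:
  one direction is \<open>log x \<le> x\<close> for \<open>x = w / w\<^sub>n\<close>, because \<open>\<bar>\<Phi>\<^sub>n\<bar>\<^sup>2 / \<parallel>\<Phi>\<^sub>n\<parallel>\<^sup>2\<close> has \<open>\<mu>\<close>-integral one; for the
  other, \<open>log x \<le> x\<close> for \<open>x = f w\<^sub>n\<close> bounds \<open>\<integral> W log f\<close> by \<open>\<integral> f d\<mu>\<close> for all positive trigonometric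
  polynomials \<open>f\<close>, since \<open>w\<^sub>n\<close> and \<open>\<mu>\<close> have the same moments up to order \<open>n\<close>, and by density for
  \<open>f = max 1 (1 / (w + \<epsilon>))\<close>.

  As \<open>W\<close> has degree four, \<open>\<integral> W log w\<^sub>n\<close> is a sum of explicit expressions in five consecutive
  Verblunsky coefficients.  Its quadratic part is \<open>-\<bar>(S - 1)\<^sup>3 (S + 1) \<alpha>\<bar>\<^sup>2 / 16\<close> up to telescoping
  terms, terms of order six are summable, and modulo summable and telescoping terms every quartic monomial
  equals \<open>\<bar>\<alpha>\<^sub>n\<bar>\<^sup>4\<close>; the quartic coefficients add up to a multiple of \<open>W(0) + W''(0)\<close>, that is, to zero.
\<close>


section \<open>Orthogonal polynomials and the Szego recursion\<close>

text \<open>Let R be the size of five consecutive coefficients and d that of their differences.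
  Replacing a quartic monomial by a fourth power factor by factor costs R^3 d, and 3/6 + 1/3 < 1
  gives no summability; R^2 d^2 is summable, as 2/6 + 2/3 = 1. So the error must be quadratic in d.
  The polarisation in \<open>Re_quartic_identity\<close> achieves this: what is left is an average
  of fourth powers at different indices, which telescopes. Write 16 W as the sum of w_k cos (k
  \<theta>). With all shifts of \<alpha> identified, the quartic part of the k-th Taylor coefficient
  of ln (1 - \<alpha> z b) is -(k^2 - 1)/2 times |\<alpha>|^4 for k = 1, ..., 4, and that of ln (1 -
  |\<alpha>|^2) is -1/2 times it. The total, the sum of w_k (k^2 - 1)/2, is -8 (W(0) + W''(0)), and
  W has a zero of order six at 0. In the second entropy inequality the singular part of \<mu> must
  not see the large values of f, so f is set to 1 on an arc length null set carrying that part.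
  Continuous approximation must then work in L^1 of \<mu> and of arc length at once.\<close>

text \<open>The reversed polynomials \<open>\<Phi>\<^sub>n\<^sup>*\<close>, given by their half of the Szego recursion; that
  \<open>\<Phi>\<^sub>n\<^sup>*(z) = z\<^sup>n cnj (\<Phi>\<^sub>n(z))\<close> on the circle is \<open>rev_poly_circle\<close> below.\<close>

primrec rev_poly :: "(nat \<Rightarrow> complex poly) \<Rightarrow> nat \<Rightarrow> complex poly" where
  "rev_poly \<Phi> 0 = 1"
| "rev_poly \<Phi> (Suc n) = rev_poly \<Phi> n - smult (verblunsky \<Phi> n) (pCons 0 (\<Phi> n))"

locale opuc =
  fixes \<mu> :: "complex measure" and \<Phi> :: "nat \<Rightarrow> complex poly"
  assumes circ: "circle_prob_measure \<mu>"
    and inf_supp: "infinite (measure_supp \<mu>)"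
    and mop: "monic_orthogonal_polys \<mu> \<Phi>"
begin

abbreviation \<psi> where "\<psi> \<equiv> rev_poly \<Phi>"
abbreviation \<alpha> where "\<alpha> \<equiv> verblunsky \<Phi>"

sublocale prob_space \<mu>
  using circ by (simp add: circle_prob_measure_def)

lemma sets_mu [measurable_cong]: "sets \<mu> = sets borel"
  using circ by (simp add: circle_prob_measure_def)

lemma space_mu: "space \<mu> = UNIV"
  using sets_eq_imp_space_eq[OF sets_mu] by simp

lemma AE_circle: "AE z in \<mu>. norm z = 1"
proof (rule AE_I)
  show "{z \<in> space \<mu>. norm z \<noteq> 1} \<subseteq> - sphere 0 1" by auto
  show "emeasure \<mu> (- sphere 0 1) = 0" using circ by (simp add: circle_prob_measure_def)
  show "- sphere 0 1 \<in> sets \<mu>" by (simp add: sets_mu)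
qed

lemma integrable_continuous:
  fixes f :: "complex \<Rightarrow> 'b::{banach, second_countable_topology}"
  assumes "continuous_on UNIV f"
  shows "integrable \<mu> f"
proof -
  have "compact (f ` sphere 0 1)"
    by (intro compact_continuous_image continuous_on_subset[OF assms]) auto
  then obtain B where B: "\<And>z. norm z = 1 \<Longrightarrow> norm (f z) \<le> B"
    using compact_imp_bounded[of "f ` sphere 0 1"] unfolding bounded_iff by fastforce
  have "f \<in> borel_measurable \<mu>"
    using assms by (simp add: borel_measurable_continuous_onI measurable_cong_sets[OF sets_mu refl])
  then show ?thesis
    using AE_circle B by (intro integrable_const_bound[of f B]) auto
qed

text \<open>Identities such as \<open>cnj z * z = 1\<close> hold only on the circle; this admits
  them under the integral.\<close>

lemma integral_circle_cong:
  fixes f g :: "complex \<Rightarrow> 'b::{banach, second_countable_topology}"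
  assumes "continuous_on UNIV f" "continuous_on UNIV g" "\<And>z. norm z = 1 \<Longrightarrow> f z = g z"
  shows "(\<integral>z. f z \<partial>\<mu>) = (\<integral>z. g z \<partial>\<mu>)"
proof (rule integral_cong_AE)
  show "AE z in \<mu>. f z = g z" using AE_circle assms(3) by auto
qed (use assms in \<open>simp_all add: borel_measurable_integrable integrable_continuous\<close>)

text \<open>This is where the infinite support enters: a polynomial of norm zero vanishes almost
  everywhere, so the open set where it is nonzero is null and the support lies among its finitely
  many roots.\<close>

lemma norm_sq_poly_pos:
  assumes "p \<noteq> 0"
  shows "(\<integral>z. (norm (poly p z))\<^sup>2 \<partial>\<mu>) > 0"
proof (rule ccontr)
  assume "\<not> ?thesis"
  moreover have int: "integrable \<mu> (\<lambda>z. (norm (poly p z))\<^sup>2)"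
    by (intro integrable_continuous continuous_intros)
  moreover have "(\<integral>z. (norm (poly p z))\<^sup>2 \<partial>\<mu>) \<ge> 0" by simp
  ultimately have "(\<integral>z. (norm (poly p z))\<^sup>2 \<partial>\<mu>) = 0" by linarith
  then have ae: "AE z in \<mu>. poly p z = 0"
    using integral_nonneg_eq_0_iff_AE[OF int] by simp
  let ?U = "{z. poly p z \<noteq> 0}"
  have op: "open ?U"
    by (intro open_Collect_neq continuous_intros)
  have "emeasure \<mu> ?U = 0"
  proof -
    have "AE z in \<mu>. z \<notin> ?U" using ae by simp
    then show ?thesis
      using AE_iff_measurable[of ?U \<mu> "\<lambda>z. z \<notin> ?U"] op by (auto simp: sets_mu space_mu)
  qed
  then have "measure_supp \<mu> \<subseteq> {z. poly p z = 0}"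
    using op unfolding measure_supp_def by force
  then show False
    using inf_supp poly_roots_finite[OF assms] finite_subset by blast
qed

lemma Phi_degree: "degree (\<Phi> n) = n" and Phi_lead: "coeff (\<Phi> n) n = 1"
  and Phi_orth_power: "k < n \<Longrightarrow> (\<integral>z. cnj (z ^ k) * poly (\<Phi> n) z \<partial>\<mu>) = 0"
proof -
  show *: "degree (\<Phi> n) = n" for n
    using mop by (simp add: monic_orthogonal_polys_def)
  show "coeff (\<Phi> n) n = 1"
    using mop * by (metis monic_orthogonal_polys_def)
  show "k < n \<Longrightarrow> (\<integral>z. cnj (z ^ k) * poly (\<Phi> n) z \<partial>\<mu>) = 0"
    using mop by (simp add: monic_orthogonal_polys_def)
qed

lemma Phi_0: "\<Phi> 0 = 1"
  using degree_0_id[OF Phi_degree[of 0]] Phi_lead[of 0] by (simp add: one_pCons)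

lemma Phi_nonzero: "\<Phi> n \<noteq> 0"
  using Phi_lead[of n] by auto

lemma integral_cnj_poly_mult:
  assumes "continuous_on UNIV f"
  shows "(\<integral>z. cnj (poly p z) * f z \<partial>\<mu>) =
         (\<Sum>i\<le>degree p. cnj (coeff p i) * (\<integral>z. cnj (z ^ i) * f z \<partial>\<mu>))"
proof -
  have "(\<integral>z. cnj (poly p z) * f z \<partial>\<mu>) =
        (\<integral>z. (\<Sum>i\<le>degree p. cnj (coeff p i) * (cnj (z ^ i) * f z)) \<partial>\<mu>)"
    by (simp add: poly_altdef sum_distrib_right mult.assoc)
  also have "\<dots> = (\<Sum>i\<le>degree p. (\<integral>z. cnj (coeff p i) * (cnj (z ^ i) * f z) \<partial>\<mu>))"
    by (intro Bochner_Integration.integral_sum integrable_continuous continuous_intros assms)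
  finally show ?thesis by simp
qed

lemma Phi_orth:
  assumes "degree p < n"
  shows "(\<integral>z. cnj (poly p z) * poly (\<Phi> n) z \<partial>\<mu>) = 0"
proof (subst integral_cnj_poly_mult, intro continuous_intros, rule sum.neutral, intro ballI)
  fix i assume "i \<in> {..degree p}"
  then have "(\<integral>z. cnj (z ^ i) * poly (\<Phi> n) z \<partial>\<mu>) = 0"
    using assms by (intro Phi_orth_power) auto
  then show "cnj (coeff p i) * (\<integral>z. cnj (z ^ i) * poly (\<Phi> n) z \<partial>\<mu>) = 0" by simp
qed

lemma circle_cnj_mult: "norm z = 1 \<Longrightarrow> cnj z * z = 1"
  using complex_norm_square[of z] by (simp add: mult.commute)

lemma rev_poly_degree: "degree (\<psi> n) \<le> n"
proof (induction n)
  case (Suc n)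
  have "degree (smult (\<alpha> n) (pCons 0 (\<Phi> n))) \<le> Suc n"
    by (rule order_trans[OF degree_smult_le order_trans[OF degree_pCons_le]]) (simp add: Phi_degree)
  then show ?case using Suc by (auto intro: degree_diff_le)
qed simp

lemma rev_poly_0 [simp]: "poly (\<psi> n) 0 = 1"
  by (induction n) auto

text \<open>The reversal formula at n is a hypothesis because it is itself proved from the recursion
  at smaller indices; \<open>rev_poly_circle\<close> closes the induction. The error R of the
  recursion has degree at most n, vanishes at 0 and is orthogonal to z, ..., z^n, hence to
  itself.\<close>

lemma Szego_recursion_aux:
  assumes psi: "\<And>z. norm z = 1 \<Longrightarrow> poly (\<psi> n) z = z ^ n * cnj (poly (\<Phi> n) z)"
  shows "\<Phi> (Suc n) = pCons 0 (\<Phi> n) - smult (cnj (\<alpha> n)) (\<psi> n)"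
proof -
  define R where "R = \<Phi> (Suc n) - pCons 0 (\<Phi> n) + smult (cnj (\<alpha> n)) (\<psi> n)"
  have R0: "coeff R 0 = 0"
    using rev_poly_0[of n] by (simp add: R_def verblunsky_def poly_0_coeff_0)
  have "coeff R i = 0" if "i > n" for i
  proof (cases "i = Suc n")
    case True
    then show ?thesis using Phi_lead[of n] Phi_lead[of "Suc n"] rev_poly_degree[of n]
      by (simp add: R_def coeff_eq_0)
  next
    case False
    then show ?thesis using that Phi_degree[of n] Phi_degree[of "Suc n"] rev_poly_degree[of n]
      by (auto simp: R_def coeff_eq_0 coeff_pCons split: nat.split)
  qed
  then have degR: "degree R \<le> n" by (simp add: degree_le)
  have orth: "(\<integral>z. cnj (z ^ k) * poly R z \<partial>\<mu>) = 0" if k: "1 \<le> k" "k \<le> n" for k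
  proof -
    have 1: "(\<integral>z. cnj (z ^ k) * poly (\<Phi> (Suc n)) z \<partial>\<mu>) = 0"
      using Phi_orth_power[of k "Suc n"] k by simp
    have "(\<integral>z. cnj (z ^ k) * (z * poly (\<Phi> n) z) \<partial>\<mu>) =
          (\<integral>z. cnj (z ^ (k - 1)) * poly (\<Phi> n) z \<partial>\<mu>)"
    proof (intro integral_circle_cong continuous_intros)
      fix z :: complex assume z: "norm z = 1"
      have "cnj (z ^ k) * z = cnj (z ^ (k - 1))"
        using k circle_cnj_mult[OF z] by (cases k) (auto simp: algebra_simps)
      then show "cnj (z ^ k) * (z * poly (\<Phi> n) z) = cnj (z ^ (k - 1)) * poly (\<Phi> n) z"
        by (metis mult.assoc)
    qed
    then have 2: "(\<integral>z. cnj (z ^ k) * (z * poly (\<Phi> n) z) \<partial>\<mu>) = 0"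
      using Phi_orth_power[of "k - 1" n] k by simp
    \<comment> \<open>Reversal turns the pairing with z^k into the conjugate of the pairing of
      \<Phi>_n with z^(n-k), and k >= 1 makes n - k < n.\<close>
    have "(\<integral>z. cnj (z ^ k) * poly (\<psi> n) z \<partial>\<mu>) =
          (\<integral>z. cnj (cnj (z ^ (n - k)) * poly (\<Phi> n) z) \<partial>\<mu>)"
    proof (intro integral_circle_cong continuous_intros)
      fix z :: complex assume z: "norm z = 1"
      have "z ^ n = z ^ (n - k) * z ^ k" using k by (simp flip: power_add)
      moreover have "cnj (z ^ k) * z ^ k = 1"
        using circle_cnj_mult[OF z] by (metis complex_cnj_power power_mult_distrib power_one)
      ultimately have "cnj (z ^ k) * z ^ n = z ^ (n - k)"
        by (metis mult.assoc mult.commute mult.right_neutral)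
      then show "cnj (z ^ k) * poly (\<psi> n) z = cnj (cnj (z ^ (n - k)) * poly (\<Phi> n) z)"
        by (simp add: psi[OF z] mult.assoc[symmetric])
    qed
    also have "\<dots> = cnj (\<integral>z. cnj (z ^ (n - k)) * poly (\<Phi> n) z \<partial>\<mu>)"
      by (rule Bochner_Integration.integral_cnj)
    finally have 3: "(\<integral>z. cnj (z ^ k) * poly (\<psi> n) z \<partial>\<mu>) = 0"
      using Phi_orth_power[of "n - k" n] k by simp
    have "(\<integral>z. cnj (z ^ k) * poly R z \<partial>\<mu>) =
      (\<integral>z. cnj (z ^ k) * poly (\<Phi> (Suc n)) z - cnj (z ^ k) * (z * poly (\<Phi> n) z)
         + cnj (\<alpha> n) * (cnj (z ^ k) * poly (\<psi> n) z) \<partial>\<mu>)"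
      by (simp add: R_def algebra_simps)
    also have "\<dots> = (\<integral>z. cnj (z ^ k) * poly (\<Phi> (Suc n)) z \<partial>\<mu>)
        - (\<integral>z. cnj (z ^ k) * (z * poly (\<Phi> n) z) \<partial>\<mu>)
        + (\<integral>z. cnj (\<alpha> n) * (cnj (z ^ k) * poly (\<psi> n) z) \<partial>\<mu>)"
    proof -
      have i: "integrable \<mu> (\<lambda>z. cnj (z ^ k) * poly (\<Phi> (Suc n)) z)"
        "integrable \<mu> (\<lambda>z. cnj (z ^ k) * (z * poly (\<Phi> n) z))"
        "integrable \<mu> (\<lambda>z. cnj (\<alpha> n) * (cnj (z ^ k) * poly (\<psi> n) z))"
        by (intro integrable_continuous continuous_intros)+
      show ?thesis
        by (rule trans[OF Bochner_Integration.integral_add[OF Bochner_Integration.integrable_diff[OF i(1,2)] i(3)]])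
          (simp only: Bochner_Integration.integral_diff[OF i(1,2)])
    qed
    finally show ?thesis using 1 2 3 by simp
  qed
  have "(\<integral>z. cnj (poly R z) * poly R z \<partial>\<mu>) = 0"
  proof (subst integral_cnj_poly_mult, intro continuous_intros, rule sum.neutral, intro ballI)
    fix i assume "i \<in> {..degree R}"
    then show "cnj (coeff R i) * (\<integral>z. cnj (z ^ i) * poly R z \<partial>\<mu>) = 0"
      using R0 orth[of i] degR by (cases "i = 0") auto
  qed
  moreover have "(\<integral>z. cnj (poly R z) * poly R z \<partial>\<mu>) = of_real (\<integral>z. (norm (poly R z))\<^sup>2 \<partial>\<mu>)"
    unfolding integral_complex_of_real[symmetric]
    by (simp only: complex_norm_square mult.commute)
  ultimately have "R = 0" using norm_sq_poly_pos[of R] by (metis less_irrefl of_real_eq_0_iff)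
  then show ?thesis unfolding R_def by (simp add: algebra_simps eq_neg_iff_add_eq_0)
qed

lemma rev_poly_circle: "norm z = 1 \<Longrightarrow> poly (\<psi> n) z = z ^ n * cnj (poly (\<Phi> n) z)"
proof (induction n arbitrary: z)
  case 0
  then show ?case by (simp add: Phi_0)
next
  case (Suc n)
  have rec: "\<Phi> (Suc n) = pCons 0 (\<Phi> n) - smult (cnj (\<alpha> n)) (\<psi> n)"
    by (rule Szego_recursion_aux) (rule Suc.IH)
  have z: "cnj z * z = 1" "cnj (z ^ n) * z ^ n = 1"
    using circle_cnj_mult[OF Suc.prems] by (auto simp flip: power_mult_distrib)
  have "z ^ Suc n * cnj (poly (\<Phi> (Suc n)) z) =
        (cnj z * z) * (z ^ n * cnj (poly (\<Phi> n) z)) - \<alpha> n * z * (z ^ n * cnj (poly (\<psi> n) z))"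
    by (simp add: rec algebra_simps)
  also have "z ^ n * cnj (poly (\<psi> n) z) = (cnj (z ^ n) * z ^ n) * poly (\<Phi> n) z"
    by (simp add: Suc.IH[OF Suc.prems] algebra_simps)
  finally show ?case using z by (simp add: Suc.IH[OF Suc.prems])
qed

lemma Szego_recursion: "\<Phi> (Suc n) = pCons 0 (\<Phi> n) - smult (cnj (\<alpha> n)) (\<psi> n)"
  by (rule Szego_recursion_aux) (rule rev_poly_circle)

lemma norm_rev_poly_circle: "norm z = 1 \<Longrightarrow> norm (poly (\<psi> n) z) = norm (poly (\<Phi> n) z)"
  by (simp add: rev_poly_circle norm_mult norm_power)

section \<open>Norms, size of the Verblunsky coefficients, absence of zeros in the closed
  disc\<close>

definition h :: "nat \<Rightarrow> real" where "h n = (\<integral>z. (norm (poly (\<Phi> n) z))\<^sup>2 \<partial>\<mu>)"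

lemma h_pos: "h n > 0"
  unfolding h_def by (intro norm_sq_poly_pos Phi_nonzero)

lemma h_0: "h 0 = 1"
  by (simp add: h_def Phi_0 prob_space[unfolded space_mu] space_mu)

text \<open>Pythagoras for z \<Phi>_n = \<Phi>_(n+1) + cnj \<alpha>_n \<psi>_n on the circle, where
  \<Phi>_n and \<psi>_n have equal modulus; the mixed term vanishes because \<psi>_n has degree at
  most n.\<close>

lemma h_Suc: "h (Suc n) = (1 - (norm (\<alpha> n))\<^sup>2) * h n"
proof -
  have "h n = (\<integral>z. (norm (poly (\<Phi> (Suc n)) z))\<^sup>2 + (norm (\<alpha> n))\<^sup>2 * (norm (poly (\<Phi> n) z))\<^sup>2
          + 2 * Re (cnj (\<alpha> n) * cnj (poly (\<Phi> (Suc n)) z) * poly (\<psi> n) z) \<partial>\<mu>)"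
    unfolding h_def
  proof (intro integral_circle_cong continuous_intros)
    fix z :: complex assume z: "norm z = 1"
    let ?P = "poly (\<Phi> (Suc n)) z" and ?s = "poly (\<psi> n) z"
    have "z * poly (\<Phi> n) z = ?P + cnj (\<alpha> n) * ?s" by (simp add: Szego_recursion)
    then have "norm (poly (\<Phi> n) z) = norm (?P + cnj (\<alpha> n) * ?s)"
      using z by (metis mult.left_neutral norm_mult)
    moreover have "(norm (a + b))\<^sup>2 = (norm a)\<^sup>2 + (norm b)\<^sup>2 + 2 * Re (cnj a * b)" for a b :: complex
      unfolding cmod_power2 by (simp add: algebra_simps power2_eq_square)
    ultimately have "(norm (poly (\<Phi> n) z))\<^sup>2 = (norm ?P)\<^sup>2 + (norm (\<alpha> n))\<^sup>2 * (norm ?s)\<^sup>2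
        + 2 * Re (cnj ?P * (cnj (\<alpha> n) * ?s))"
      by (simp add: norm_mult power_mult_distrib)
    then show "(norm (poly (\<Phi> n) z))\<^sup>2 = (norm (poly (\<Phi> (Suc n)) z))\<^sup>2
        + (norm (\<alpha> n))\<^sup>2 * (norm (poly (\<Phi> n) z))\<^sup>2
        + 2 * Re (cnj (\<alpha> n) * cnj (poly (\<Phi> (Suc n)) z) * poly (\<psi> n) z)"
      using norm_rev_poly_circle[OF z, of n] by (simp only: mult_ac)
  qed
  also have "\<dots> = h (Suc n) + (norm (\<alpha> n))\<^sup>2 * h n
      + (\<integral>z. 2 * Re (cnj (\<alpha> n) * cnj (poly (\<Phi> (Suc n)) z) * poly (\<psi> n) z) \<partial>\<mu>)"
  proof -
    have i: "integrable \<mu> (\<lambda>z. (norm (poly (\<Phi> (Suc n)) z))\<^sup>2)"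
      "integrable \<mu> (\<lambda>z. (norm (\<alpha> n))\<^sup>2 * (norm (poly (\<Phi> n) z))\<^sup>2)"
      "integrable \<mu> (\<lambda>z. 2 * Re (cnj (\<alpha> n) * cnj (poly (\<Phi> (Suc n)) z) * poly (\<psi> n) z))"
      by (intro integrable_continuous continuous_intros)+
    show ?thesis
      unfolding h_def
      by (rule trans[OF Bochner_Integration.integral_add[OF Bochner_Integration.integrable_add[OF i(1,2)] i(3)]])
        (simp only: Bochner_Integration.integral_add[OF i(1,2)] Bochner_Integration.integral_mult_right_zero)
  qed
  finally have 1: "h n = h (Suc n) + (norm (\<alpha> n))\<^sup>2 * h n
      + (\<integral>z. 2 * Re (cnj (\<alpha> n) * cnj (poly (\<Phi> (Suc n)) z) * poly (\<psi> n) z) \<partial>\<mu>)" .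
  have 2: "(\<integral>z. 2 * Re (cnj (\<alpha> n) * cnj (poly (\<Phi> (Suc n)) z) * poly (\<psi> n) z) \<partial>\<mu>) =
     2 * Re (\<integral>z. cnj (\<alpha> n) * cnj (poly (\<Phi> (Suc n)) z) * poly (\<psi> n) z \<partial>\<mu>)"
  proof -
    have "integrable \<mu> (\<lambda>z. cnj (\<alpha> n) * cnj (poly (\<Phi> (Suc n)) z) * poly (\<psi> n) z)"
      by (intro integrable_continuous continuous_intros)
    from integral_Re[OF this] show ?thesis
      by (simp only: Bochner_Integration.integral_mult_right_zero)
  qed
  have 3: "(\<integral>z. cnj (\<alpha> n) * cnj (poly (\<Phi> (Suc n)) z) * poly (\<psi> n) z \<partial>\<mu>) =
     cnj (\<alpha> n) * cnj (\<integral>z. cnj (poly (\<psi> n) z) * poly (\<Phi> (Suc n)) z \<partial>\<mu>)"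
    unfolding Bochner_Integration.integral_cnj[symmetric] Bochner_Integration.integral_mult_right_zero[symmetric]
    by (simp only: complex_cnj_mult complex_cnj_cnj mult_ac)
  have 4: "(\<integral>z. cnj (poly (\<psi> n) z) * poly (\<Phi> (Suc n)) z \<partial>\<mu>) = 0"
    using rev_poly_degree[of n] by (intro Phi_orth) simp
  have "h n = h (Suc n) + (norm (\<alpha> n))\<^sup>2 * h n"
    using 1 unfolding 2 3 4 by simp
  then show ?thesis unfolding left_diff_distrib by linarith
qed

lemma alpha_less_1: "norm (\<alpha> n) < 1"
proof -
  have "1 - (norm (\<alpha> n))\<^sup>2 > 0"
    using h_Suc[of n] h_pos[of n] h_pos[of "Suc n"] by (simp add: zero_less_mult_iff)
  then show ?thesis using power2_less_imp_less[of "norm (\<alpha> n)" 1] by simp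
qed

text \<open>A disc automorphism preserves the closed disc, with the denominator cleared: the
  difference of the squared norms factors as (1 - |a|^2)(1 - |b|^2).\<close>

lemma Moebius_norm_le:
  fixes a b :: complex
  assumes "norm a < 1" "norm b \<le> 1"
  shows "norm (b - cnj a) \<le> norm (1 - a * b)"
proof -
  have "(norm (1 - a * b))\<^sup>2 - (norm (b - cnj a))\<^sup>2 = (1 - (norm a)\<^sup>2) * (1 - (norm b)\<^sup>2)"
    unfolding cmod_power2 by (simp add: algebra_simps power2_eq_square)
  also have "\<dots> \<ge> 0"
    using assms by (intro mult_nonneg_nonneg) (auto simp: power_le_one abs_square_le_1)
  finally have "(norm (b - cnj a))\<^sup>2 \<le> (norm (1 - a * b))\<^sup>2" by linarith
  then show ?thesis by (rule power2_le_imp_le) simp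
qed

text \<open>Both claims are carried through one induction: with b = z \<Phi>_n / \<psi>_n of modulus
  at most one, \<psi>_(n+1) = \<psi>_n (1 - \<alpha>_n b) cannot vanish, and \<Phi>_(n+1) /
  \<psi>_(n+1) is a Moebius image of b.\<close>

lemma rev_poly_nonzero_and_le:
  "norm z \<le> 1 \<Longrightarrow> poly (\<psi> n) z \<noteq> 0 \<and> norm (poly (\<Phi> n) z) \<le> norm (poly (\<psi> n) z)"
proof (induction n)
  case 0
  then show ?case by (simp add: Phi_0)
next
  case (Suc n)
  let ?s = "poly (\<psi> n) z" and ?b = "z * poly (\<Phi> n) z / poly (\<psi> n) z"
  have s: "?s \<noteq> 0" "norm (poly (\<Phi> n) z) \<le> norm ?s" using Suc by auto
  have "norm (z * poly (\<Phi> n) z) \<le> 1 * norm ?s"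
    unfolding norm_mult using s Suc.prems by (intro mult_mono) auto
  then have b: "norm ?b \<le> 1" using s by (simp add: norm_divide divide_le_eq_1)
  have e1: "poly (\<psi> (Suc n)) z = ?s * (1 - \<alpha> n * ?b)" using s by (simp add: field_simps)
  have e2: "poly (\<Phi> (Suc n)) z = ?s * (?b - cnj (\<alpha> n))"
    using s by (simp add: field_simps Szego_recursion)
  have "norm (\<alpha> n * ?b) < 1"
    using alpha_less_1[of n] b mult_left_le[OF b norm_ge_zero[of "\<alpha> n"]]
    unfolding norm_mult by linarith
  then have "1 - \<alpha> n * ?b \<noteq> 0" by (metis eq_iff_diff_eq_0 less_irrefl norm_one)
  then show ?case
    unfolding e1 e2 norm_mult using s Moebius_norm_le[OF alpha_less_1 b, of n]
    by (auto intro: mult_left_mono)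
qed

lemmas rev_poly_nonzero = rev_poly_nonzero_and_le[THEN conjunct1]
lemmas Phi_le_rev_poly = rev_poly_nonzero_and_le[THEN conjunct2]

end

section \<open>Circle means against the weight\<close>

lemma angle_measure_density:
  "angle_measure = density lborel (\<lambda>x. ennreal (indicator {0..2 * pi} x / (2 * pi)))"
proof -
  have "indicator {0..2 * pi} x / ennreal (2 * pi) = ennreal (indicator {0..2 * pi} x / (2 * pi))" for x :: real
    by (cases "x \<in> {0..2 * pi}") (auto simp: divide_ennreal simp flip: ennreal_1)
  then show ?thesis by (simp add: angle_measure_def uniform_measure_def)
qed

lemma prob_space_angle_measure: "prob_space angle_measure"
  unfolding angle_measure_def by (rule prob_space_uniform_measure) auto

lemma sets_angle_measure [measurable_cong, simp]: "sets angle_measure = sets borel"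
  by (simp add: angle_measure_def)

lemma space_angle_measure [simp]: "space angle_measure = UNIV"
  by (simp add: angle_measure_def)

lemma measurable_angle_measure: "measurable angle_measure N = measurable borel N"
  by (rule measurable_cong_sets) auto

text \<open>Bridge to the gauge integral, in which contour integrals are expressed.\<close>

lemma angle_measure_integrable_continuous:
  fixes f :: "real \<Rightarrow> 'a::euclidean_space"
  assumes "continuous_on UNIV f"
  shows "integrable angle_measure f"
    and "integral\<^sup>L angle_measure f = integral {0..2 * pi} f /\<^sub>R (2 * pi)"
proof -
  have f: "f \<in> borel_measurable lborel"
    using borel_measurable_continuous_onI[OF assms] by simp
  have si: "set_integrable lborel {0..2 * pi} f"
    by (intro borel_integrable_atLeastAtMost' continuous_on_subset[OF assms]) auto
  have eq: "(\<lambda>x. (indicator {0..2 * pi} x / (2 * pi)) *\<^sub>R f x) =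
      (\<lambda>x. (1 / (2 * pi)) *\<^sub>R (indicator {0..2 * pi} x *\<^sub>R f x))"
    by auto
  have int: "integrable lborel (\<lambda>x. (indicator {0..2 * pi} x / (2 * pi)) *\<^sub>R f x)"
    unfolding eq using si unfolding set_integrable_def by (intro integrable_scaleR_right) auto
  show "integrable angle_measure f"
    unfolding angle_measure_density by (subst integrable_density) (use f int in auto)
  have "integral\<^sup>L angle_measure f = (\<integral>x. (indicator {0..2 * pi} x / (2 * pi)) *\<^sub>R f x \<partial>lborel)"
    unfolding angle_measure_density by (subst integral_density) (use f in auto)
  also have "\<dots> = (1 / (2 * pi)) *\<^sub>R (LINT x:{0..2 * pi}|lborel. f x)"
    unfolding eq set_lebesgue_integral_def by (rule integral_scaleR_right)
  finally show "integral\<^sup>L angle_measure f = integral {0..2 * pi} f /\<^sub>R (2 * pi)"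
    unfolding set_borel_integral_eq_integral(2)[OF si] inverse_eq_divide .
qed

lemma continuous_on_cis_compose:
  assumes "continuous_on (sphere 0 1) F"
  shows "continuous_on UNIV (\<lambda>\<theta>. F (cis \<theta>))"
  by (rule continuous_on_compose2[OF assms]) (auto intro!: continuous_intros)

text \<open>Cauchy's formula for derivatives, on the unit circle itself, where continuity up to the
  boundary is enough.\<close>

lemma circle_mean_Taylor:
  assumes "continuous_on (cball 0 1) f" "f holomorphic_on ball 0 1"
  shows "(\<integral>\<theta>. f (cis \<theta>) / cis \<theta> ^ k \<partial>angle_measure) = fps_nth (fps_expansion f 0) k"
proof -
  have cont: "continuous_on UNIV (\<lambda>\<theta>. f (cis \<theta>) / cis \<theta> ^ k)"
    by (rule continuous_on_cis_compose[of "\<lambda>z. f z / z ^ k"])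
       (auto intro!: continuous_intros continuous_on_subset[OF assms(1)])
  have "((\<lambda>u. f u / (u - 0) ^ Suc k) has_contour_integral
      (2 * pi * \<i>) / fact k * (deriv ^^ k) f 0) (circlepath 0 1)"
    by (rule Cauchy_has_contour_integral_higher_derivative_circlepath) (use assms in auto)
  then have "((\<lambda>t. f (cis t) / cis t ^ Suc k * \<i> * cis t) has_integral
      (2 * pi * \<i>) / fact k * (deriv ^^ k) f 0) {0..2 * pi}"
    unfolding circlepath_def by (subst (asm) has_contour_integral_part_circlepath_iff) auto
  moreover have "(\<lambda>t. f (cis t) / cis t ^ Suc k * \<i> * cis t) = (\<lambda>t. \<i> * (f (cis t) / cis t ^ k))"
    by (auto simp: fun_eq_iff field_simps)
  ultimately have "integral {0..2 * pi} (\<lambda>t. \<i> * (f (cis t) / cis t ^ k)) =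
      (2 * pi * \<i>) / fact k * (deriv ^^ k) f 0"
    by (metis integral_unique)
  moreover have "integral {0..2 * pi} (\<lambda>t. \<i> * (f (cis t) / cis t ^ k)) =
      \<i> * integral {0..2 * pi} (\<lambda>t. f (cis t) / cis t ^ k)"
    by (rule integral_mult_right)
  ultimately have "\<i> * integral {0..2 * pi} (\<lambda>t. f (cis t) / cis t ^ k) =
      (2 * pi * \<i>) / fact k * (deriv ^^ k) f 0"
    by simp
  then have "integral {0..2 * pi} (\<lambda>t. f (cis t) / cis t ^ k) = (2 * pi) / fact k * (deriv ^^ k) f 0"
    by (simp add: field_simps)
  then show ?thesis
    unfolding angle_measure_integrable_continuous(2)[OF cont]
    by (simp add: fps_expansion_def scaleR_conv_of_real field_simps)
qed

text \<open>The mean is the value of f(z) z^k at 0.\<close>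

lemma circle_mean_power:
  assumes "continuous_on (cball 0 1) f" "f holomorphic_on ball 0 1" "k > 0"
  shows "(\<integral>\<theta>. f (cis \<theta>) * cis \<theta> ^ k \<partial>angle_measure) = 0"
proof -
  have "(\<integral>\<theta>. f (cis \<theta>) * cis \<theta> ^ k / cis \<theta> ^ 0 \<partial>angle_measure) =
      fps_nth (fps_expansion (\<lambda>z. f z * z ^ k) 0) 0"
    by (rule circle_mean_Taylor) (intro continuous_intros holomorphic_intros assms)+
  then show ?thesis using assms(3) by (simp add: fps_expansion_def)
qed

definition weight :: "real \<Rightarrow> real" where "weight \<theta> = (1 - cos \<theta>) ^ 3 * (1 + cos \<theta>)"

lemma one_plus_cos_nonneg: "0 \<le> 1 + cos \<theta>" for \<theta> :: real
  using cos_ge_minus_one[of \<theta>] by linarith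

lemma weight_nonneg: "weight \<theta> \<ge> 0"
  unfolding weight_def by (intro mult_nonneg_nonneg zero_le_power one_plus_cos_nonneg) simp

lemma weight_le: "weight \<theta> \<le> 16"
proof -
  have "weight \<theta> \<le> 2 ^ 3 * 2"
    unfolding weight_def using cos_ge_minus_one[of \<theta>] cos_le_one[of \<theta>]
    by (intro mult_mono power_mono one_plus_cos_nonneg) simp_all
  then show ?thesis by simp
qed

lemma continuous_weight: "continuous_on S weight"
  unfolding weight_def by (intro continuous_intros)

lemma cos_multiple_cis: "complex_of_real (cos (real k * \<theta>)) = (cis \<theta> ^ k + 1 / cis \<theta> ^ k) / 2"
proof -
  have 1: "cis \<theta> ^ k = cis (real k * \<theta>)" by (rule Complex.DeMoivre)
  have 2: "1 / cis x = cis (- x)" for x by (simp add: cis_divide[of 0, simplified])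
  show ?thesis unfolding 1 2 by (simp add: complex_eq_iff)
qed

text \<open>The cosines are split into positive and negative powers of \<open>cis \<theta>\<close>
  because these act differently on holomorphic functions. In terms of cosines, 16 W has the
  coefficients 10, -8, -8, 8, -2, the source of all those in the sum rule.\<close>

lemma weight_Fourier: "complex_of_real (weight \<theta>) = 
   (10 - 4 * (cis \<theta> ^ 1 + 1 / cis \<theta> ^ 1) - 4 * (cis \<theta> ^ 2 + 1 / cis \<theta> ^ 2)
    + 4 * (cis \<theta> ^ 3 + 1 / cis \<theta> ^ 3) - (cis \<theta> ^ 4 + 1 / cis \<theta> ^ 4)) / 16"
proof -
  define c where "c = cos \<theta>"
  have c2: "cos (2 * \<theta>) = 2 * c\<^sup>2 - 1" by (simp add: c_def cos_double_cos)
  have c3: "cos (3 * \<theta>) = 4 * c ^ 3 - 3 * c" by (simp add: c_def cos_treble_cos)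
  have c4: "cos (4 * \<theta>) = 2 * (2 * c\<^sup>2 - 1)\<^sup>2 - 1"
    using cos_double_cos[of "2 * \<theta>"] by (simp add: c2)
  have "weight \<theta> = (10 - 8 * cos (real 1 * \<theta>) - 8 * cos (real 2 * \<theta>) + 8 * cos (real 3 * \<theta>)
       - 2 * cos (real 4 * \<theta>)) / 16"
    unfolding weight_def of_nat_numeral c2 c3 c4
    by (simp add: c_def[symmetric] field_simps eval_nat_numeral)
  then have "complex_of_real (weight \<theta>) = complex_of_real ((10 - 8 * cos (real 1 * \<theta>) - 8 * cos (real 2 * \<theta>)
       + 8 * cos (real 3 * \<theta>) - 2 * cos (real 4 * \<theta>)) / 16)"
    by (rule arg_cong)
  also have "\<dots> = (10 - 8 * complex_of_real (cos (real 1 * \<theta>))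
       - 8 * complex_of_real (cos (real 2 * \<theta>)) + 8 * complex_of_real (cos (real 3 * \<theta>))
       - 2 * complex_of_real (cos (real 4 * \<theta>))) / 16"
    by (simp only: of_real_diff of_real_add of_real_mult of_real_divide of_real_numeral)
  also have "\<dots> = (10 - 4 * (cis \<theta> ^ 1 + 1 / cis \<theta> ^ 1) - 4 * (cis \<theta> ^ 2 + 1 / cis \<theta> ^ 2)
    + 4 * (cis \<theta> ^ 3 + 1 / cis \<theta> ^ 3) - (cis \<theta> ^ 4 + 1 / cis \<theta> ^ 4)) / 16"
  proof -
    have "(10 - 8 * (p / 2) - 8 * (q / 2) + 8 * (r / 2) - 2 * (s / 2)) / 16 = (10 - 4 * p - 4 * q + 4 * r - s) / 16"
      for p q r s :: complex by (simp add: field_simps)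
    then show ?thesis unfolding cos_multiple_cis .
  qed
  finally show ?thesis .
qed

text \<open>Positive powers of \<open>cis \<theta>\<close> integrate to zero against f and negative
  ones pick out Taylor coefficients.\<close>

lemma integral_weight_holomorphic:
  assumes f: "continuous_on (cball 0 1) f" "f holomorphic_on ball 0 1"
  defines "c \<equiv> fps_nth (fps_expansion f 0)"
  shows "(\<integral>\<theta>. of_real (weight \<theta>) * f (cis \<theta>) \<partial>angle_measure) = (10 * c 0 - 4 * c 1 - 4 * c 2 + 4 * c 3 - c 4) / 16"
proof -
  have fs: "continuous_on (sphere 0 1) f" by (rule continuous_on_subset[OF f(1)]) auto
  have i1: "integrable angle_measure (\<lambda>\<theta>. f (cis \<theta>) * cis \<theta> ^ k)" for k
    by (rule angle_measure_integrable_continuous(1),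
        rule continuous_on_cis_compose[of "\<lambda>z. f z * z ^ k"]) (intro continuous_intros fs)
  have i2: "integrable angle_measure (\<lambda>\<theta>. f (cis \<theta>) / cis \<theta> ^ k)" for k
    by (rule angle_measure_integrable_continuous(1),
        rule continuous_on_cis_compose[of "\<lambda>z. f z / z ^ k"]) (auto intro!: continuous_intros fs)
  have b0: "has_bochner_integral angle_measure (\<lambda>\<theta>. f (cis \<theta>)) (c 0)"
    using i2[of 0] circle_mean_Taylor[OF f, of 0] by (simp add: has_bochner_integral_iff c_def)
  have b: "has_bochner_integral angle_measure (\<lambda>\<theta>. f (cis \<theta>) * cis \<theta> ^ k + f (cis \<theta>) / cis \<theta> ^ k) (c k)" if "k > 0" for k
    using has_bochner_integral_add[of angle_measure _ 0 _ "c k"] i1[of k] i2[of k]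
      circle_mean_Taylor[OF f, of k] circle_mean_power[OF f that]
    by (fastforce simp: has_bochner_integral_iff c_def)
  have "has_bochner_integral angle_measure (\<lambda>\<theta>. 1/16 * (10 * f (cis \<theta>)
      - 4 * (f (cis \<theta>) * cis \<theta> ^ 1 + f (cis \<theta>) / cis \<theta> ^ 1)
      - 4 * (f (cis \<theta>) * cis \<theta> ^ 2 + f (cis \<theta>) / cis \<theta> ^ 2)
      + 4 * (f (cis \<theta>) * cis \<theta> ^ 3 + f (cis \<theta>) / cis \<theta> ^ 3)
      - (f (cis \<theta>) * cis \<theta> ^ 4 + f (cis \<theta>) / cis \<theta> ^ 4)))
      (1/16 * (10 * c 0 - 4 * c 1 - 4 * c 2 + 4 * c 3 - c 4))"
    by (intro has_bochner_integral_mult_right has_bochner_integral_diff has_bochner_integral_add b b0) simp_all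
  moreover have "(\<lambda>\<theta>. 1/16 * (10 * f (cis \<theta>)
      - 4 * (f (cis \<theta>) * cis \<theta> ^ 1 + f (cis \<theta>) / cis \<theta> ^ 1)
      - 4 * (f (cis \<theta>) * cis \<theta> ^ 2 + f (cis \<theta>) / cis \<theta> ^ 2)
      + 4 * (f (cis \<theta>) * cis \<theta> ^ 3 + f (cis \<theta>) / cis \<theta> ^ 3)
      - (f (cis \<theta>) * cis \<theta> ^ 4 + f (cis \<theta>) / cis \<theta> ^ 4))) = (\<lambda>\<theta>. of_real (weight \<theta>) * f (cis \<theta>))"
    unfolding weight_Fourier by (auto simp: fun_eq_iff algebra_simps add_divide_distrib diff_divide_distrib)
  ultimately have "has_bochner_integral angle_measure (\<lambda>\<theta>. of_real (weight \<theta>) * f (cis \<theta>))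
      (1/16 * (10 * c 0 - 4 * c 1 - 4 * c 2 + 4 * c 3 - c 4))"
    by (simp only:)
  from has_bochner_integral_integral_eq[OF this] show ?thesis by simp
qed

section \<open>Sequences with bounded partial sums\<close>

text \<open>The working notion of a negligible sequence: it covers summable terms as well as
  differences f(n + k) - f(n) of bounded sequences, and it suffices because only bounds on partial
  sums matter.\<close>

definition bounded_sums :: "(nat \<Rightarrow> real) \<Rightarrow> bool" where
  "bounded_sums f \<longleftrightarrow> (\<exists>B. \<forall>N. \<bar>\<Sum>n<N. f n\<bar> \<le> B)"

lemma bounded_sums_add:
  assumes "bounded_sums f" "bounded_sums g"
  shows "bounded_sums (\<lambda>n. f n + g n)"
proof -
  obtain B C where "\<And>N. \<bar>\<Sum>n<N. f n\<bar> \<le> B" "\<And>N. \<bar>\<Sum>n<N. g n\<bar> \<le> C"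
    using assms unfolding bounded_sums_def by metis
  then have "\<bar>\<Sum>n<N. f n + g n\<bar> \<le> B + C" for N
    unfolding sum.distrib by (meson abs_triangle_ineq add_mono order_trans)
  then show ?thesis unfolding bounded_sums_def by blast
qed

lemma bounded_sums_cmult:
  assumes "bounded_sums f"
  shows "bounded_sums (\<lambda>n. c * f n)"
proof -
  obtain B where "\<And>N. \<bar>\<Sum>n<N. f n\<bar> \<le> B"
    using assms unfolding bounded_sums_def by metis
  then have "\<bar>\<Sum>n<N. c * f n\<bar> \<le> \<bar>c\<bar> * B" for N
    unfolding sum_distrib_left[symmetric] abs_mult by (intro mult_left_mono) auto
  then show ?thesis unfolding bounded_sums_def by blast
qed

lemma bounded_sums_diff:
  assumes "bounded_sums f" "bounded_sums g"
  shows "bounded_sums (\<lambda>n. f n - g n)"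
  using bounded_sums_add[OF assms(1) bounded_sums_cmult[OF assms(2), of "-1"]] by simp

lemma bounded_sums_summable:
  assumes "summable (\<lambda>n. \<bar>f n\<bar>)"
  shows "bounded_sums f"
  unfolding bounded_sums_def
proof (intro exI allI)
  fix N
  have "\<bar>\<Sum>n<N. f n\<bar> \<le> (\<Sum>n<N. \<bar>f n\<bar>)" by (rule sum_abs)
  also have "\<dots> \<le> (\<Sum>n. \<bar>f n\<bar>)" by (rule sum_le_suminf[OF assms]) auto
  finally show "\<bar>\<Sum>n<N. f n\<bar> \<le> (\<Sum>n. \<bar>f n\<bar>)" .
qed

lemma bounded_sums_le:
  assumes "summable g" "\<And>n. \<bar>f n\<bar> \<le> C * g n"
  shows "bounded_sums f"
proof (rule bounded_sums_summable)
  show "summable (\<lambda>n. \<bar>f n\<bar>)"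
    by (rule summable_comparison_test'[OF summable_mult[OF assms(1), of C], of 0]) (use assms(2) in simp)
qed

lemma bounded_sums_telescope:
  assumes "\<And>n. \<bar>f n\<bar> \<le> C"
  shows "bounded_sums (\<lambda>n. f (n + k) - f n)"
proof (induction k)
  case 0
  then show ?case by (auto simp: bounded_sums_def)
next
  case (Suc k)
  have "bounded_sums (\<lambda>n. f (Suc (n + k)) - f (n + k))"
    unfolding bounded_sums_def
  proof (intro exI allI)
    fix N
    have "(\<Sum>n<N. f (Suc (n + k)) - f (n + k)) = f (N + k) - f k"
      using sum_lessThan_telescope[of "\<lambda>n. f (n + k)" N] by simp
    then show "\<bar>\<Sum>n<N. f (Suc (n + k)) - f (n + k)\<bar> \<le> 2 * C"
      using assms[of "N + k"] assms[of k] by linarith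
  qed
  from bounded_sums_add[OF this Suc] show ?case by simp
qed

lemma add_power_le:
  fixes x y :: real
  assumes "x \<ge> 0" "y \<ge> 0"
  shows "(x + y) ^ p \<le> 2 ^ p * (x ^ p + y ^ p)"
proof -
  have "(x + y) ^ p \<le> (2 * max x y) ^ p" using assms by (intro power_mono) auto
  also have "\<dots> = 2 ^ p * max x y ^ p" by (simp add: power_mult_distrib)
  also have "\<dots> \<le> 2 ^ p * (x ^ p + y ^ p)"
    using assms by (intro mult_left_mono) (auto simp: max_def)
  finally show ?thesis .
qed

lemma summable_power_add:
  fixes f g :: "nat \<Rightarrow> real"
  assumes "\<And>n. f n \<ge> 0" "\<And>n. g n \<ge> 0" "summable (\<lambda>n. f n ^ p)" "summable (\<lambda>n. g n ^ p)"
  shows "summable (\<lambda>n. (f n + g n) ^ p)"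
proof (rule summable_comparison_test')
  show "summable (\<lambda>n. 2 ^ p * (f n ^ p + g n ^ p))"
    using assms by (intro summable_mult summable_add)
  show "norm ((f n + g n) ^ p) \<le> 2 ^ p * (f n ^ p + g n ^ p)" for n
    using add_power_le[of "f n" "g n" p] assms(1,2)[of n] by simp
qed

text \<open>Twice polarising the product leaves only squares of differences.\<close>

lemma Re_quartic_identity:
  fixes p q r s :: complex
  shows "Re (p * q * cnj r * cnj s) - ((norm p)^4 + (norm q)^4 + (norm r)^4 + (norm s)^4) / 4 =
    - (norm (p * q - r * s))\<^sup>2 / 2 - ((norm p)\<^sup>2 - (norm q)\<^sup>2)\<^sup>2 / 4 - ((norm r)\<^sup>2 - (norm s)\<^sup>2)\<^sup>2 / 4"
proof -
  have pow4: "(norm z)^4 = ((norm z)\<^sup>2)\<^sup>2" for z :: complex by simp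
  have 1: "(norm (a - b))\<^sup>2 = (norm a)\<^sup>2 + (norm b)\<^sup>2 - 2 * Re (a * cnj b)" for a b :: complex
    unfolding cmod_power2 by (simp add: algebra_simps power2_eq_square)
  have 2: "p * q * cnj r * cnj s = (p * q) * cnj (r * s)" by simp
  show ?thesis
    unfolding 1 2 pow4 norm_mult power_mult_distrib by (simp add: field_simps power2_eq_square)
qed

text \<open>Each square in \<open>Re_quartic_identity\<close> is at most 4 R^2 d^2: the first by pq
  - rs = p(q - s) + s(p - r), the others by (|a| + |b|)(|a| - |b|). The weights 1/2, 1/4, 1/4 then
  give the constant 4.\<close>

lemma Re_quartic_bound:
  fixes p q r s :: complex
  assumes "norm p \<le> R" "norm q \<le> R" "norm r \<le> R" "norm s \<le> R"
    and "norm (p - r) \<le> d" "norm (q - s) \<le> d" "norm (p - q) \<le> d" "norm (r - s) \<le> d"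
  shows "\<bar>Re (p * q * cnj r * cnj s) - ((norm p)^4 + (norm q)^4 + (norm r)^4 + (norm s)^4) / 4\<bar>
     \<le> 4 * (R\<^sup>2 * d\<^sup>2)"
proof -
  have R: "R \<ge> 0" and d: "d \<ge> 0" using assms norm_ge_zero order_trans by blast+
  have "norm (p * q - r * s) = norm (p * (q - s) + s * (p - r))" by (simp add: algebra_simps)
  also have "\<dots> \<le> norm p * norm (q - s) + norm s * norm (p - r)"
    by (metis norm_mult norm_triangle_ineq)
  also have "\<dots> \<le> R * d + R * d" using assms R d by (intro add_mono mult_mono) auto
  finally have "(norm (p * q - r * s))\<^sup>2 \<le> (2 * (R * d))\<^sup>2" by (intro power_mono) auto
  then have 1: "(norm (p * q - r * s))\<^sup>2 \<le> 4 * (R\<^sup>2 * d\<^sup>2)" by (simp add: power_mult_distrib)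
  have 2: "((norm a)\<^sup>2 - (norm b)\<^sup>2)\<^sup>2 \<le> 4 * (R\<^sup>2 * d\<^sup>2)"
    if "norm a \<le> R" "norm b \<le> R" "norm (a - b) \<le> d" for a b :: complex
  proof -
    have "\<bar>(norm a)\<^sup>2 - (norm b)\<^sup>2\<bar> = (norm a + norm b) * \<bar>norm a - norm b\<bar>"
      by (simp add: power2_eq_square square_diff_square_factored abs_mult)
    also have "\<dots> \<le> (2 * R) * d"
      using that R norm_triangle_ineq3[of a b] by (intro mult_mono) auto
    finally have "\<bar>(norm a)\<^sup>2 - (norm b)\<^sup>2\<bar>\<^sup>2 \<le> ((2 * R) * d)\<^sup>2" by (intro power_mono) auto
    then show ?thesis by (simp add: power_mult_distrib)
  qed
  show ?thesis
    unfolding Re_quartic_identity abs_le_iff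
    using 1 2[OF assms(1,2,7)] 2[OF assms(3,4,8)]
      zero_le_power2[of "norm (p * q - r * s)"] zero_le_power2[of "(norm p)\<^sup>2 - (norm q)\<^sup>2"]
      zero_le_power2[of "(norm r)\<^sup>2 - (norm s)\<^sup>2"] by linarith
qed

text \<open>The function inside the modulus has derivative -x^2 / (1 - x), which lies between -2 x^2
  and 0 on [0, 1/2], while s^3 has derivative 3 x^2.\<close>

lemma ln_one_minus_cubic_bound:
  fixes s :: real
  assumes "0 \<le> s" "s \<le> 1/2"
  shows "\<bar>ln (1 - s) + s + s\<^sup>2 / 2\<bar> \<le> s ^ 3"
proof -
  define f where "f = (\<lambda>s::real. ln (1 - s) + s + s\<^sup>2 / 2)"
  have D: "(f has_real_derivative - (x\<^sup>2 / (1 - x))) (at x)" if "x \<le> 1/2" for x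
  proof -
    have "(f has_real_derivative - 1 / (1 - x) + 1 + x) (at x)"
      unfolding f_def using that by (auto intro!: derivative_eq_intros)
    also have "- 1 / (1 - x) + 1 + x = - (x\<^sup>2 / (1 - x))"
      using that by (simp add: field_simps power2_eq_square)
    finally show ?thesis .
  qed
  have "f s \<le> f 0"
  proof (rule DERIV_nonpos_imp_nonincreasing[OF assms(1)])
    fix x assume "0 \<le> x" "x \<le> s"
    then show "\<exists>y. (f has_real_derivative y) (at x) \<and> y \<le> 0"
      using D[of x] assms by (intro exI[of _ "- (x\<^sup>2 / (1 - x))"]) auto
  qed
  moreover have "f 0 + 0 ^ 3 \<le> f s + s ^ 3"
  proof (rule DERIV_nonneg_imp_nondecreasing[OF assms(1), of "\<lambda>x. f x + x ^ 3"])
    fix x assume x: "0 \<le> x" "x \<le> s"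
    have "((\<lambda>x. f x + x ^ 3) has_real_derivative - (x\<^sup>2 / (1 - x)) + 3 * x\<^sup>2) (at x)"
      using D[of x] x assms by (auto intro!: derivative_eq_intros)
    moreover have "x\<^sup>2 / (1 - x) \<le> x\<^sup>2 / (1/2)"
      using x assms by (intro divide_left_mono) auto
    then have "x\<^sup>2 / (1 - x) \<le> 2 * x\<^sup>2" by simp
    then have "- (x\<^sup>2 / (1 - x)) + 3 * x\<^sup>2 \<ge> 0"
      using zero_le_power2[of x] by linarith
    ultimately show "\<exists>y. ((\<lambda>x. f x + x ^ 3) has_real_derivative y) (at x) \<and> 0 \<le> y" by blast
  qed
  moreover have "f 0 = 0" by (simp add: f_def)
  ultimately show ?thesis by (simp add: f_def abs_le_iff)
qed

text \<open>Degree bookkeeping, f = O(r^k): with r the size of a window of coefficients, a monomial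
  of degree k in them has order k, and order six is summable.\<close>

definition decay_order :: "(nat \<Rightarrow> real) \<Rightarrow> nat \<Rightarrow> (nat \<Rightarrow> complex) \<Rightarrow> bool" where
  "decay_order r k f \<longleftrightarrow> (\<exists>C. \<forall>n. norm (f n) \<le> C * r n ^ k)"

lemma decay_order_add:
  assumes "decay_order r k f" "decay_order r k g"
  shows "decay_order r k (\<lambda>n. f n + g n)"
proof -
  obtain B C where "\<And>n. norm (f n) \<le> B * r n ^ k" "\<And>n. norm (g n) \<le> C * r n ^ k"
    using assms unfolding decay_order_def by metis
  then have "norm (f n + g n) \<le> (B + C) * r n ^ k" for n
    unfolding distrib_right by (meson add_mono norm_triangle_ineq order_trans)
  then show ?thesis unfolding decay_order_def by blast
qed

lemma decay_order_minus: "decay_order r k f \<Longrightarrow> decay_order r k (\<lambda>n. - f n)"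
  by (simp add: decay_order_def)

lemma decay_order_diff:
  assumes "decay_order r k f" "decay_order r k g"
  shows "decay_order r k (\<lambda>n. f n - g n)"
  using decay_order_add[OF assms(1) decay_order_minus[OF assms(2)]] by simp

lemma decay_order_mult:
  assumes "decay_order r k f" "decay_order r l g"
  shows "decay_order r (k + l) (\<lambda>n. f n * g n)"
proof -
  obtain B C where *: "\<And>n. norm (f n) \<le> B * r n ^ k" "\<And>n. norm (g n) \<le> C * r n ^ l"
    using assms unfolding decay_order_def by metis
  have "norm (f n * g n) \<le> (B * C) * r n ^ (k + l)" for n
  proof -
    have "norm (f n * g n) \<le> (B * r n ^ k) * (C * r n ^ l)"
      unfolding norm_mult using * order_trans[OF norm_ge_zero *(1)]
      by (intro mult_mono) auto
    then show ?thesis by (simp add: power_add mult_ac)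
  qed
  then show ?thesis unfolding decay_order_def by blast
qed

lemma decay_order_const: "decay_order r 0 (\<lambda>n. c)"
  by (auto simp: decay_order_def)

text \<open>Boundedness of r lets surplus factors be dropped; the remainders also contain monomials
  of degree eight.\<close>

lemma decay_order_weaken:
  assumes "decay_order r k f" "l \<le> k" "\<And>n. 0 \<le> r n" "\<And>n. r n \<le> R"
  shows "decay_order r l f"
proof -
  obtain C where C: "\<And>n. norm (f n) \<le> C * r n ^ k"
    using assms unfolding decay_order_def by metis
  have "norm (f n) \<le> (\<bar>C\<bar> * R ^ (k - l)) * r n ^ l" for n
  proof -
    have "norm (f n) \<le> \<bar>C\<bar> * (r n ^ (k - l) * r n ^ l)"
      using C[of n] assms(2) mult_right_mono[OF abs_ge_self, of "r n ^ k" C] assms(3)[of n]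
      by (simp add: power_add[symmetric])
    also have "\<dots> \<le> \<bar>C\<bar> * (R ^ (k - l) * r n ^ l)"
      using assms(3,4)[of n] by (intro mult_left_mono mult_right_mono power_mono) auto
    finally show ?thesis by simp
  qed
  then show ?thesis unfolding decay_order_def by blast
qed

lemma summable_power_sum:
  fixes f :: "nat \<Rightarrow> nat \<Rightarrow> real"
  assumes "\<And>i n. f i n \<ge> 0" "\<And>i. summable (\<lambda>n. f i n ^ p)" "p > 0"
  shows "summable (\<lambda>n. (\<Sum>i<m. f i n) ^ p)"
proof (induction m)
  case 0
  then show ?case using assms(3) by (simp add: power_0_left)
next
  case (Suc m)
  have "summable (\<lambda>n. ((\<Sum>i<m. f i n) + f m n) ^ p)"
    by (rule summable_power_add) (use assms Suc in \<open>auto intro: sum_nonneg\<close>)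
  then show ?case by simp
qed

lemma bounded_sums_telescope2:
  assumes "\<And>n. \<bar>f n\<bar> \<le> C"
  shows "bounded_sums (\<lambda>n. f (n + i) - f (n + j))"
  using bounded_sums_diff[OF bounded_sums_telescope[of f, OF assms, of i] bounded_sums_telescope[of f, OF assms, of j]]
  by simp

section \<open>Sequences in ell^6 with differences in ell^3\<close>

locale ell6_sequence =
  fixes a :: "nat \<Rightarrow> complex"
  assumes norm_less_1: "norm (a n) < 1"
    and ell6: "in_ell 6 a"
    and ell3: "in_ell 3 (shift_minus_one a)"
begin

text \<open>A window of five, since an increment of the entropy is expanded in five consecutive
  coefficients. \<open>R\<close> dominates every modulus in the window and \<open>d\<close> every
  difference inside it.\<close>

definition R :: "nat \<Rightarrow> real" where "R n = (\<Sum>i<5. norm (a (n + i)))"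
definition d :: "nat \<Rightarrow> real" where "d n = (\<Sum>i<4. norm (a (n + Suc i) - a (n + i)))"

lemma summable_R: "summable (\<lambda>n. R n ^ 6)"
  unfolding R_def
proof (rule summable_power_sum)
  show "summable (\<lambda>n. norm (a (n + i)) ^ 6)" for i
    using ell6 summable_iff_shift[of "\<lambda>n. norm (a n) ^ 6" i] by (simp add: in_ell_def)
qed auto

lemma summable_d: "summable (\<lambda>n. d n ^ 3)"
  unfolding d_def
proof (rule summable_power_sum)
  show "summable (\<lambda>n. norm (a (n + Suc i) - a (n + i)) ^ 3)" for i
    using ell3 summable_iff_shift[of "\<lambda>n. norm (a (Suc n) - a n) ^ 3" i]
    by (simp add: in_ell_def shift_minus_one_def seq_shift_def)
qed auto

lemma R_nonneg: "R n \<ge> 0" and d_nonneg: "d n \<ge> 0"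
  by (auto simp: R_def d_def intro: sum_nonneg)

lemma R_le: "R n \<le> 5"
  unfolding R_def using sum_bounded_above[of "{..<5::nat}" "\<lambda>i. norm (a (n + i))" 1] norm_less_1
  by (simp add: less_imp_le)

lemma norm_le_R: "i \<le> 4 \<Longrightarrow> norm (a (n + i)) \<le> R n"
  unfolding R_def by (rule member_le_sum[of i "{..<5}" "\<lambda>i. norm (a (n + i))"]) auto

lemma norm_diff_le_d:
  assumes "i \<le> 4" "j \<le> 4"
  shows "norm (a (n + i) - a (n + j)) \<le> d n"
proof -
  have *: "norm (a (n + j) - a (n + i)) \<le> d n" if "i \<le> j" "j \<le> 4" for i j
  proof -
    have "a (n + j) - a (n + i) = (\<Sum>k=i..<j. a (n + Suc k) - a (n + k))"
      using sum_Suc_diff'[OF that(1), of "\<lambda>k. a (n + k)"] by simp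
    also have "norm \<dots> \<le> (\<Sum>k=i..<j. norm (a (n + Suc k) - a (n + k)))" by (rule norm_sum)
    also have "\<dots> \<le> d n" unfolding d_def using that by (intro sum_mono2) auto
    finally show ?thesis .
  qed
  show ?thesis
    using *[of i j] *[of j i] assms by (cases "i \<le> j") (auto simp: norm_minus_commute)
qed

text \<open>The one place where the two exponents interact: if d <= R^2 the product is at most R^6,
  otherwise at most d^3.\<close>

lemma summable_R2d2: "summable (\<lambda>n. (R n)\<^sup>2 * (d n)\<^sup>2)"
proof (rule summable_comparison_test')
  show "summable (\<lambda>n. R n ^ 6 + d n ^ 3)" by (intro summable_add summable_R summable_d)
  show "norm ((R n)\<^sup>2 * (d n)\<^sup>2) \<le> R n ^ 6 + d n ^ 3" for n
  proof (cases "d n \<le> (R n)\<^sup>2")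
    case True
    then have "(R n)\<^sup>2 * (d n)\<^sup>2 \<le> (R n)\<^sup>2 * ((R n)\<^sup>2)\<^sup>2"
      using d_nonneg[of n] by (intro mult_left_mono power_mono) auto
    also have "\<dots> = R n ^ 6" by (simp add: power2_eq_square eval_nat_numeral)
    finally show ?thesis using d_nonneg[of n] by (simp add: add_increasing2)
  next
    case False
    then have "(R n)\<^sup>2 * (d n)\<^sup>2 \<le> d n * (d n)\<^sup>2"
      by (intro mult_right_mono) auto
    also have "\<dots> = d n ^ 3" by (simp add: eval_nat_numeral)
    finally show ?thesis using R_nonneg[of n] by (simp add: add_increasing)
  qed
qed

text \<open>\<open>Re_quartic_bound\<close> replaces the monomial by the average of four fourth
  powers, and telescoping moves each of these to index n + 4.\<close>

lemma bounded_sums_quartic: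
  assumes "i \<le> 4" "j \<le> 4" "k \<le> 4" "l \<le> 4"
  shows "bounded_sums (\<lambda>n. Re (a (n + i) * a (n + j) * cnj (a (n + k)) * cnj (a (n + l))) - norm (a (n + 4)) ^ 4)"
proof -
  define q where "q n = norm (a n) ^ 4" for n
  have q: "\<bar>q n\<bar> \<le> 1" for n
    using norm_less_1[of n] by (simp add: q_def power_le_one)
  have 1: "bounded_sums (\<lambda>n. Re (a (n + i) * a (n + j) * cnj (a (n + k)) * cnj (a (n + l)))
      - (q (n + i) + q (n + j) + q (n + k) + q (n + l)) / 4)"
    by (rule bounded_sums_le[OF summable_R2d2, of _ 4], unfold q_def, rule Re_quartic_bound)
      (intro norm_le_R norm_diff_le_d assms)+
  have 2: "bounded_sums (\<lambda>n. 1/4 * (q (n + m) - q (n + 4)))" for m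
    by (intro bounded_sums_cmult bounded_sums_telescope2[of q 1] q)
  show ?thesis
    using bounded_sums_add[OF 1 bounded_sums_add[OF bounded_sums_add[OF bounded_sums_add[OF 2[of i] 2[of j]] 2[of k]] 2[of l]]]
    by (rule back_subst[of bounded_sums]) (auto simp: fun_eq_iff q_def field_simps)
qed

text \<open>Shaped for backward chaining: the product loses its last factor and the goal one degree.
  The subtraction is truncated, so monomials with more than six factors simply end at order
  0.\<close>

lemma decay_order_step:
  assumes "decay_order R (k - 1) f" "decay_order R 1 g"
  shows "decay_order R k (\<lambda>n. f n * g n)"
  by (rule decay_order_weaken[OF decay_order_mult[OF assms], of _ 5]) (auto simp: R_nonneg R_le)

lemma decay_order_shift: "i \<le> 4 \<Longrightarrow> decay_order R 1 (\<lambda>n. a (n + i))"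
  and decay_order_cnj_shift: "i \<le> 4 \<Longrightarrow> decay_order R 1 (\<lambda>n. cnj (a (n + i)))"
  unfolding decay_order_def by (auto intro!: exI[of _ 1] norm_le_R)

lemma decay_order_shift0: "i \<le> 4 \<Longrightarrow> decay_order R 0 (\<lambda>n. a (n + i))"
  by (rule decay_order_weaken[OF decay_order_shift, of _ _ 5]) (auto simp: R_nonneg R_le)

lemma bounded_sums_Re_decay_order:
  assumes "decay_order R 6 f"
  shows "bounded_sums (\<lambda>n. Re (f n))"
proof -
  obtain C where "\<And>n. norm (f n) \<le> C * R n ^ 6" using assms unfolding decay_order_def by metis
  then show ?thesis
    by (intro bounded_sums_le[OF summable_R, of _ C]) (meson abs_Re_le_cmod order_trans)
qed

text \<open>As a tends to 0, s = |a n|^2 is eventually at most 1/2, and the cubic bound in s is of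
  order six in |a n|.\<close>

lemma bounded_sums_log_remainder:
  "bounded_sums (\<lambda>n. ln (1 - (norm (a n))\<^sup>2) + (norm (a n))\<^sup>2 + (norm (a n)) ^ 4 / 2)"
proof (rule bounded_sums_summable, rule summable_comparison_test_ev)
  have s6: "summable (\<lambda>n. norm (a n) ^ 6)" using ell6 by (simp add: in_ell_def)
  then show "summable (\<lambda>n. norm (a n) ^ 6)" .
  have "(\<lambda>n. norm (a n) ^ 6) \<longlonglongrightarrow> 0" using s6 by (rule summable_LIMSEQ_zero)
  then have "eventually (\<lambda>n. norm (a n) ^ 6 < (1/2) ^ 3) sequentially"
    by (rule order_tendstoD) auto
  then show "\<forall>\<^sub>F n in sequentially. norm \<bar>ln (1 - (cmod (a n))\<^sup>2) + (cmod (a n))\<^sup>2 + cmod (a n) ^ 4 / 2\<bar>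
        \<le> cmod (a n) ^ 6"
  proof eventually_elim
    case (elim n)
    have "((norm (a n))\<^sup>2) ^ 3 < (1/2) ^ 3" using elim by (simp flip: power_mult)
    then have "(norm (a n))\<^sup>2 < 1/2" by (rule power_less_imp_less_base) simp
    then have "(norm (a n))\<^sup>2 \<le> 1/2" by simp
    from ln_one_minus_cubic_bound[OF _ this] show ?case
      by (simp flip: power_mult)
  qed
qed

end

text \<open>Third and fourth Taylor coefficients of \<open>ln (1 - \<alpha> z b(z))\<close>, with \<open>y\<^sub>i\<close> standing
  for the conjugate of \<open>x\<^sub>i\<close>: the parts of degree two and four are split off.\<close>

lemma log_coeff3_expansion:
  fixes x0 x1 x2 y1 y2 y3 :: "'a::field_char_0"
  defines "b1 \<equiv> - y1"
    and "b2 \<equiv> (1 - x1 * y1) * (- y2)"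
    and "b3 \<equiv> (1 - x1 * y1) * ((1 - x2 * y2) * (- y3) + x1 * (- y2)\<^sup>2)"
  shows "- x0 * b3 - x0\<^sup>2 * b1 * b2 - x0 ^ 3 * b1 ^ 3 / 3 =
    x0 * y3 - (x0 * x1 * y1 * y3 + x0 * x2 * y2 * y3 + x0 * x1 * y2 * y2 + x0 * x0 * y1 * y2)
    + (x0*x1*y1*x2*y2*y3 + x0*x1*y1*x1*y2*y2 + x0*x0*y1*x1*y1*y2 + (1/3)*x0*x0*x0*y1*y1*y1)"
  unfolding b1_def b2_def b3_def by (simp add: field_simps power2_eq_square power3_eq_cube)

lemma log_coeff4_expansion:
  fixes x0 x1 x2 x3 y1 y2 y3 y4 :: "'a::field_char_0"
  defines "b1 \<equiv> - y1"
    and "b2 \<equiv> (1 - x1 * y1) * (- y2)"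
    and "b3 \<equiv> (1 - x1 * y1) * ((1 - x2 * y2) * (- y3) + x1 * (- y2)\<^sup>2)"
    and "b4 \<equiv> (1 - x1 * y1) * ((1 - x2 * y2) * ((1 - x3 * y3) * (- y4) + x2 * (- y3)\<^sup>2)
              + 2 * x1 * (- y2) * ((1 - x2 * y2) * (- y3)) + x1\<^sup>2 * (- y2) ^ 3)"
  shows "- x0 * b4 - x0\<^sup>2 * (b1 * b3 + b2\<^sup>2 / 2) - x0 ^ 3 * b1\<^sup>2 * b2 - x0 ^ 4 * b1 ^ 4 / 4 =
    x0 * y4 - (x0 * x1 * y1 * y4 + x0 * x2 * y2 * y4 + x0 * x3 * y3 * y4 + x0 * x2 * y3 * y3
       + 2 * (x0 * x1 * y2 * y3) + x0 * x0 * y1 * y3 + x0 * x0 * y2 * y2 / 2)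
    + (x0*x1*y1*x2*y2*y4 + x0*x1*y1*x3*y3*y4 + x0*x2*y2*x3*y3*y4 - x0*x1*y1*x2*y2*x3*y3*y4
       - x0*x1*y1*x2*y2*x2*y3*y3 + x0*x1*y1*x2*y3*y3 + x0*x2*y2*x2*y3*y3
       - 2*x0*x1*y1*x2*y2*x1*y2*y3 + 2*x0*x1*y1*x1*y2*y3 + 2*x0*x2*y2*x1*y2*y3
       + x0*x1*x1*y2*y2*y2 - x0*x1*y1*x1*x1*y2*y2*y2
       + x0*x0*y1*x1*y1*y3 + x0*x0*y1*x2*y2*y3 + x0*x0*y1*x1*y2*y2
       - x0*x0*y1*x1*y1*x2*y2*y3 - x0*x0*y1*x1*y1*x1*y2*y2
       + x0*x0*y2*y2*x1*y1 - (1/2)*x0*x0*y2*y2*x1*y1*x1*y1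
       + x0*x0*x0*y1*y1*y2 - x0*x0*x0*y1*y1*x1*y1*y2 - (1/4)*x0*x0*x0*x0*y1*y1*y1*y1)"
  unfolding b1_def b2_def b3_def b4_def
  by (simp add: field_simps power2_eq_square power3_eq_cube power4_eq_xxxx)

section \<open>The coefficient side of the sum rule\<close>

text \<open>Beyond the first k terms the partial sums of f are those of -g up to a bounded error,
  and for g >= 0 bounded partial sums mean summability. The shift lets an expansion of f start where
  a full window of earlier coefficients exists.\<close>

lemma bounded_sums_shift_iff:
  assumes "bounded_sums (\<lambda>n. f (n + k) + g n)" "\<And>n. g n \<ge> 0"
  shows "(\<exists>K. \<forall>N. - K \<le> (\<Sum>n<N. f n)) \<longleftrightarrow> summable g"
proof -
  obtain B where B: "\<And>N. \<bar>\<Sum>n<N. f (n + k) + g n\<bar> \<le> B"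
    using assms(1) unfolding bounded_sums_def by metis
  have split: "(\<Sum>n<N + k. f n) = (\<Sum>n<k. f n) + (\<Sum>n<N. f (n + k))" for N
    by (induction N) (simp_all add: add_ac)
  show ?thesis
  proof
    assume "\<exists>K. \<forall>N. - K \<le> (\<Sum>n<N. f n)"
    then obtain K where K: "\<And>N. - K \<le> (\<Sum>n<N. f n)" by blast
    have "(\<Sum>n<N. norm (g n)) \<le> B + K + (\<Sum>n<k. f n)" for N
      using B[of N] K[of "N + k"] assms(2) unfolding split sum.distrib by auto
    then show "summable g"
      using summableI_nonneg_bounded[of g] assms(2) by auto
  next
    assume g: "summable g"
    define M where "M = (\<Sum>n<k. \<bar>f n\<bar>) + B + suminf g"
    have "- M \<le> (\<Sum>n<N. f n)" for N
    proof (cases "N \<le> k")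
      case True
      have "\<bar>\<Sum>n<N. f n\<bar> \<le> (\<Sum>n<N. \<bar>f n\<bar>)" by (rule sum_abs)
      also have "\<dots> \<le> (\<Sum>n<k. \<bar>f n\<bar>)" using True by (intro sum_mono2) auto
      finally show ?thesis using B[of 0] suminf_nonneg[OF g assms(2)] unfolding M_def by auto
    next
      case False
      then obtain m where m: "N = m + k" using le_Suc_ex[of k N] by (auto simp: add.commute)
      have "(\<Sum>n<m. g n) \<le> suminf g" by (rule sum_le_suminf[OF g]) (use assms(2) in auto)
      moreover have "\<bar>\<Sum>n<k. f n\<bar> \<le> (\<Sum>n<k. \<bar>f n\<bar>)" by (rule sum_abs)
      ultimately show ?thesis
        using B[of m] unfolding m split M_def sum.distrib by linarith
    qed
    then show "\<exists>K. \<forall>N. - K \<le> (\<Sum>n<N. f n)" by blast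
  qed
qed

lemma bounded_sums_shift_initial:
  assumes "bounded_sums f"
  shows "bounded_sums (\<lambda>n. f (n + k))"
proof -
  obtain B where B: "\<And>N. \<bar>\<Sum>n<N. f n\<bar> \<le> B"
    using assms unfolding bounded_sums_def by metis
  have split: "(\<Sum>n<N + k. f n) = (\<Sum>n<k. f n) + (\<Sum>n<N. f (n + k))" for N
    by (induction N) (simp_all add: add_ac)
  have "\<bar>\<Sum>n<N. f (n + k)\<bar> \<le> 2 * B" for N
    using B[of "N + k"] B[of k] unfolding split by linarith
  then show ?thesis unfolding bounded_sums_def by blast
qed

text \<open>x2 is missing because (S - 1)^3 (S + 1) = S^4 - 2 S^3 + 2 S - 1. Collected by index
  difference 0, ..., 4, the coefficients are 10, -8, -8, 8, -2, those of 16 W, since |e^(i\<theta>)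
  - 1|^6 |e^(i\<theta>) + 1|^2 = 16 W(\<theta>).\<close>

lemma norm_cubic_difference_square:
  fixes x0 x1 x3 x4 :: complex
  shows "(norm (x0 - 2 * x1 + 2 * x3 - x4))\<^sup>2 =
    (norm x0)\<^sup>2 + 4 * (norm x1)\<^sup>2 + 4 * (norm x3)\<^sup>2 + (norm x4)\<^sup>2
    - 4 * Re (x0 * cnj x1) + 4 * Re (x0 * cnj x3) - 2 * Re (x0 * cnj x4)
    - 8 * Re (x1 * cnj x3) + 4 * Re (x1 * cnj x4) - 4 * Re (x3 * cnj x4)"
  unfolding cmod_power2 by (simp add: algebra_simps power2_eq_square)

lemma shift_cube_eq:
  "(shift_minus_one ^^ 3) (shift_plus_one a) n = a (n + 4) - 2 * a (n + 3) + 2 * a (n + 1) - a n"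
  by (simp add: eval_nat_numeral shift_minus_one_def shift_plus_one_def seq_shift_def)

text \<open>Every real quantity is a free variable, which leaves only linear arithmetic: L is the
  logarithm, s a squared modulus, t the real part of a product labelled by its indices, f the fourth
  power, r3 and r4 the remainders. The quartic cancellation is visible here: the coefficients of the
  brackets with f add up to 5, against 10 (f / 2) from the logarithm.\<close>

lemma sum_rule_rearrangement:
  fixes L s1 s0 s3 s4 f r3 r4 t01 t34 t02 t13 t03 t14 t0112 t0011 t0113 t0223 t0122 t0012 t0114 t0224 t0334 t0233 t0123 t0013 t0022 t04 :: real
  shows "4 * (s1 - s0) + 4 * (s3 - s0) + 1 * (s4 - s0) + 4 * (t01 - t34) + 8 * (t02 - t13) + - 4 *
    (t03 - t14) + (- 8 * (t0112 - f) + - 4 * (t0011 - f) + 8 * (t0113 - f) + 8 * (t0223 - f) +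
    8 * (t0122 - f) + 8 * (t0012 - f) + - 2 * (t0114 - f) + - 2 * (t0224 - f) + - 2 * (t0334 -
    f) + - 2 * (t0233 - f) + - 4 * (t0123 - f) + - 2 * (t0013 - f) + - 1 * (t0022 - f)) + (- 8
    * r3 + 2 * r4) + 10 * (L + s0 + f / 2) = 10 * L + 8 * t01 + 8 * (t02 - t0112 - 1 / 2 *
    t0011) - 8 * (t03 - (t0113 + t0223 + t0122 + t0012) + r3) + 2 * (t04 - (t0114 + t0224 +
    t0334 + t0233 + 2 * t0123 + t0013 + t0022 / 2) + r4) + (s0 + 4 * s1 + 4 * s3 + s4 - 4 *
    t01 + 4 * t03 - 2 * t04 - 8 * t13 + 4 * t14 - 4 * t34)"
  by (simp add: algebra_simps)

context ell6_sequence
begin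

text \<open>Quadratic products with the same index difference m are interchangeable up to
  telescoping.\<close>

lemma bounded_sums_product_shift:
  "bounded_sums (\<lambda>n. Re (a (n + m + i) * cnj (a (n + i))) - Re (a (n + m + j) * cnj (a (n + j))))"
proof -
  define f where "f n = Re (a (n + m) * cnj (a n))" for n
  have "\<bar>f n\<bar> \<le> 1" for n
  proof -
    have "\<bar>f n\<bar> \<le> norm (a (n + m) * cnj (a n))" unfolding f_def by (rule abs_Re_le_cmod)
    also have "\<dots> \<le> 1 * 1" unfolding norm_mult complex_mod_cnj
      using norm_less_1 by (intro mult_mono) (auto simp: less_imp_le)
    finally show ?thesis by simp
  qed
  from bounded_sums_telescope2[of f, OF this, of i j] show ?thesis
    by (simp add: f_def add_ac)
qed

text \<open>In the application b1, ..., b4 are the Taylor coefficients of orders 0 to 3 of \<Phi>_n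
  / \<psi>_n, c1, ..., c4 those of orders 1 to 4 of ln (1 - \<alpha>_n z \<Phi>_n / \<psi>_n), and D
  is 16 times the entropy increment. Unrolled down from n + 4, the recursions end in b1 (n + 1) = -
  cnj (a n), so that no initial values appear.\<close>

lemma sum_rule_iff:
  fixes b1 b2 b3 b4 c1 c2 c3 c4 :: "nat \<Rightarrow> complex" and D :: "nat \<Rightarrow> real"
  assumes b1: "\<And>n. b1 (Suc n) = - cnj (a n)"
    and b2: "\<And>n. b2 (Suc n) = (1 - a n * cnj (a n)) * b1 n"
    and b3: "\<And>n. b3 (Suc n) = (1 - a n * cnj (a n)) * (b2 n + a n * (b1 n)\<^sup>2)"
    and b4: "\<And>n. b4 (Suc n) = (1 - a n * cnj (a n)) *
      (b3 n + 2 * a n * b1 n * b2 n + (a n)\<^sup>2 * b1 n ^ 3)"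
    and c1: "\<And>n. c1 n = - a n * b1 n"
    and c2: "\<And>n. c2 n = - a n * b2 n - (a n)\<^sup>2 * (b1 n)\<^sup>2 / 2"
    and c3: "\<And>n. c3 n = - a n * b3 n - (a n)\<^sup>2 * b1 n * b2 n - a n ^ 3 * b1 n ^ 3 / 3"
    and c4: "\<And>n. c4 n = - a n * b4 n - (a n)\<^sup>2 * (b1 n * b3 n + (b2 n)\<^sup>2 / 2)
      - a n ^ 3 * (b1 n)\<^sup>2 * b2 n - a n ^ 4 * b1 n ^ 4 / 4"
    and D: "\<And>n. D n = 10 * ln (1 - (norm (a n))\<^sup>2)
      + 8 * Re (c1 n) + 8 * Re (c2 n) - 8 * Re (c3 n) + 2 * Re (c4 n)"
  shows "(\<exists>K. \<forall>N. - K \<le> (\<Sum>n<N. D n)) \<longleftrightarrow>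
    in_ell 2 ((shift_minus_one ^^ 3) (shift_plus_one a))"
proof -
  \<comment> \<open>Indices count backwards from n + 4: x0 is the newest coefficient, and each y is
    the conjugate of the x with the same index.\<close>
  define x0 x1 x2 x3 x4 where x: "x0 = (\<lambda>n. a (n + 4))" "x1 = (\<lambda>n. a (n + 3))"
    "x2 = (\<lambda>n. a (n + 2))" "x3 = (\<lambda>n. a (n + 1))" "x4 = (\<lambda>n. a (n + 0))"
  define y1 y2 y3 y4 where y: "y1 = (\<lambda>n. cnj (a (n + 3)))"
    "y2 = (\<lambda>n. cnj (a (n + 2)))" "y3 = (\<lambda>n. cnj (a (n + 1)))" "y4 = (\<lambda>n. cnj (a (n + 0)))"
  define r3 where "r3 = (\<lambda>n. x0 n*x1 n*y1 n*x2 n*y2 n*y3 n + x0 n*x1 n*y1 n*x1 n*y2 n*y2 n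
    + x0 n*x0 n*y1 n*x1 n*y1 n*y2 n + (1/3)*x0 n*x0 n*x0 n*y1 n*y1 n*y1 n)"
  define r4 where "r4 = (\<lambda>n. x0 n*x1 n*y1 n*x2 n*y2 n*y4 n + x0 n*x1 n*y1 n*x3 n*y3 n*y4 n
       + x0 n*x2 n*y2 n*x3 n*y3 n*y4 n - x0 n*x1 n*y1 n*x2 n*y2 n*x3 n*y3 n*y4 n
       - x0 n*x1 n*y1 n*x2 n*y2 n*x2 n*y3 n*y3 n + x0 n*x1 n*y1 n*x2 n*y3 n*y3 n + x0 n*x2 n*y2 n*x2 n*y3 n*y3 n
       - 2*x0 n*x1 n*y1 n*x2 n*y2 n*x1 n*y2 n*y3 n + 2*x0 n*x1 n*y1 n*x1 n*y2 n*y3 n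
       + 2*x0 n*x2 n*y2 n*x1 n*y2 n*y3 n
       + x0 n*x1 n*x1 n*y2 n*y2 n*y2 n - x0 n*x1 n*y1 n*x1 n*x1 n*y2 n*y2 n*y2 n
       + x0 n*x0 n*y1 n*x1 n*y1 n*y3 n + x0 n*x0 n*y1 n*x2 n*y2 n*y3 n + x0 n*x0 n*y1 n*x1 n*y2 n*y2 n
       - x0 n*x0 n*y1 n*x1 n*y1 n*x2 n*y2 n*y3 n - x0 n*x0 n*y1 n*x1 n*y1 n*x1 n*y2 n*y2 n
       + x0 n*x0 n*y2 n*y2 n*x1 n*y1 n - (1/2)*x0 n*x0 n*y2 n*y2 n*x1 n*y1 n*x1 n*y1 n
       + x0 n*x0 n*x0 n*y1 n*y1 n*y2 n - x0 n*x0 n*x0 n*y1 n*y1 n*x1 n*y1 n*y2 n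
       - (1/4)*x0 n*x0 n*x0 n*x0 n*y1 n*y1 n*y1 n*y1 n)"
  have order1: "decay_order R 1 x0" "decay_order R 1 x1" "decay_order R 1 x2" "decay_order R 1 x3"
    "decay_order R 1 y1" "decay_order R 1 y2" "decay_order R 1 y3" "decay_order R 1 y4"
    unfolding x y by (rule decay_order_shift decay_order_cnj_shift; simp)+
  \<comment> \<open>Needed for the monomials of degree eight, where the truncated degree reaches 0
    before the leading factor x0.\<close>
  have order0: "decay_order R 0 x0" unfolding x by (rule decay_order_shift0) simp
  note order = order1 order1[unfolded One_nat_def] order0
  have "decay_order R 6 r3"
    unfolding r3_def
    by (intro decay_order_add decay_order_diff) (intro decay_order_step decay_order_const; simp add: order decay_order_const)+
  from bounded_sums_Re_decay_order[OF this] have rem3: "bounded_sums (\<lambda>n. Re (r3 n))" .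
  have "decay_order R 6 r4"
    unfolding r4_def
    by (intro decay_order_add decay_order_diff) (intro decay_order_step decay_order_const; simp add: order decay_order_const)+
  from bounded_sums_Re_decay_order[OF this] have rem4: "bounded_sums (\<lambda>n. Re (r4 n))" .
  have quart: "bounded_sums (\<lambda>n. Re (a (n + i) * a (n + j) * cnj (a (n + k)) * cnj (a (n + l))) - norm (x0 n) ^ 4)"
    if "i \<le> 4" "j \<le> 4" "k \<le> 4" "l \<le> 4" for i j k l
    using bounded_sums_quartic[OF that] by (simp add: x)
  have log: "bounded_sums (\<lambda>n. ln (1 - (norm (x0 n))\<^sup>2) + (norm (x0 n))\<^sup>2 + (norm (x0 n)) ^ 4 / 2)"
    unfolding x by (rule bounded_sums_shift_initial[OF bounded_sums_log_remainder, of 4])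
  have sq: "bounded_sums (\<lambda>n. Re (a (n + i) * cnj (a (n + i))) - Re (a (n + j) * cnj (a (n + j))))" for i j
    using bounded_sums_product_shift[of 0 i j] by simp
  have e1: "b1 (n + 4) = - y1 n" for n
    using b1[of "n + 3"] by (simp add: y eval_nat_numeral)
  have e2: "b2 (n + 4) = (1 - x1 n * y1 n) * (- y2 n)" for n
    using b2[of "n + 3"] b1[of "n + 2"] by (simp add: x y eval_nat_numeral)
  have e2': "b2 (n + 3) = (1 - x2 n * y2 n) * (- y3 n)" for n
    using b2[of "n + 2"] b1[of "n + 1"] by (simp add: x y eval_nat_numeral)
  have e2'': "b2 (n + 2) = (1 - x3 n * y3 n) * (- y4 n)" for n
    using b2[of "n + 1"] b1[of n] by (simp add: x y eval_nat_numeral)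
  have e3: "b3 (n + 4) = (1 - x1 n * y1 n) * ((1 - x2 n * y2 n) * (- y3 n) + x1 n * (- y2 n)\<^sup>2)" for n
    using b3[of "n + 3"] b1[of "n + 2"] e2'[of n] by (simp add: x y eval_nat_numeral)
  have e3': "b3 (n + 3) = (1 - x2 n * y2 n) * ((1 - x3 n * y3 n) * (- y4 n) + x2 n * (- y3 n)\<^sup>2)" for n
    using b3[of "n + 2"] b1[of "n + 1"] e2''[of n] by (simp add: x y eval_nat_numeral)
  have e4: "b4 (n + 4) = (1 - x1 n * y1 n) * ((1 - x2 n * y2 n) * ((1 - x3 n * y3 n) * (- y4 n) + x2 n * (- y3 n)\<^sup>2)
              + 2 * x1 n * (- y2 n) * ((1 - x2 n * y2 n) * (- y3 n)) + (x1 n)\<^sup>2 * (- y2 n) ^ 3)" for n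
    using b4[of "n + 3"] b1[of "n + 2"] e2'[of n] e3'[of n] by (simp add: x y eval_nat_numeral)
  have xa: "a (n + 4) = x0 n" for n by (simp add: x)
  have C1: "c1 (n + 4) = x0 n * y1 n" for n
    unfolding c1 e1 by (simp add: x)
  have C2: "c2 (n + 4) = x0 n * y2 n - x0 n * x1 n * y1 n * y2 n - (1/2) * (x0 n * x0 n * y1 n * y1 n)" for n
    unfolding c2 e1 e2 by (simp add: x algebra_simps power2_eq_square)
  have C3: "c3 (n + 4) = x0 n * y3 n - (x0 n * x1 n * y1 n * y3 n + x0 n * x2 n * y2 n * y3 n
      + x0 n * x1 n * y2 n * y2 n + x0 n * x0 n * y1 n * y2 n) + r3 n" for n
    unfolding c3 e1 e2 e3 r3_def xa by (rule log_coeff3_expansion)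
  have C4: "c4 (n + 4) = x0 n * y4 n - (x0 n * x1 n * y1 n * y4 n + x0 n * x2 n * y2 n * y4 n
       + x0 n * x3 n * y3 n * y4 n + x0 n * x2 n * y3 n * y3 n
       + 2 * (x0 n * x1 n * y2 n * y3 n) + x0 n * x0 n * y1 n * y3 n + x0 n * x0 n * y2 n * y2 n / 2) + r4 n" for n
    unfolding c4 e1 e2 e3 e4 r4_def xa by (rule log_coeff4_expansion)
  define Q where "Q = (\<lambda>n. (norm ((shift_minus_one ^^ 3) (shift_plus_one a) n))\<^sup>2)"
  note cm = bounded_sums_cmult and q = quart[of 4]
  define G where "G = (\<lambda>n. 10 * (ln (1 - (norm (x0 n))\<^sup>2) + (norm (x0 n))\<^sup>2 + (norm (x0 n)) ^ 4 / 2))"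
  have G: "bounded_sums G" unfolding G_def by (rule cm[OF log])
  have "bounded_sums (\<lambda>n. D (n + 4) + Q n)"
  proof -
    let ?S = "\<lambda>i j n. Re (a (n + i) * cnj (a (n + i))) - Re (a (n + j) * cnj (a (n + j)))"
    let ?P = "\<lambda>m i j n. Re (a (n + m + i) * cnj (a (n + i))) - Re (a (n + m + j) * cnj (a (n + j)))"
    let ?q = "\<lambda>j k l n. Re (a (n + 4) * a (n + j) * cnj (a (n + k)) * cnj (a (n + l))) - norm (x0 n) ^ 4"
    \<comment> \<open>When Q is added to D, quadratic products survive only as differences of two
      products with equal index difference, those with index difference 4 cancel, and these
      coefficients remain.\<close>
    have quad: "bounded_sums (\<lambda>n. 4 * ?S 3 4 n + 4 * ?S 1 4 n + 1 * ?S 0 4 n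
       + 4 * ?P 1 3 0 n + 8 * ?P 2 2 1 n + (-4) * ?P 3 1 0 n)"
      by (intro bounded_sums_add cm sq bounded_sums_product_shift)
    \<comment> \<open>Arguments are offsets from n: \<open>?q 3 3 2\<close> compares Re (x0 x1 y1
      y2) with |x0|^4. The factors are the weights of the monomials in D.\<close>
    have quar: "bounded_sums (\<lambda>n. (-8) * ?q 3 3 2 n + (-4) * ?q 4 3 3 n + 8 * ?q 3 3 1 n
       + 8 * ?q 2 2 1 n + 8 * ?q 3 2 2 n + 8 * ?q 4 3 2 n
       + (-2) * ?q 3 3 0 n + (-2) * ?q 2 2 0 n + (-2) * ?q 1 1 0 n + (-2) * ?q 2 1 1 n
       + (-4) * ?q 3 2 1 n + (-2) * ?q 4 3 1 n + (-1) * ?q 4 2 2 n)"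
      by (intro bounded_sums_add cm q) simp_all
    have rem: "bounded_sums (\<lambda>n. (-8) * Re (r3 n) + 2 * Re (r4 n))"
      by (intro bounded_sums_add cm rem3 rem4)
    have sqr: "Re (z * cnj z) = (norm z)\<^sup>2" for z
      unfolding cmod_power2 by (simp add: power2_eq_square)
    have Re_scale: "Re (2 * z) = 2 * Re z" "Re (1/2 * z) = 1/2 * Re z" "Re (z / 2) = Re z / 2" for z
      by simp_all
    have Qn: "Q n = (norm (x0 n))\<^sup>2 + 4 * (norm (x1 n))\<^sup>2 + 4 * (norm (x3 n))\<^sup>2 + (norm (x4 n))\<^sup>2
      - 4 * Re (x0 n * y1 n) + 4 * Re (x0 n * y3 n) - 2 * Re (x0 n * y4 n)
      - 8 * Re (x1 n * y3 n) + 4 * Re (x1 n * y4 n) - 4 * Re (x3 n * y4 n)" for n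
      using norm_cubic_difference_square[of "x0 n" "x1 n" "x3 n" "x4 n"]
      unfolding Q_def shift_cube_eq x y by simp
    show ?thesis
    proof (rule back_subst[of bounded_sums, OF bounded_sums_add[OF bounded_sums_add[OF bounded_sums_add[OF quad quar] rem] G]], rule ext)
      fix n :: nat
      have idx: "n + 1 + 3 = n + 4" "n + 1 + 0 = n + 1" "n + 2 + 2 = n + 4" "n + 2 + 1 = n + 3"
        "n + 3 + 1 = n + 4" "n + 3 + 0 = n + 3" by simp_all
      show "4 * ?S 3 4 n + 4 * ?S 1 4 n + 1 * ?S 0 4 n
       + 4 * ?P 1 3 0 n + 8 * ?P 2 2 1 n + (-4) * ?P 3 1 0 n +
       ((-8) * ?q 3 3 2 n + (-4) * ?q 4 3 3 n + 8 * ?q 3 3 1 n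
       + 8 * ?q 2 2 1 n + 8 * ?q 3 2 2 n + 8 * ?q 4 3 2 n
       + (-2) * ?q 3 3 0 n + (-2) * ?q 2 2 0 n + (-2) * ?q 1 1 0 n + (-2) * ?q 2 1 1 n
       + (-4) * ?q 3 2 1 n + (-2) * ?q 4 3 1 n + (-1) * ?q 4 2 2 n) +
       ((-8) * Re (r3 n) + 2 * Re (r4 n)) + G n = D (n + 4) + Q n"
        unfolding D C1 C2 C3 C4 Qn G_def idx sqr minus_complex.sel plus_complex.sel Re_scale
        unfolding fun_cong[OF y(1), symmetric] fun_cong[OF y(2), symmetric]
          fun_cong[OF y(3), symmetric] fun_cong[OF y(4), symmetric]
        unfolding fun_cong[OF x(1), symmetric] fun_cong[OF x(2), symmetric]
          fun_cong[OF x(3), symmetric] fun_cong[OF x(4), symmetric] fun_cong[OF x(5), symmetric]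
        by (rule sum_rule_rearrangement)
    qed
  qed
  from bounded_sums_shift_iff[OF this] show ?thesis
    by (simp add: Q_def in_ell_def)
qed

end

section \<open>Increments of the sum rule\<close>

text \<open>With s for \<open>schur\<close>, the hypothesis reads A = X s - cnj a + a X (A s), which
  determines each coefficient of A from lower ones.\<close>

lemma Moebius_fps_coeffs:
  fixes A schur :: "complex fps"
  assumes "A * (1 - fps_const a * fps_X * schur) = fps_X * schur - fps_const (cnj a)"
  shows "fps_nth A 0 = - cnj a"
    and "fps_nth A 1 = (1 - a * cnj a) * fps_nth schur 0"
    and "fps_nth A 2 = (1 - a * cnj a) * (fps_nth schur 1 + a * (fps_nth schur 0)\<^sup>2)"
    and "fps_nth A 3 = (1 - a * cnj a) *
      (fps_nth schur 2 + 2 * a * fps_nth schur 0 * fps_nth schur 1 + a\<^sup>2 * fps_nth schur 0 ^ 3)"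
proof -
  have A: "A = fps_X * schur - fps_const (cnj a) + fps_const a * (fps_X * (A * schur))"
    using assms by (simp add: algebra_simps)
  have nth: "fps_nth A (Suc k) = fps_nth schur k + a * fps_nth (A * schur) k" for k
    by (subst A) (simp add: fps_mult_fps_X_commute)
  show 0: "fps_nth A 0 = - cnj a"
    by (subst A) simp
  show 1: "fps_nth A 1 = (1 - a * cnj a) * fps_nth schur 0"
    using nth[of 0] by (simp add: 0 algebra_simps)
  show 2: "fps_nth A 2 = (1 - a * cnj a) * (fps_nth schur 1 + a * (fps_nth schur 0)\<^sup>2)"
  proof -
    have "fps_nth A 2 = fps_nth schur 1 + a * (fps_nth A 0 * fps_nth schur 1 + fps_nth A 1 * fps_nth schur 0)"
      using nth[of 1] by (simp add: fps_mult_nth eval_nat_numeral)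
    then show ?thesis unfolding 0 1 by (simp add: algebra_simps power2_eq_square)
  qed
  show 3: "fps_nth A 3 = (1 - a * cnj a) *
      (fps_nth schur 2 + 2 * a * fps_nth schur 0 * fps_nth schur 1 + a\<^sup>2 * fps_nth schur 0 ^ 3)"
  proof -
    have "fps_nth A 3 = fps_nth schur 2 + a * (fps_nth A 0 * fps_nth schur 2 + fps_nth A 1 * fps_nth schur 1 + fps_nth A 2 * fps_nth schur 0)"
      using nth[of 2] by (simp add: fps_mult_nth eval_nat_numeral)
    then show ?thesis unfolding 0 1 2 by (simp add: algebra_simps power2_eq_square power3_eq_cube)
  qed
qed

text \<open>With u = a X s and s for \<open>schur\<close>, the hypothesis is G' = -u' / (1 - u) with
  the denominator cleared, so G is ln (1 - u) up to its constant term. Comparing coefficients gives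
  a recursion for those of positive order.\<close>

lemma log_fps_coeffs:
  fixes G schur :: "complex fps"
  assumes "fps_deriv G * (1 - fps_const a * fps_X * schur) = - fps_deriv (fps_const a * fps_X * schur)"
  defines "b \<equiv> fps_nth schur"
  shows "fps_nth G 1 = - a * b 0"
    and "fps_nth G 2 = - a * b 1 - a\<^sup>2 * (b 0)\<^sup>2 / 2"
    and "fps_nth G 3 = - a * b 2 - a\<^sup>2 * b 0 * b 1 - a ^ 3 * b 0 ^ 3 / 3"
    and "fps_nth G 4 = - a * b 3 - a\<^sup>2 * (b 0 * b 2 + (b 1)\<^sup>2 / 2) - a ^ 3 * (b 0)\<^sup>2 * b 1 - a ^ 4 * b 0 ^ 4 / 4"
proof -
  define g where "g = fps_nth G"
  have e: "fps_deriv G = fps_const a * (fps_X * (fps_deriv G * schur)) - fps_const a * fps_deriv (fps_X * schur)"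
    using assms(1) by (simp add: algebra_simps)
  have nth0: "g 1 = - a * b 0"
    using arg_cong[OF e, of "\<lambda>F. fps_nth F 0"] by (simp add: g_def b_def)
  have nth: "of_nat (k + 2) * g (k + 2) = a * (\<Sum>i=0..k. of_nat (i + 1) * g (i + 1) * b (k - i)) - a * of_nat (k + 2) * b (k + 1)" for k
  proof -
    have "fps_nth (fps_deriv G) (Suc k) = a * fps_nth (fps_deriv G * schur) k - a * fps_nth (fps_deriv (fps_X * schur)) (Suc k)"
      by (subst e) (simp add: fps_mult_fps_X_commute)
    moreover have "fps_nth (fps_deriv (fps_X * schur)) (Suc k) = of_nat (k + 2) * b (k + 1)"
      unfolding fps_deriv_nth by (simp add: b_def fps_mult_fps_X_commute)
    moreover have "fps_nth (fps_deriv G * schur) k = (\<Sum>i=0..k. of_nat (i + 1) * g (i + 1) * b (k - i))"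
      by (simp add: fps_mult_nth g_def b_def mult.assoc)
    ultimately show ?thesis by (simp add: g_def mult.assoc)
  qed
  show 1: "fps_nth G 1 = - a * b 0" using nth0 by (simp add: g_def)
  have 2: "g 2 = - a * b 1 - a\<^sup>2 * (b 0)\<^sup>2 / 2"
  proof -
    have "2 * g 2 = a * (g 1 * b 0) - a * 2 * b 1"
      using nth[of 0] by (simp add: eval_nat_numeral)
    then have e2: "g 2 = (a * (g 1 * b 0) - a * 2 * b 1) / 2" by (simp add: eq_divide_eq mult.commute[of "g 2"])
    show ?thesis unfolding e2 nth0 by (simp add: field_simps power2_eq_square)
  qed
  then show "fps_nth G 2 = - a * b 1 - a\<^sup>2 * (b 0)\<^sup>2 / 2" by (simp add: g_def)
  have "3 * g 3 = a * (g 1 * b 1 + 2 * g 2 * b 0) - a * 3 * b 2"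
    using nth[of 1] by (simp add: eval_nat_numeral)
  then have e3: "g 3 = (a * (g 1 * b 1 + 2 * g 2 * b 0) - a * 3 * b 2) / 3" by (simp add: eq_divide_eq mult.commute[of "g 3"])
  have 3: "g 3 = - a * b 2 - a\<^sup>2 * b 0 * b 1 - a ^ 3 * b 0 ^ 3 / 3"
    unfolding e3 nth0 2 by (simp add: field_simps power2_eq_square power3_eq_cube)
  then show "fps_nth G 3 = - a * b 2 - a\<^sup>2 * b 0 * b 1 - a ^ 3 * b 0 ^ 3 / 3" by (simp add: g_def)
  have "4 * g 4 = a * (g 1 * b 2 + 2 * g 2 * b 1 + 3 * g 3 * b 0) - a * 4 * b 3"
    using nth[of 2] by (simp add: eval_nat_numeral)
  then have e4: "g 4 = (a * (g 1 * b 2 + 2 * g 2 * b 1 + 3 * g 3 * b 0) - a * 4 * b 3) / 4" by (simp add: eq_divide_eq mult.commute[of "g 4"])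
  have "g 4 = - a * b 3 - a\<^sup>2 * (b 0 * b 2 + (b 1)\<^sup>2 / 2) - a ^ 3 * (b 0)\<^sup>2 * b 1 - a ^ 4 * b 0 ^ 4 / 4"
    unfolding e4 nth0 2 3 by (simp add: field_simps power2_eq_square power3_eq_cube power4_eq_xxxx)
  then show "fps_nth G 4 = - a * b 3 - a\<^sup>2 * (b 0 * b 2 + (b 1)\<^sup>2 / 2) - a ^ 3 * (b 0)\<^sup>2 * b 1 - a ^ 4 * b 0 ^ 4 / 4"
    by (simp add: g_def)
qed

context opuc
begin

text \<open>\<psi>_n has the modulus of \<Phi>_n on the circle, and having no zeros in the closed
  disc it makes 1 / \<psi>_n accessible to Cauchy's formula.\<close>

definition bernstein_szego :: "nat \<Rightarrow> real \<Rightarrow> real" where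
  "bernstein_szego n \<theta> = h n / (norm (poly (\<psi> n) (cis \<theta>)))\<^sup>2"

definition szego_entropy :: "nat \<Rightarrow> real" where
  "szego_entropy n = (\<integral>\<theta>. weight \<theta> * ln (bernstein_szego n \<theta>) \<partial>angle_measure)"

text \<open>Taylor series at 0 of \<Phi>_n / \<psi>_n; the constant term of \<psi>_n is 1. The Szego
  recursion acts on it as a step of the Schur algorithm run backwards, see
  \<open>schur_Moebius\<close>.\<close>

definition schur :: "nat \<Rightarrow> complex fps" where
  "schur n = fps_of_poly (\<Phi> n) * inverse (fps_of_poly (\<psi> n))"

lemma rev_poly_cis_nonzero: "poly (\<psi> n) (cis \<theta>) \<noteq> 0"
  by (rule rev_poly_nonzero) simp

lemma bernstein_szego_pos: "bernstein_szego n \<theta> > 0"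
  using h_pos[of n] rev_poly_cis_nonzero[of n \<theta>] by (simp add: bernstein_szego_def)

lemma continuous_bernstein_szego: "continuous_on S (bernstein_szego n)"
  unfolding bernstein_szego_def using rev_poly_cis_nonzero
  by (intro continuous_intros) auto

lemma integrable_weight_bernstein_szego:
  "integrable angle_measure (\<lambda>\<theta>. weight \<theta> * ln (bernstein_szego n \<theta>))"
  using bernstein_szego_pos[of n] less_imp_neq
  by (intro angle_measure_integrable_continuous continuous_intros continuous_weight continuous_bernstein_szego) fastforce

lemma szego_entropy_0: "szego_entropy 0 = 0"
  by (simp add: szego_entropy_def bernstein_szego_def h_0)

lemma fps_rev_poly_nonzero: "fps_of_poly (\<psi> n) \<noteq> 0" "fps_nth (fps_of_poly (\<psi> n)) 0 = 1"
proof -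
  show "fps_nth (fps_of_poly (\<psi> n)) 0 = 1" using rev_poly_0[of n] by (simp add: poly_0_coeff_0)
  then show "fps_of_poly (\<psi> n) \<noteq> 0" by auto
qed

lemma schur_mult: "schur n * fps_of_poly (\<psi> n) = fps_of_poly (\<Phi> n)"
  using inverse_mult_eq_1[of "fps_of_poly (\<psi> n)"] fps_rev_poly_nonzero[of n]
  by (simp add: schur_def mult.assoc)

lemma schur_Moebius:
  "schur (Suc n) * (1 - fps_const (\<alpha> n) * fps_X * schur n) = fps_X * schur n - fps_const (cnj (\<alpha> n))"
proof -
  let ?s = "fps_of_poly (\<psi> n)"
  have 1: "fps_of_poly (\<Phi> (Suc n)) = ?s * (fps_X * schur n - fps_const (cnj (\<alpha> n)))"
    unfolding Szego_recursion using schur_mult[of n]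
    by (simp add: fps_of_poly_diff fps_of_poly_smult fps_of_poly_pCons algebra_simps)
  have 2: "fps_of_poly (\<psi> (Suc n)) = ?s * (1 - fps_const (\<alpha> n) * fps_X * schur n)"
    using schur_mult[of n]
    by (simp add: fps_of_poly_diff fps_of_poly_smult fps_of_poly_pCons algebra_simps)
  have "?s * (schur (Suc n) * (1 - fps_const (\<alpha> n) * fps_X * schur n)) = ?s * (fps_X * schur n - fps_const (cnj (\<alpha> n)))"
    using schur_mult[of "Suc n"] unfolding 1 2 by (simp only: mult_ac)
  then show ?thesis using fps_rev_poly_nonzero(1)[of n] by simp
qed

text \<open>\<open>\<psi>\<^bsub>n+1\<^esub> = \<psi>\<^sub>n (1 - \<alpha>\<^sub>n z b\<^sub>n)\<close> with \<open>b\<^sub>n = \<Phi>\<^sub>n / \<psi>\<^sub>n\<close>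
  of modulus at most one, so the increment only involves the principal logarithm.\<close>

lemma szego_entropy_Suc:
  obtains G where
    "fps_deriv G * (1 - fps_const (\<alpha> n) * fps_X * schur n) = - fps_deriv (fps_const (\<alpha> n) * fps_X * schur n)"
    "szego_entropy (Suc n) - szego_entropy n = 10 / 16 * ln (1 - (norm (\<alpha> n))\<^sup>2) -
      2 * Re (- 4 * fps_nth G 1 - 4 * fps_nth G 2 + 4 * fps_nth G 3 - fps_nth G 4) / 16"
proof -
  define u where "u z = \<alpha> n * z * (poly (\<Phi> n) z * inverse (poly (\<psi> n) z))" for z
  define g where "g z = Ln (1 - u z)" for z
  have u_less: "norm (u z) < 1" if "norm z \<le> 1" for z
  proof -
    have "norm (poly (\<Phi> n) z * inverse (poly (\<psi> n) z)) \<le> 1"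
      using Phi_le_rev_poly[OF that, of n] rev_poly_nonzero[OF that, of n]
      by (simp add: divide_inverse[symmetric] norm_divide divide_le_eq_1)
    then have "norm (z * (poly (\<Phi> n) z * inverse (poly (\<psi> n) z))) \<le> 1"
      using that unfolding norm_mult[of z] by (simp add: mult_le_one)
    then have "norm (u z) \<le> norm (\<alpha> n)"
      unfolding u_def mult.assoc norm_mult[of "\<alpha> n"] by (rule mult_left_le) simp
    then show ?thesis using alpha_less_1[of n] by linarith
  qed
  have Re_pos: "Re (1 - u z) > 0" if "norm z \<le> 1" for z
    using u_less[OF that] complex_Re_le_cmod[of "u z"] by simp
  have nonpos: "1 - u z \<notin> \<real>\<^sub>\<le>\<^sub>0" if "norm z \<le> 1" for z
    using Re_pos[OF that] by (auto simp: complex_nonpos_Reals_iff)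
  have hu: "u holomorphic_on ball 0 1"
    unfolding u_def using rev_poly_nonzero[of _ n] by (intro holomorphic_intros) auto
  have cu: "continuous_on (cball 0 1) u"
    unfolding u_def using rev_poly_nonzero[of _ n] by (intro continuous_intros) auto
  have hg: "g holomorphic_on ball 0 1"
    unfolding g_def using nonpos by (intro holomorphic_intros hu) auto
  have cg: "continuous_on (cball 0 1) g"
    unfolding g_def using nonpos by (intro continuous_intros cu) auto
  define G where "G = fps_expansion g 0"
  have G: "g has_fps_expansion G"
    unfolding G_def by (rule has_fps_expansion_fps_expansion[OF _ _ hg]) auto
  have poly_exp: "(\<lambda>z. poly p z) has_fps_expansion fps_of_poly p" for p :: "complex poly"
    by (simp add: has_fps_expansion_def)
  have U: "u has_fps_expansion fps_const (\<alpha> n) * fps_X * schur n"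
    unfolding u_def schur_def
    by (intro has_fps_expansion_mult has_fps_expansion_inverse has_fps_expansion_const
        has_fps_expansion_fps_X poly_exp) (use fps_rev_poly_nonzero(2) in simp)
  have deriv_g: "deriv g z * (1 - u z) = - deriv u z" if "z \<in> ball 0 1" for z
  proof -
    have "(u has_field_derivative deriv u z) (at z)"
      using hu that by (intro holomorphic_derivI[of _ "ball 0 1"]) auto
    then have "(g has_field_derivative (- deriv u z) / (1 - u z)) (at z)"
      unfolding g_def using nonpos[of z] that by (auto intro!: derivative_eq_intros simp: field_simps)
    then have "deriv g z = (- deriv u z) / (1 - u z)" by (rule DERIV_imp_deriv)
    moreover have "1 - u z \<noteq> 0" using nonpos[of z] that by auto
    ultimately show ?thesis by simp
  qed
  have X1: "(\<lambda>z. deriv g z * (1 - u z)) has_fps_expansion fps_deriv G * (1 - fps_const (\<alpha> n) * fps_X * schur n)"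
    by (intro has_fps_expansion_mult has_fps_expansion_deriv has_fps_expansion_diff G U has_fps_expansion_1)
  have X2: "(\<lambda>z. - deriv u z) has_fps_expansion - fps_deriv (fps_const (\<alpha> n) * fps_X * schur n)"
    by (intro has_fps_expansion_minus has_fps_expansion_deriv U)
  have X3: "eventually (\<lambda>z. deriv g z * (1 - u z) = - deriv u z) (nhds 0)"
    by (rule eventually_mono[OF eventually_nhds_in_open[of "ball 0 1"]]) (use deriv_g in auto)
  have fps: "fps_deriv G * (1 - fps_const (\<alpha> n) * fps_X * schur n) = - fps_deriv (fps_const (\<alpha> n) * fps_X * schur n)"
    by (rule fps_expansion_unique_complex[OF iffD1[OF has_fps_expansion_cong[OF X3 refl] X1] X2])
  \<comment> \<open>Hence the mean 10 / 16 of the weight meets only the constant ln (1 -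
    |\<alpha>_n|^2).\<close>
  have G0: "fps_nth G 0 = 0" by (simp add: G_def fps_expansion_def g_def u_def)
  have int: "(\<integral>\<theta>. of_real (weight \<theta>) * g (cis \<theta>) \<partial>angle_measure) =
      (- 4 * fps_nth G 1 - 4 * fps_nth G 2 + 4 * fps_nth G 3 - fps_nth G 4) / 16"
    using integral_weight_holomorphic[OF cg hg] by (simp add: G_def[symmetric] G0)
  have cgc: "continuous_on UNIV (\<lambda>\<theta>. g (cis \<theta>))"
    by (rule continuous_on_cis_compose[OF continuous_on_subset[OF cg]]) auto
  have ig: "integrable angle_measure (\<lambda>\<theta>. of_real (weight \<theta>) * g (cis \<theta>))"
    by (intro angle_measure_integrable_continuous continuous_intros continuous_weight cgc)
  have pointwise: "weight \<theta> * ln (bernstein_szego (Suc n) \<theta>) =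
      weight \<theta> * ln (bernstein_szego n \<theta>) + ln (1 - (norm (\<alpha> n))\<^sup>2) * weight \<theta>
        - 2 * Re (of_real (weight \<theta>) * g (cis \<theta>))" for \<theta>
  proof -
    let ?z = "cis \<theta>"
    have z: "norm ?z \<le> 1" by simp
    have nz: "poly (\<psi> n) ?z \<noteq> 0" "1 - u ?z \<noteq> 0"
      using rev_poly_nonzero[OF z] nonpos[OF z] by auto
    have "poly (\<psi> (Suc n)) ?z = poly (\<psi> n) ?z * (1 - u ?z)"
      using nz by (simp add: u_def field_simps)
    then have "bernstein_szego (Suc n) \<theta> = (1 - (norm (\<alpha> n))\<^sup>2) * bernstein_szego n \<theta> / (norm (1 - u ?z))\<^sup>2"
      by (simp add: bernstein_szego_def h_Suc norm_mult power_mult_distrib)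
    moreover have "1 - (norm (\<alpha> n))\<^sup>2 > 0"
      using alpha_less_1[of n] by (simp add: power_less_one_iff abs_square_less_1)
    ultimately have "ln (bernstein_szego (Suc n) \<theta>) =
        ln (1 - (norm (\<alpha> n))\<^sup>2) + ln (bernstein_szego n \<theta>) - ln ((norm (1 - u ?z))\<^sup>2)"
      using bernstein_szego_pos[of n \<theta>] nz by (simp add: ln_div ln_mult)
    also have "ln ((norm (1 - u ?z))\<^sup>2) = 2 * Re (g ?z)"
      using nz by (simp add: g_def ln_realpow)
    finally have eq: "ln (bernstein_szego (Suc n) \<theta>) =
        ln (1 - (norm (\<alpha> n))\<^sup>2) + ln (bernstein_szego n \<theta>) - 2 * Re (g ?z)" .
    show ?thesis unfolding eq by (simp add: algebra_simps)
  qed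
  have W0: "(\<integral>\<theta>. weight \<theta> \<partial>angle_measure) = 10 / 16"
  proof -
    have "(\<integral>\<theta>. complex_of_real (weight \<theta>) * 1 \<partial>angle_measure) = 10 / 16"
      using integral_weight_holomorphic[of "\<lambda>_. 1"] by (simp add: fps_expansion_def)
    then have "complex_of_real (\<integral>\<theta>. weight \<theta> \<partial>angle_measure) = complex_of_real (10 / 16)"
      by (simp flip: integral_complex_of_real)
    then show ?thesis by (simp only: of_real_eq_iff)
  qed
  have "has_bochner_integral angle_measure (\<lambda>\<theta>. weight \<theta> * ln (bernstein_szego (Suc n) \<theta>))
      (szego_entropy n + ln (1 - (norm (\<alpha> n))\<^sup>2) * (10 / 16) -
        2 * Re ((- 4 * fps_nth G 1 - 4 * fps_nth G 2 + 4 * fps_nth G 3 - fps_nth G 4) / 16))"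
    unfolding pointwise
  proof (intro has_bochner_integral_diff has_bochner_integral_add has_bochner_integral_mult_right)
    show "has_bochner_integral angle_measure (\<lambda>\<theta>. weight \<theta> * ln (bernstein_szego n \<theta>)) (szego_entropy n)"
      using integrable_weight_bernstein_szego by (simp add: has_bochner_integral_iff szego_entropy_def)
    show "has_bochner_integral angle_measure weight (10 / 16)"
      using W0 angle_measure_integrable_continuous(1)[OF continuous_weight] by (simp add: has_bochner_integral_iff)
    show "has_bochner_integral angle_measure (\<lambda>\<theta>. Re (of_real (weight \<theta>) * g (cis \<theta>)))
       (Re ((- 4 * fps_nth G 1 - 4 * fps_nth G 2 + 4 * fps_nth G 3 - fps_nth G 4) / 16))"
      using ig int integral_Re[OF ig] integrable_Re[OF ig] by (simp only: has_bochner_integral_iff simp_thms)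
  qed
  then have "szego_entropy (Suc n) - szego_entropy n = 10 / 16 * ln (1 - (norm (\<alpha> n))\<^sup>2) -
      2 * Re (- 4 * fps_nth G 1 - 4 * fps_nth G 2 + 4 * fps_nth G 3 - fps_nth G 4) / 16"
    unfolding szego_entropy_def[of "Suc n"] by (simp add: has_bochner_integral_iff)
  with fps show ?thesis using that by blast
qed

end

section \<open>The Bernstein--Szego approximation\<close>

context opuc
begin

text \<open>Linear in F, and shown below to vanish on z^k and its conjugate for k <= n; complex test
  functions allow the powers to be treated one at a time.\<close>

definition defect :: "nat \<Rightarrow> (complex \<Rightarrow> complex) \<Rightarrow> complex" where
  "defect n F = (\<integral>z. F z \<partial>\<mu>) - (\<integral>\<theta>. F (cis \<theta>) * of_real (bernstein_szego n \<theta>) \<partial>angle_measure)"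

lemma integrable_bernstein_szego:
  fixes F :: "complex \<Rightarrow> complex"
  assumes "continuous_on UNIV F"
  shows "integrable angle_measure (\<lambda>\<theta>. F (cis \<theta>) * of_real (bernstein_szego n \<theta>))"
  by (intro angle_measure_integrable_continuous continuous_intros continuous_bernstein_szego
      continuous_on_cis_compose continuous_on_subset[OF assms]) auto

lemma defect_sum:
  assumes "\<And>i. i \<in> A \<Longrightarrow> continuous_on UNIV (F i)"
  shows "defect n (\<lambda>z. \<Sum>i\<in>A. c i * F i z) = (\<Sum>i\<in>A. c i * defect n (F i))"
proof -
  have "(\<integral>z. (\<Sum>i\<in>A. c i * F i z) \<partial>\<mu>) = (\<Sum>i\<in>A. c i * (\<integral>z. F i z \<partial>\<mu>))"
    by (subst Bochner_Integration.integral_sum)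
      (auto intro!: integrable_continuous continuous_intros assms)
  moreover have "(\<integral>\<theta>. (\<Sum>i\<in>A. c i * F i (cis \<theta>)) * of_real (bernstein_szego n \<theta>) \<partial>angle_measure) =
     (\<Sum>i\<in>A. c i * (\<integral>\<theta>. F i (cis \<theta>) * of_real (bernstein_szego n \<theta>) \<partial>angle_measure))"
    unfolding sum_distrib_right mult.assoc
    by (subst Bochner_Integration.integral_sum)
      (auto intro!: integrable_mult_right integrable_bernstein_szego assms)
  ultimately show ?thesis by (simp add: defect_def sum_subtractf right_diff_distrib)
qed

lemma defect_cong:
  assumes "continuous_on UNIV F" "continuous_on UNIV G" "\<And>z. norm z = 1 \<Longrightarrow> F z = G z"
  shows "defect n F = defect n G"
  unfolding defect_def using integral_circle_cong[OF assms] assms(3) by simp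

lemma defect_cnj: "defect n (\<lambda>z. cnj (F z)) = cnj (defect n F)"
proof -
  have "(\<integral>\<theta>. cnj (F (cis \<theta>)) * of_real (bernstein_szego n \<theta>) \<partial>angle_measure) =
      (\<integral>\<theta>. cnj (F (cis \<theta>) * of_real (bernstein_szego n \<theta>)) \<partial>angle_measure)" by simp
  also have "\<dots> = cnj (\<integral>\<theta>. F (cis \<theta>) * of_real (bernstein_szego n \<theta>) \<partial>angle_measure)"
    by (rule Bochner_Integration.integral_cnj)
  finally show ?thesis
    unfolding defect_def Bochner_Integration.integral_cnj complex_cnj_diff by simp
qed

lemma cnj_power_circle: "norm z = 1 \<Longrightarrow> cnj (z ^ k) * z ^ k = 1" for z :: complex
  using circle_cnj_mult by (metis complex_cnj_power power_mult_distrib power_one)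

lemma Phi_from_rev_poly: "norm z = 1 \<Longrightarrow> poly (\<Phi> n) z = z ^ n * cnj (poly (\<psi> n) z)"
  using rev_poly_circle[of z n] cnj_power_circle[of z n]
  by (metis (no_types, lifting) complex_cnj_cnj complex_cnj_mult mult.assoc mult.commute mult.right_neutral)

text \<open>On the circle \<Phi>_n times the density is h_n z^n / \<psi>_n, so the second integral
  is h_n times the mean of z^(n-k) / \<psi>_n, which is holomorphic in the disc. For k < n both
  integrals are 0, for k = n both are h_n.\<close>

lemma defect_Phi_self:
  assumes "k \<le> n"
  shows "defect n (\<lambda>z. cnj (z ^ k) * poly (\<Phi> n) z) = 0"
proof -
  let ?f = "\<lambda>z. inverse (poly (\<psi> n) z)"
  have f: "continuous_on (cball 0 1) ?f" "?f holomorphic_on ball 0 1"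
    using rev_poly_nonzero[of _ n] by (intro continuous_intros holomorphic_intros; auto)+
  have "cnj (cis \<theta> ^ k) * poly (\<Phi> n) (cis \<theta>) * of_real (bernstein_szego n \<theta>) =
      of_real (h n) * (?f (cis \<theta>) * cis \<theta> ^ (n - k))" for \<theta>
  proof -
    let ?z = "cis \<theta>" and ?s = "poly (\<psi> n) (cis \<theta>)"
    have "?z ^ n = ?z ^ (n - k) * ?z ^ k" using assms by (simp flip: power_add)
    then have 1: "cnj (?z ^ k) * ?z ^ n = ?z ^ (n - k)"
      using cnj_power_circle[of ?z k] by (metis norm_cis mult.assoc mult.commute mult.right_neutral)
    have "of_real (bernstein_szego n \<theta>) = of_real (h n) / (?s * cnj ?s)"
      by (simp add: bernstein_szego_def complex_norm_square flip: of_real_power)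
    then have "cnj (?z ^ k) * poly (\<Phi> n) ?z * of_real (bernstein_szego n \<theta>) =
      (cnj (?z ^ k) * ?z ^ n) * cnj ?s * (of_real (h n) / (?s * cnj ?s))"
      by (simp add: Phi_from_rev_poly)
    also have "\<dots> = of_real (h n) * (?f ?z * ?z ^ (n - k))"
      unfolding 1 using rev_poly_cis_nonzero[of n \<theta>] by (simp add: field_simps)
    finally show ?thesis .
  qed
  then have 2: "(\<integral>\<theta>. cnj (cis \<theta> ^ k) * poly (\<Phi> n) (cis \<theta>) * of_real (bernstein_szego n \<theta>) \<partial>angle_measure)
      = of_real (h n) * (\<integral>\<theta>. ?f (cis \<theta>) * cis \<theta> ^ (n - k) \<partial>angle_measure)"
    by simp
  show ?thesis
  proof (cases "k = n")
    case True
    have "(\<integral>\<theta>. ?f (cis \<theta>) * cis \<theta> ^ (n - k) \<partial>angle_measure) = 1"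
      using circle_mean_Taylor[OF f, of 0] True by (simp add: fps_expansion_def)
    moreover have "(\<integral>z. cnj (z ^ n) * poly (\<Phi> n) z \<partial>\<mu>) = of_real (h n)"
    proof -
      have "of_real (h n) = (\<integral>z. cnj (poly (\<Phi> n) z) * poly (\<Phi> n) z \<partial>\<mu>)"
        unfolding h_def integral_complex_of_real[symmetric]
        by (simp only: complex_norm_square mult.commute)
      also have "\<dots> = (\<Sum>i\<le>n. cnj (coeff (\<Phi> n) i) * (\<integral>z. cnj (z ^ i) * poly (\<Phi> n) z \<partial>\<mu>))"
        by (subst integral_cnj_poly_mult) (intro continuous_intros, simp add: Phi_degree)
      also have "\<dots> = (\<Sum>i\<le>n. if i = n then \<integral>z. cnj (z ^ n) * poly (\<Phi> n) z \<partial>\<mu> else 0)"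
        using Phi_orth_power[of _ n] Phi_lead[of n] by (intro sum.cong) (auto simp: less_le)
      finally show ?thesis by simp
    qed
    ultimately show ?thesis unfolding defect_def 2 using True by simp
  next
    case False
    then have "k < n" using assms by simp
    then show ?thesis unfolding defect_def 2
      using circle_mean_power[OF f, of "n - k"] Phi_orth_power[of k n] by simp
  qed
qed

text \<open>Descending induction: the inverse Szego recursion writes \<open>z \<Phi>\<^sub>m\<close> as a combination of
  \<open>\<Phi>\<^bsub>m+1\<^esub>\<close> and its reversal, for which the defect is known to vanish.\<close>

lemma defect_Phi:
  assumes "m \<le> n" "k \<le> m"
  shows "defect n (\<lambda>z. cnj (z ^ k) * poly (\<Phi> m) z) = 0"
  using assms
proof (induction m arbitrary: k rule: inc_induct)
  case base
  then show ?case by (rule defect_Phi_self)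
next
  case (step m)
  let ?k = "Suc k"
  have 1: "defect n (\<lambda>z. cnj (z ^ ?k) * poly (\<Phi> (Suc m)) z) = 0"
    by (rule step.IH) (use step.prems in simp)
  have "defect n (\<lambda>z. cnj (z ^ ?k) * poly (\<psi> (Suc m)) z) =
      defect n (\<lambda>z. cnj (cnj (z ^ (Suc m - ?k)) * poly (\<Phi> (Suc m)) z))"
  proof (intro defect_cong continuous_intros)
    fix z :: complex assume z: "norm z = 1"
    have "z ^ Suc m = z ^ (Suc m - ?k) * z ^ ?k"
      using step.prems by (metis Suc_le_mono le_add_diff_inverse2 power_add)
    then have "cnj (z ^ ?k) * z ^ Suc m = z ^ (Suc m - ?k)"
      using cnj_power_circle[OF z, of ?k] by (metis mult.assoc mult.commute mult.right_neutral)
    then show "cnj (z ^ ?k) * poly (\<psi> (Suc m)) z = cnj (cnj (z ^ (Suc m - ?k)) * poly (\<Phi> (Suc m)) z)"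
      unfolding rev_poly_circle[OF z] mult.assoc[symmetric] by simp
  qed
  also have "\<dots> = cnj (defect n (\<lambda>z. cnj (z ^ (Suc m - ?k)) * poly (\<Phi> (Suc m)) z))"
    by (rule defect_cnj)
  also have "\<dots> = 0" by (subst step.IH) simp_all
  finally have 2: "defect n (\<lambda>z. cnj (z ^ ?k) * poly (\<psi> (Suc m)) z) = 0" .
  \<comment> \<open>\<open>bool\<close> indexes the two terms of the inverse Szego recursion, so
    that \<open>defect_sum\<close> applies to them.\<close>
  define c :: "bool \<Rightarrow> complex" where "c b = (if b then 1 else cnj (\<alpha> m)) / (1 - \<alpha> m * cnj (\<alpha> m))" for b
  define F where "F b z = cnj (z ^ ?k) * poly (if b then \<Phi> (Suc m) else \<psi> (Suc m)) z" for b z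
  have nz: "1 - \<alpha> m * cnj (\<alpha> m) \<noteq> 0"
  proof
    assume "1 - \<alpha> m * cnj (\<alpha> m) = 0"
    then have "norm (\<alpha> m * cnj (\<alpha> m)) = 1" by (metis eq_iff_diff_eq_0 norm_one)
    then have "norm (\<alpha> m) * norm (\<alpha> m) = 1" by (simp add: norm_mult)
    then show False using alpha_less_1[of m] mult_strict_mono[of "norm (\<alpha> m)" 1 "norm (\<alpha> m)" 1] by simp
  qed
  have "defect n (\<lambda>z. cnj (z ^ k) * poly (\<Phi> m) z) = defect n (\<lambda>z. \<Sum>b\<in>UNIV. c b * F b z)"
  proof (intro defect_cong continuous_intros)
    show "continuous_on UNIV (F b)" for b unfolding F_def by (intro continuous_intros)
    fix z :: complex assume z: "norm z = 1"
    have "(\<Sum>b\<in>UNIV. c b * F b z) = cnj (z ^ ?k) * ((poly (\<Phi> (Suc m)) z + cnj (\<alpha> m) * poly (\<psi> (Suc m)) z)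
        / (1 - \<alpha> m * cnj (\<alpha> m)))"
      by (simp add: UNIV_bool c_def F_def add_divide_distrib diff_divide_distrib algebra_simps)
    also have "poly (\<Phi> (Suc m)) z + cnj (\<alpha> m) * poly (\<psi> (Suc m)) z =
        (1 - \<alpha> m * cnj (\<alpha> m)) * (z * poly (\<Phi> m) z)"
      by (simp add: Szego_recursion algebra_simps)
    also have "\<dots> / (1 - \<alpha> m * cnj (\<alpha> m)) = z * poly (\<Phi> m) z" using nz by simp
    also have "cnj (z ^ ?k) * (z * poly (\<Phi> m) z) = (cnj z * z) * cnj (z ^ k) * poly (\<Phi> m) z"
      by (simp add: mult_ac)
    finally show "cnj (z ^ k) * poly (\<Phi> m) z = (\<Sum>b\<in>UNIV. c b * F b z)"
      using circle_cnj_mult[OF z] by simp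
  qed
  also have "\<dots> = (\<Sum>b\<in>UNIV. c b * defect n (F b))"
    unfolding F_def by (intro defect_sum continuous_intros)
  also have "\<dots> = 0"
  proof -
    have "F True = (\<lambda>z. cnj (z ^ ?k) * poly (\<Phi> (Suc m)) z)"
      "F False = (\<lambda>z. cnj (z ^ ?k) * poly (\<psi> (Suc m)) z)"
      by (simp_all only: F_def if_True if_False fun_eq_iff simp_thms)
    with 1 2 have "defect n (F True) = 0" "defect n (F False) = 0" by (simp_all only:)
    then show ?thesis by (simp add: UNIV_bool)
  qed
  finally show ?case .
qed

text \<open>z^m is \<Phi>_m minus a combination of lower powers, and \<open>defect_Phi\<close> with
  k = 0 disposes of \<Phi>_m.\<close>

lemma defect_power:
  assumes "m \<le> n"
  shows "defect n (\<lambda>z. z ^ m) = 0"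
  using assms
proof (induction m rule: less_induct)
  case (less m)
  have "defect n (\<lambda>z. poly (\<Phi> m) z) = 0"
    using defect_Phi[of m n 0] less.prems by simp
  also have "(\<lambda>z. poly (\<Phi> m) z) = (\<lambda>z. \<Sum>i\<le>m. coeff (\<Phi> m) i * z ^ i)"
    by (simp add: poly_altdef Phi_degree)
  also have "defect n \<dots> = (\<Sum>i\<le>m. coeff (\<Phi> m) i * defect n (\<lambda>z. z ^ i))"
    by (intro defect_sum continuous_intros)
  also have "\<dots> = (\<Sum>i\<le>m. if i = m then defect n (\<lambda>z. z ^ m) else 0)"
    using less Phi_lead[of m] by (intro sum.cong) (auto simp: less_le)
  finally show ?case by simp
qed

text \<open>On the circle Re z = (z + 1/z) / 2 and Im z = (z - 1/z) / (2 i), so real polynomials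
  become Laurent polynomials; as 1/z = cnj z, the factor \<open>cnj (z ^ N)\<close> absorbs the
  negative powers.\<close>

lemma real_polynomial_function_circle:
  fixes p :: "complex \<Rightarrow> real"
  assumes "real_polynomial_function p"
  shows "\<exists>N P. \<forall>z. norm z = 1 \<longrightarrow> complex_of_real (p z) = cnj (z ^ N) * poly P z"
  using assms
proof (induction rule: real_polynomial_function.induct)
  case (linear f)
  define P where "P = [: (of_real (f 1) + \<i> * of_real (f \<i>)) / 2, 0, (of_real (f 1) - \<i> * of_real (f \<i>)) / 2 :]"
  have "complex_of_real (f z) = cnj (z ^ 1) * poly P z" if z: "norm z = 1" for z
  proof -
    have "z = Re z *\<^sub>R 1 + Im z *\<^sub>R \<i>" by (simp add: complex_eq_iff)
    then have "f z = f (Re z *\<^sub>R 1 + Im z *\<^sub>R \<i>)" by (rule arg_cong)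
    also have "\<dots> = Re z * f 1 + Im z * f \<i>"
      using linear.hyps by (simp add: bounded_linear.linear linear_add linear_scale)
    finally have f: "complex_of_real (f z) = of_real (Re z) * of_real (f 1) + of_real (Im z) * of_real (f \<i>)"
      by simp
    have "cnj (z ^ 1) * poly P z = cnj z * (of_real (f 1) + \<i> * of_real (f \<i>)) / 2
      + (cnj z * z) * z * (of_real (f 1) - \<i> * of_real (f \<i>)) / 2"
      by (simp add: P_def algebra_simps add_divide_distrib diff_divide_distrib)
    also have "\<dots> = of_real (f 1) * ((z + cnj z) / 2) + of_real (f \<i>) * (- \<i> * ((z - cnj z) / 2))"
      unfolding circle_cnj_mult[OF z] by (simp add: field_simps)
    also have "(z + cnj z) / 2 = of_real (Re z)" by (simp add: complex_add_cnj)
    also have "- \<i> * ((z - cnj z) / 2) = of_real (Im z)" by (simp add: complex_eq_iff)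
    finally show ?thesis by (simp add: f mult.commute)
  qed
  then show ?case by blast
next
  case (const c)
  have "complex_of_real c = cnj (z ^ 0) * poly [: of_real c :] z" for z by simp
  then show ?case by blast
next
  case (add f g)
  obtain N P M Q where 1: "\<And>z. norm z = 1 \<Longrightarrow> complex_of_real (f z) = cnj (z ^ N) * poly P z"
    and 2: "\<And>z. norm z = 1 \<Longrightarrow> complex_of_real (g z) = cnj (z ^ M) * poly Q z"
    using add.IH by metis
  have "complex_of_real (f z + g z) = cnj (z ^ (N + M)) * poly (monom 1 M * P + monom 1 N * Q) z"
    if z: "norm z = 1" for z
  proof -
    have "cnj (z ^ (N + M)) * poly (monom 1 M * P + monom 1 N * Q) z =
      (cnj (z ^ M) * z ^ M) * (cnj (z ^ N) * poly P z) + (cnj (z ^ N) * z ^ N) * (cnj (z ^ M) * poly Q z)"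
      by (simp add: poly_monom power_add algebra_simps)
    then show ?thesis unfolding cnj_power_circle[OF z] by (simp add: 1[OF z] 2[OF z])
  qed
  then show ?case by blast
next
  case (mult f g)
  obtain N P M Q where 1: "\<And>z. norm z = 1 \<Longrightarrow> complex_of_real (f z) = cnj (z ^ N) * poly P z"
    and 2: "\<And>z. norm z = 1 \<Longrightarrow> complex_of_real (g z) = cnj (z ^ M) * poly Q z"
    using mult.IH by metis
  have "complex_of_real (f z * g z) = cnj (z ^ (N + M)) * poly (P * Q) z" if z: "norm z = 1" for z
    using 1[OF z] 2[OF z] by (simp add: power_add)
  then show ?case by blast
qed

lemma bernstein_szego_integral:
  fixes p :: "complex \<Rightarrow> real"
  assumes p: "real_polynomial_function p"
  shows "\<exists>n. (\<integral>\<theta>. p (cis \<theta>) * bernstein_szego n \<theta> \<partial>angle_measure) = (\<integral>z. p z \<partial>\<mu>)"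
proof -
  obtain N P where P: "\<And>z. norm z = 1 \<Longrightarrow> complex_of_real (p z) = cnj (z ^ N) * poly P z"
    using real_polynomial_function_circle[OF p] by blast
  have cp: "continuous_on UNIV p"
    using p by (simp add: continuous_on_eq_continuous_within continuous_real_polymonial_function)
  \<comment> \<open>All exponents i - N with i <= degree P then lie between -n and n.\<close>
  define n where "n = max N (degree P)"
  have "defect n (\<lambda>z. complex_of_real (p z)) = defect n (\<lambda>z. \<Sum>i\<le>degree P. coeff P i * (cnj (z ^ N) * z ^ i))"
    by (intro defect_cong continuous_intros cp) (simp add: P poly_altdef sum_distrib_left mult_ac)
  also have "\<dots> = (\<Sum>i\<le>degree P. coeff P i * defect n (\<lambda>z. cnj (z ^ N) * z ^ i))"
    by (intro defect_sum continuous_intros)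
  also have "\<dots> = 0"
  proof (intro sum.neutral ballI)
    fix i assume i: "i \<in> {..degree P}"
    have "defect n (\<lambda>z. cnj (z ^ N) * z ^ i) = 0"
    proof (cases "N \<le> i")
      case True
      have "defect n (\<lambda>z. cnj (z ^ N) * z ^ i) = defect n (\<lambda>z. z ^ (i - N))"
      proof (intro defect_cong continuous_intros)
        fix z :: complex assume z: "norm z = 1"
        have "z ^ i = z ^ N * z ^ (i - N)" using True by (simp flip: power_add)
        then show "cnj (z ^ N) * z ^ i = z ^ (i - N)"
          using cnj_power_circle[OF z, of N] by (simp flip: mult.assoc)
      qed
      then show ?thesis using i defect_power[of "i - N" n] by (simp add: n_def)
    next
      case False
      have "defect n (\<lambda>z. cnj (z ^ N) * z ^ i) = defect n (\<lambda>z. cnj (z ^ (N - i)))"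
      proof (intro defect_cong continuous_intros)
        fix z :: complex assume z: "norm z = 1"
        have "z ^ N = z ^ (N - i) * z ^ i" using False by (simp flip: power_add)
        then show "cnj (z ^ N) * z ^ i = cnj (z ^ (N - i))"
          using cnj_power_circle[OF z, of i] by (simp add: mult.assoc)
      qed
      also have "\<dots> = cnj (defect n (\<lambda>z. z ^ (N - i)))" by (rule defect_cnj)
      finally show ?thesis using defect_power[of "N - i" n] by (simp add: n_def)
    qed
    then show "coeff P i * defect n (\<lambda>z. cnj (z ^ N) * z ^ i) = 0" by simp
  qed
  finally have "complex_of_real (\<integral>z. p z \<partial>\<mu>) = complex_of_real (\<integral>\<theta>. p (cis \<theta>) * bernstein_szego n \<theta> \<partial>angle_measure)"
    by (simp add: defect_def flip: of_real_mult)
  then show ?thesis by (metis of_real_eq_iff)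
qed

end

section \<open>Approximation by continuous functions\<close>

lemma finite_borel_between:
  fixes M :: "'a::{second_countable_topology, complete_space} measure"
  assumes M: "finite_measure M" "sets M = sets borel" and A: "A \<in> sets borel" and e: "e > 0"
  obtains K U where "compact K" "K \<subseteq> A" "open U" "A \<subseteq> U" "measure M (U - K) < e"
proof -
  interpret finite_measure M by (rule M(1))
  have fin: "emeasure M (space M) \<noteq> \<infinity>" by simp
  have "emeasure M A < emeasure M A + ennreal (e / 2)"
    using e by (simp add: emeasure_eq_measure ennreal_less_iff flip: ennreal_plus)
  then have "(INF U \<in> {U. A \<subseteq> U \<and> open U}. emeasure M U) < emeasure M A + ennreal (e / 2)"
    using outer_regular[OF M(2) fin A] by simp
  then obtain U where U: "A \<subseteq> U" "open U" "emeasure M U < emeasure M A + ennreal (e / 2)"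
    unfolding INF_less_iff by blast
  have "\<exists>K. K \<subseteq> A \<and> compact K \<and> emeasure M A < emeasure M K + ennreal (e / 2)"
  proof (cases "emeasure M A < ennreal (e / 2)")
    case True
    then show ?thesis by (intro exI[of _ "{}"]) auto
  next
    case False
    have "ennreal (measure M A - e / 2) < emeasure M A"
      using e False by (auto simp: emeasure_eq_measure ennreal_less_iff)
    then have "ennreal (measure M A - e / 2) < (SUP K \<in> {K. K \<subseteq> A \<and> compact K}. emeasure M K)"
      using inner_regular[OF M(2) fin A] by simp
    then obtain K where K: "K \<subseteq> A" "compact K" "ennreal (measure M A - e / 2) < emeasure M K"
      unfolding less_SUP_iff by blast
    have "measure M A - e / 2 < measure M K"
      using K(3) e False by (auto simp: emeasure_eq_measure ennreal_less_iff)
    then show ?thesis using K e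
      by (intro exI[of _ K]) (simp add: emeasure_eq_measure ennreal_less_iff flip: ennreal_plus)
  qed
  then obtain K where K: "K \<subseteq> A" "compact K" "emeasure M A < emeasure M K + ennreal (e / 2)" by blast
  have UA: "measure M U < measure M A + e / 2"
    using U(3) e by (simp add: emeasure_eq_measure ennreal_less_iff flip: ennreal_plus)
  have AK: "measure M A < measure M K + e / 2"
    using K(3) e by (simp add: emeasure_eq_measure ennreal_less_iff flip: ennreal_plus)
  have "measure M (U - K) = measure M U - measure M K"
    using K U by (intro finite_measure_Diff) (auto simp: M(2) compact_imp_closed)
  also have "\<dots> < e" using UA AK by linarith
  finally show thesis using that K U by blast
qed

text \<open>Regularity gives a compact set inside and an open set around A for each measure. A
  Urysohn function for the union of the compact sets and the intersection of the open ones differs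
  from the indicator only on a set that is small for both measures.\<close>

lemma indicator_continuous_approx:
  fixes M1 M2 :: "complex measure"
  assumes M1: "finite_measure M1" "sets M1 = sets borel"
    and M2: "finite_measure M2" "sets M2 = sets borel"
    and A: "A \<in> sets borel" and e: "e > 0"
  obtains g :: "complex \<Rightarrow> real" where "continuous_on UNIV g" "\<And>x. 0 \<le> g x" "\<And>x. g x \<le> 1"
    "(\<integral>x. \<bar>indicator A x - g x\<bar> \<partial>M1) \<le> e" "(\<integral>x. \<bar>indicator A x - g x\<bar> \<partial>M2) \<le> e"
proof -
  obtain K1 U1 where 1: "compact K1" "K1 \<subseteq> A" "open U1" "A \<subseteq> U1" "measure M1 (U1 - K1) < e"
    by (rule finite_borel_between[OF M1 A e])
  obtain K2 U2 where 2: "compact K2" "K2 \<subseteq> A" "open U2" "A \<subseteq> U2" "measure M2 (U2 - K2) < e"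
    by (rule finite_borel_between[OF M2 A e])
  have "closed (- (U1 \<inter> U2))" "closed (K1 \<union> K2)" "- (U1 \<inter> U2) \<inter> (K1 \<union> K2) = {}"
    using 1 2 by (auto intro: compact_imp_closed)
  from Urysohn[OF this, of "0::real" 1] obtain g :: "complex \<Rightarrow> real" where g: "continuous_on UNIV g"
    "\<And>x. g x \<in> closed_segment 0 1" "\<And>x. x \<in> - (U1 \<inter> U2) \<Longrightarrow> g x = 0" "\<And>x. x \<in> K1 \<union> K2 \<Longrightarrow> g x = 1"
    by blast
  have g01: "0 \<le> g x" "g x \<le> 1" for x using g(2)[of x] by (auto simp: closed_segment_eq_real_ivl)
  have bound: "(\<integral>x. \<bar>indicator A x - g x\<bar> \<partial>M) \<le> e"
    if M: "finite_measure M" "sets M = sets borel" and D: "D \<in> sets borel" "measure M D < e"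
      "(U1 \<inter> U2) - (K1 \<union> K2) \<subseteq> D" for M D
  proof -
    interpret finite_measure M by (rule M(1))
    have sp: "space M = UNIV" using sets_eq_imp_space_eq[OF M(2)] by simp
    have le: "\<bar>indicator A x - g x\<bar> \<le> indicator D x" for x
      using g01[of x] g(3)[of x] g(4)[of x] D(3) 1 2 by (cases "x \<in> A"; cases "x \<in> D") (auto simp: abs_le_iff)
    have gm: "g \<in> borel_measurable M"
      using borel_measurable_continuous_onI[OF g(1)] by (simp add: measurable_cong_sets[OF M(2) refl])
    have Am: "A \<in> sets M" "D \<in> sets M" using A D M by auto
    have i1: "integrable M (indicator D :: _ \<Rightarrow> real)"
      using Am by (intro integrable_real_indicator) (simp_all add: emeasure_eq_measure)
    have i2: "integrable M (\<lambda>x. \<bar>indicator A x - g x\<bar>)"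
      by (rule Bochner_Integration.integrable_bound[OF i1]) (use gm Am le in auto)
    have "(\<integral>x. \<bar>indicator A x - g x\<bar> \<partial>M) \<le> (\<integral>x. indicator D x \<partial>M)"
      by (rule integral_mono[OF i2 i1]) (rule le)
    also have "\<dots> = measure M D" using Am by (simp add: sp)
    finally show ?thesis using D by simp
  qed
  have "(\<integral>x. \<bar>indicator A x - g x\<bar> \<partial>M1) \<le> e"
    by (rule bound[OF M1, of "U1 - K1"]) (use 1 in \<open>auto intro: borel_open borel_compact\<close>)
  moreover have "(\<integral>x. \<bar>indicator A x - g x\<bar> \<partial>M2) \<le> e"
    by (rule bound[OF M2, of "U2 - K2"]) (use 2 in \<open>auto intro: borel_open borel_compact\<close>)
  ultimately show thesis using that[of g] g(1) g01 by blast
qed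

text \<open>The sum counts the multiples of \<delta> in (0, t], so it is \<delta> times the floor of
  t / \<delta>; the bound on t makes m levels enough.\<close>

lemma layer_sum_approx:
  fixes t \<delta> :: real
  assumes "0 \<le> t" "t \<le> real m * \<delta>" "\<delta> > 0"
  shows "\<bar>t - (\<Sum>j<m. \<delta> * (if real (Suc j) * \<delta> \<le> t then 1 else 0))\<bar> \<le> \<delta>"
proof -
  define k where "k = nat \<lfloor>t / \<delta>\<rfloor>"
  have "real k = of_int \<lfloor>t / \<delta>\<rfloor>" using assms by (simp add: k_def)
  then have k: "real k \<le> t / \<delta>" "t / \<delta> < real k + 1" by linarith+
  then have kt: "real k * \<delta> \<le> t" "t < (real k + 1) * \<delta>"
    using assms(3) by (simp_all add: field_simps)
  have "real k \<le> real m" using kt(1) assms(2,3) by (meson mult_le_cancel_right_pos order_trans)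
  then have km: "k \<le> m" by simp
  have iff: "real (Suc j) * \<delta> \<le> t \<longleftrightarrow> j < k" for j
  proof
    assume "real (Suc j) * \<delta> \<le> t"
    then have "real (Suc j) * \<delta> < (real k + 1) * \<delta>" using kt(2) by linarith
    then show "j < k" using assms(3) by simp
  next
    assume "j < k"
    then have "real (Suc j) * \<delta> \<le> real k * \<delta>" using assms(3) by (intro mult_right_mono) auto
    then show "real (Suc j) * \<delta> \<le> t" using kt(1) by linarith
  qed
  have "(\<Sum>j<m. \<delta> * (if real (Suc j) * \<delta> \<le> t then 1 else 0)) = (\<Sum>j<m. if j \<in> {..<k} then \<delta> else 0)"
    unfolding iff by (intro sum.cong) auto
  also have "\<dots> = (\<Sum>j\<in>{..<m} \<inter> {..<k}. \<delta>)" by (rule sum.inter_restrict[symmetric]) simp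
  also have "{..<m} \<inter> {..<k} = {..<k}" using km by auto
  also have "(\<Sum>j\<in>{..<k}. \<delta>) = real k * \<delta>" by simp
  finally show ?thesis using kt by (simp add: algebra_simps)
qed

text \<open>Superlevel sets of f are approximated one by one. A common g for two measures is needed
  because the entropy inequality compares an integral over arc length with one over \<mu>.\<close>

lemma bounded_continuous_approx:
  fixes M1 M2 :: "complex measure" and f :: "complex \<Rightarrow> real"
  assumes M1: "prob_space M1" "sets M1 = sets borel"
    and M2: "prob_space M2" "sets M2 = sets borel"
    and f: "f \<in> borel_measurable borel" "\<And>x. 0 \<le> f x" "\<And>x. f x \<le> C" and e: "e > 0"
  obtains g :: "complex \<Rightarrow> real" where "continuous_on UNIV g" "\<And>x. 0 \<le> g x"
    "(\<integral>x. \<bar>f x - g x\<bar> \<partial>M1) \<le> e" "(\<integral>x. \<bar>f x - g x\<bar> \<partial>M2) \<le> e"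
proof -
  define \<delta> where "\<delta> = e / 2"
  have \<delta>: "\<delta> > 0" using e by (simp add: \<delta>_def)
  obtain m where m: "C / \<delta> \<le> real m" using real_arch_simple by blast
  then have m: "C \<le> real m * \<delta>" using \<delta> by (simp add: field_simps)
  define A where "A j = {x. real (Suc j) * \<delta> \<le> f x}" for j
  have A: "A j \<in> sets borel" for j unfolding A_def using f(1) by measurable
  \<comment> \<open>m layers of height \<delta> with error \<eta> each cost at most \<delta>, the
    discretisation costs another \<delta>, and \<delta> = e / 2.\<close>
  define \<eta> where "\<eta> = 1 / (real m + 1)"
  have \<eta>: "\<eta> > 0" by (simp add: \<eta>_def)
  have fin: "finite_measure M1" "finite_measure M2"
    using M1 M2 by (simp_all add: prob_space_def)
  define P where "P j g \<longleftrightarrow> continuous_on UNIV g \<and> (\<forall>x. 0 \<le> g x) \<and> (\<forall>x. g x \<le> 1) \<and>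
    (\<integral>x. \<bar>indicator (A j) x - g x\<bar> \<partial>M1) \<le> \<eta> \<and> (\<integral>x. \<bar>indicator (A j) x - g x\<bar> \<partial>M2) \<le> \<eta>"
    for j and g :: "complex \<Rightarrow> real"
  have "\<exists>g. P j g" for j
    by (rule indicator_continuous_approx[OF fin(1) M1(2) fin(2) M2(2) A[of j] \<eta>]) (auto simp: P_def)
  then have "\<forall>j. \<exists>g. P j g" by blast
  from choice[OF this] obtain g where Pg: "\<And>j. P j (g j)" by blast
  have g: "continuous_on UNIV (g j)" "0 \<le> g j x" "g j x \<le> 1"
    "(\<integral>x. \<bar>indicator (A j) x - g j x\<bar> \<partial>M1) \<le> \<eta>"
    "(\<integral>x. \<bar>indicator (A j) x - g j x\<bar> \<partial>M2) \<le> \<eta>" for j x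
    using Pg[of j] by (simp_all add: P_def)
  define G where "G x = (\<Sum>j<m. \<delta> * g j x)" for x
  have le: "\<bar>f x - G x\<bar> \<le> \<delta> + (\<Sum>j<m. \<delta> * \<bar>indicator (A j) x - g j x\<bar>)" for x
  proof -
    have "f x \<le> real m * \<delta>" using f(3)[of x] m by linarith
    have "\<bar>f x - (\<Sum>j<m. \<delta> * indicator (A j) x)\<bar> \<le> \<delta>"
    proof -
      have "indicator (A j) x = (if real (Suc j) * \<delta> \<le> f x then 1 else 0 :: real)" for j
        by (simp only: A_def indicator_def mem_Collect_eq of_bool_def)
      then show ?thesis
        using layer_sum_approx[OF f(2) \<open>f x \<le> real m * \<delta>\<close> \<delta>] by (simp only:)
    qed
    moreover have "\<bar>(\<Sum>j<m. \<delta> * indicator (A j) x) - G x\<bar> \<le> (\<Sum>j<m. \<bar>\<delta> * indicator (A j) x - \<delta> * g j x\<bar>)"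
      unfolding G_def sum_subtractf[symmetric] by (rule sum_abs)
    moreover have "(\<Sum>j<m. \<bar>\<delta> * indicator (A j) x - \<delta> * g j x\<bar>) = (\<Sum>j<m. \<delta> * \<bar>indicator (A j) x - g j x\<bar>)"
      using \<delta> by (intro sum.cong) (auto simp: abs_mult simp flip: right_diff_distrib)
    ultimately show ?thesis by linarith
  qed
  have bound: "(\<integral>x. \<bar>f x - G x\<bar> \<partial>M) \<le> e"
    if M: "prob_space M" "sets M = sets borel" and gM: "\<And>j. (\<integral>x. \<bar>indicator (A j) x - g j x\<bar> \<partial>M) \<le> \<eta>" for M
  proof -
    interpret prob_space M by (rule M(1))
    have [measurable_cong]: "sets M = sets borel" by (rule M(2))
    have gm [measurable]: "g j \<in> borel_measurable borel" for j
      by (rule borel_measurable_continuous_onI[OF g(1)])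
    have Gm: "G \<in> borel_measurable borel" unfolding G_def by measurable
    have [measurable]: "A j \<in> sets borel" for j by (rule A)
    have ij: "integrable M (\<lambda>x. \<bar>indicator (A j) x - g j x\<bar>)" for j
    proof (rule integrable_const_bound[of _ 1])
      show "AE x in M. norm \<bar>indicator (A j) x - g j x\<bar> \<le> 1"
      proof (rule AE_I2)
        fix x
        show "norm \<bar>indicator (A j) x - g j x\<bar> \<le> 1"
          using g(2)[of j x] g(3)[of j x] by (cases "x \<in> A j") simp_all
      qed
      show "(\<lambda>x. \<bar>indicator (A j) x - g j x\<bar>) \<in> borel_measurable M" by measurable
    qed
    have isum: "integrable M (\<lambda>x. \<delta> + (\<Sum>j<m. \<delta> * \<bar>indicator (A j) x - g j x\<bar>))"
      by (intro Bochner_Integration.integrable_add integrable_const Bochner_Integration.integrable_sum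
          integrable_mult_right ij)
    have "(\<integral>x. \<bar>f x - G x\<bar> \<partial>M) \<le> (\<integral>x. \<delta> + (\<Sum>j<m. \<delta> * \<bar>indicator (A j) x - g j x\<bar>) \<partial>M)"
    proof (rule integral_mono)
      show "integrable M (\<lambda>x. \<bar>f x - G x\<bar>)"
        by (rule Bochner_Integration.integrable_bound[OF isum])
          (use le f(1) Gm in \<open>auto intro!: order_trans[OF le] simp: measurable_cong_sets[OF M(2) refl]\<close>)
    qed (use isum le in auto)
    also have "\<dots> = \<delta> + (\<Sum>j<m. \<delta> * (\<integral>x. \<bar>indicator (A j) x - g j x\<bar> \<partial>M))"
    proof -
      have "(\<integral>x. (\<Sum>j<m. \<delta> * \<bar>indicator (A j) x - g j x\<bar>) \<partial>M) = (\<Sum>j<m. \<delta> * (\<integral>x. \<bar>indicator (A j) x - g j x\<bar> \<partial>M))"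
        by (subst Bochner_Integration.integral_sum) (intro integrable_mult_right ij, simp)
      moreover have "integrable M (\<lambda>x. \<Sum>j<m. \<delta> * \<bar>indicator (A j) x - g j x\<bar>)"
        by (intro Bochner_Integration.integrable_sum integrable_mult_right ij)
      ultimately show ?thesis
        by (subst Bochner_Integration.integral_add) (auto simp: prob_space)
    qed
    also have "\<dots> \<le> \<delta> + (\<Sum>j<m. \<delta> * \<eta>)"
      using \<delta> by (intro add_left_mono sum_mono mult_left_mono gM) auto
    also have "\<dots> \<le> e"
    proof -
      have "real m * \<eta> \<le> 1" by (simp add: \<eta>_def field_simps)
      then have "\<delta> * (real m * \<eta>) \<le> \<delta> * 1" using \<delta> by (intro mult_left_mono) auto
      then show ?thesis by (simp add: \<delta>_def mult_ac)
    qed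
    finally show ?thesis .
  qed
  show thesis
  proof (rule that[of G])
    show "continuous_on UNIV G" unfolding G_def by (intro continuous_intros g)
    show "0 \<le> G x" for x unfolding G_def using \<delta> g(2) by (intro sum_nonneg) auto
  qed (intro bound M1 M2 g)+
qed

section \<open>Entropy bounds\<close>

text \<open>The Lebesgue decomposition is given only as an identity between values on sets;
  induction over measurable functions transfers it to integrals.\<close>

lemma nn_integral_add_measures:
  assumes s: "sets M1 = sets M" "sets M2 = sets M"
    and add: "\<And>A. A \<in> sets M \<Longrightarrow> emeasure M A = emeasure M1 A + emeasure M2 A"
    and f: "f \<in> borel_measurable M"
  shows "(\<integral>\<^sup>+x. f x \<partial>M) = (\<integral>\<^sup>+x. f x \<partial>M1) + (\<integral>\<^sup>+x. f x \<partial>M2)"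
proof -
  have meas: "f \<in> borel_measurable M1" "f \<in> borel_measurable M2"
    if "f \<in> borel_measurable M" for f :: "'a \<Rightarrow> ennreal"
    using that measurable_cong_sets[OF s(1) refl] measurable_cong_sets[OF s(2) refl] by auto
  show ?thesis
    using f
  proof (induction rule: borel_measurable_induct)
    case (cong f g)
    have "space M1 = space M" "space M2 = space M" using s sets_eq_imp_space_eq by blast+
    then have "(\<integral>\<^sup>+x. f x \<partial>M) = (\<integral>\<^sup>+x. g x \<partial>M)" "(\<integral>\<^sup>+x. f x \<partial>M1) = (\<integral>\<^sup>+x. g x \<partial>M1)"
      "(\<integral>\<^sup>+x. f x \<partial>M2) = (\<integral>\<^sup>+x. g x \<partial>M2)"
      using cong(3) by (auto intro!: nn_integral_cong)
    then show ?case using cong(4) by simp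
  next
    case (set A)
    then show ?case using s add[of A] by simp
  next
    case (mult u c)
    have IH: "integral\<^sup>N M u = integral\<^sup>N M1 u + integral\<^sup>N M2 u" by fact
    show ?case
      unfolding nn_integral_cmult[OF \<open>u \<in> borel_measurable M\<close>] IH distrib_left
        nn_integral_cmult[OF meas(1)[OF \<open>u \<in> borel_measurable M\<close>]]
        nn_integral_cmult[OF meas(2)[OF \<open>u \<in> borel_measurable M\<close>]] ..
  next
    case (add u v)
    have IH: "integral\<^sup>N M u = integral\<^sup>N M1 u + integral\<^sup>N M2 u"
      "integral\<^sup>N M v = integral\<^sup>N M1 v + integral\<^sup>N M2 v" by fact+
    have uv: "u \<in> borel_measurable M" "v \<in> borel_measurable M" by fact+
    show ?case
      unfolding nn_integral_add[OF uv(2,1)] nn_integral_add[OF meas(1)[OF uv(2)] meas(1)[OF uv(1)]]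
        nn_integral_add[OF meas(2)[OF uv(2)] meas(2)[OF uv(1)]] IH by (simp only: add_ac)
  next
    case (seq U)
    have IH: "integral\<^sup>N M (U i) = integral\<^sup>N M1 (U i) + integral\<^sup>N M2 (U i)" for i
      by fact
    have U: "U i \<in> borel_measurable M" for i by fact
    have "incseq U" by fact
    have inc: "incseq (\<lambda>i. integral\<^sup>N N (U i))" for N
      using \<open>incseq U\<close> by (auto simp: incseq_def le_fun_def intro!: nn_integral_mono)
    have "(\<integral>\<^sup>+x. (SUP i. U i x) \<partial>M) = (SUP i. integral\<^sup>N M1 (U i) + integral\<^sup>N M2 (U i))"
      unfolding nn_integral_monotone_convergence_SUP[OF \<open>incseq U\<close> U] IH ..
    also have "\<dots> = (SUP i. integral\<^sup>N M1 (U i)) + (SUP i. integral\<^sup>N M2 (U i))"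
      by (rule ennreal_SUP_add[OF inc inc])
    also have "\<dots> = (\<integral>\<^sup>+x. (SUP i. U i x) \<partial>M1) + (\<integral>\<^sup>+x. (SUP i. U i x) \<partial>M2)"
      unfolding nn_integral_monotone_convergence_SUP[OF \<open>incseq U\<close> meas(1)[OF U]]
        nn_integral_monotone_convergence_SUP[OF \<open>incseq U\<close> meas(2)[OF U]] ..
    finally show ?case unfolding SUP_apply .
  qed
qed

lemma ln_le_self: "x > 0 \<Longrightarrow> ln x \<le> x" for x :: real
  by (rule less_imp_le[OF ln_less_self])

lemma ln_diff_le_two_abs:
  fixes x y :: real
  assumes "x > 0" "y \<ge> 1 / 2"
  shows "ln x - ln y \<le> 2 * \<bar>x - y\<bar>"
proof -
  have "ln x - ln y \<le> (x - y) / y" using assms by (intro ln_diff_le) auto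
  also have "\<dots> \<le> \<bar>x - y\<bar> / y" using assms by (intro divide_right_mono) auto
  also have "\<dots> \<le> \<bar>x - y\<bar> / (1 / 2)" using assms by (intro divide_left_mono) auto
  finally show ?thesis by simp
qed

context opuc
begin

lemma integrable_weight_ln:
  assumes "continuous_on UNIV g" "\<And>z. norm z = 1 \<Longrightarrow> g z > 0"
  shows "integrable angle_measure (\<lambda>\<theta>. weight \<theta> * ln (g (cis \<theta>)))"
proof -
  have "continuous_on UNIV (\<lambda>\<theta>. g (cis \<theta>))"
    by (intro continuous_on_cis_compose continuous_on_subset[OF assms(1)]) auto
  moreover have "g (cis \<theta>) \<noteq> 0" for \<theta> using assms(2)[of "cis \<theta>"] by simp
  ultimately show ?thesis
    by (intro angle_measure_integrable_continuous continuous_intros continuous_weight) auto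
qed

text \<open>n is chosen after p, so that p has the same integral against w_n and \<mu>; this is why
  the lower bound K must be uniform in n. The factor 16 bounds the weight.\<close>

lemma szego_entropy_bounded_below_polynomial:
  assumes K: "\<And>n. - K \<le> szego_entropy n"
    and p: "real_polynomial_function p" "\<And>z. norm z = 1 \<Longrightarrow> p z > 0"
  shows "(\<integral>\<theta>. weight \<theta> * ln (p (cis \<theta>)) \<partial>angle_measure) \<le> K + 16 * (\<integral>z. p z \<partial>\<mu>)"
proof -
  obtain n where n: "(\<integral>\<theta>. p (cis \<theta>) * bernstein_szego n \<theta> \<partial>angle_measure) = (\<integral>z. p z \<partial>\<mu>)"
    using bernstein_szego_integral[OF p(1)] by blast
  have cp: "continuous_on UNIV p"
    using p(1) by (simp add: continuous_on_eq_continuous_within continuous_real_polymonial_function)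
  have i1: "integrable angle_measure (\<lambda>\<theta>. weight \<theta> * ln (p (cis \<theta>)))"
    by (rule integrable_weight_ln[OF cp p(2)])
  have i3: "integrable angle_measure (\<lambda>\<theta>. p (cis \<theta>) * bernstein_szego n \<theta>)"
    by (intro angle_measure_integrable_continuous continuous_intros continuous_bernstein_szego
        continuous_on_cis_compose continuous_on_subset[OF cp]) auto
  have "szego_entropy n + (\<integral>\<theta>. weight \<theta> * ln (p (cis \<theta>)) \<partial>angle_measure) =
    (\<integral>\<theta>. weight \<theta> * ln (bernstein_szego n \<theta>) + weight \<theta> * ln (p (cis \<theta>)) \<partial>angle_measure)"
    unfolding szego_entropy_def by (rule Bochner_Integration.integral_add[symmetric, OF integrable_weight_bernstein_szego i1])
  also have "\<dots> \<le> (\<integral>\<theta>. 16 * (p (cis \<theta>) * bernstein_szego n \<theta>) \<partial>angle_measure)"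
  proof (rule integral_mono)
    show "integrable angle_measure (\<lambda>\<theta>. weight \<theta> * ln (bernstein_szego n \<theta>) + weight \<theta> * ln (p (cis \<theta>)))"
      by (intro Bochner_Integration.integrable_add integrable_weight_bernstein_szego i1)
    show "integrable angle_measure (\<lambda>\<theta>. 16 * (p (cis \<theta>) * bernstein_szego n \<theta>))"
      by (intro integrable_mult_right i3)
    fix \<theta>
    have pos: "bernstein_szego n \<theta> > 0" "p (cis \<theta>) > 0"
      using bernstein_szego_pos p(2) by auto
    have "weight \<theta> * ln (bernstein_szego n \<theta>) + weight \<theta> * ln (p (cis \<theta>)) = weight \<theta> * ln (p (cis \<theta>) * bernstein_szego n \<theta>)"
      using pos by (simp add: ln_mult algebra_simps)
    also have "\<dots> \<le> weight \<theta> * (p (cis \<theta>) * bernstein_szego n \<theta>)"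
      using pos ln_le_self[OF mult_pos_pos[OF pos(2,1)]] weight_nonneg
      by (intro mult_left_mono)
    also have "\<dots> \<le> 16 * (p (cis \<theta>) * bernstein_szego n \<theta>)"
      using pos weight_le by (intro mult_right_mono) auto
    finally show "weight \<theta> * ln (bernstein_szego n \<theta>) + weight \<theta> * ln (p (cis \<theta>)) \<le> 16 * (p (cis \<theta>) * bernstein_szego n \<theta>)" .
  qed
  also have "\<dots> = 16 * (\<integral>z. p z \<partial>\<mu>)" by (simp add: n)
  finally show ?thesis using K[of n] by linarith
qed

lemma szego_entropy_bounded_below_continuous:
  assumes K: "\<And>n. - K \<le> szego_entropy n"
    and g: "continuous_on UNIV g" "\<And>z. g z \<ge> 1"
  shows "(\<integral>\<theta>. weight \<theta> * ln (g (cis \<theta>)) \<partial>angle_measure) \<le> K + 16 * (\<integral>z. g z \<partial>\<mu>)"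
proof (rule field_le_epsilon)
  fix \<epsilon> :: real assume \<epsilon>: "\<epsilon> > 0"
  interpret A: prob_space angle_measure by (rule prob_space_angle_measure)
  \<comment> \<open>e <= 1/2 keeps p >= 1/2, where ln has slope at most 2. The logarithm then costs
    32 e and the integral of p over \<mu> costs 16 e, together 48 e.\<close>
  define e where "e = min (1 / 2) (\<epsilon> / 48)"
  have e: "e > 0" "e \<le> 1 / 2" "48 * e \<le> \<epsilon>" using \<epsilon> by (auto simp: e_def)
  obtain p where p: "real_polynomial_function p" "\<And>z. z \<in> sphere 0 1 \<Longrightarrow> \<bar>g z - p z\<bar> < e"
    using Stone_Weierstrass_real_polynomial_function[OF compact_sphere continuous_on_subset[OF g(1)] e(1)]
    by (metis subset_UNIV)
  have p_ge: "p z \<ge> 1 / 2" "p z \<le> g z + e" "\<bar>g z - p z\<bar> \<le> e" if "norm z = 1" for z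
    using p(2)[of z] that g(2)[of z] e(2) by auto
  have cp: "continuous_on UNIV p"
    using p(1) by (simp add: continuous_on_eq_continuous_within continuous_real_polymonial_function)
  have p_pos: "p z > 0" if "norm z = 1" for z using p_ge(1)[OF that] by linarith
  have g_pos: "g z > 0" for z using g(2)[of z] by linarith
  have i1: "integrable angle_measure (\<lambda>\<theta>. weight \<theta> * ln (g (cis \<theta>)))"
    by (rule integrable_weight_ln[OF g(1)]) (rule g_pos)
  have i2: "integrable angle_measure (\<lambda>\<theta>. weight \<theta> * ln (p (cis \<theta>)))"
    by (rule integrable_weight_ln[OF cp]) (rule p_pos)
  have "(\<integral>\<theta>. weight \<theta> * ln (g (cis \<theta>)) \<partial>angle_measure) \<le> (\<integral>\<theta>. weight \<theta> * ln (p (cis \<theta>)) + 32 * e \<partial>angle_measure)"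
  proof (rule integral_mono[OF i1])
    show "integrable angle_measure (\<lambda>\<theta>. weight \<theta> * ln (p (cis \<theta>)) + 32 * e)"
      by (intro Bochner_Integration.integrable_add i2 A.integrable_const)
    fix \<theta>
    have "ln (g (cis \<theta>)) - ln (p (cis \<theta>)) \<le> 2 * \<bar>g (cis \<theta>) - p (cis \<theta>)\<bar>"
      using g_pos p_ge(1)[of "cis \<theta>"] by (intro ln_diff_le_two_abs) auto
    also have "\<dots> \<le> 2 * e" using p_ge(3)[of "cis \<theta>"] by simp
    finally have "weight \<theta> * (ln (g (cis \<theta>)) - ln (p (cis \<theta>))) \<le> weight \<theta> * (2 * e)"
      using weight_nonneg by (intro mult_left_mono)
    also have "\<dots> \<le> 16 * (2 * e)" using weight_le e by (intro mult_right_mono) auto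
    finally show "weight \<theta> * ln (g (cis \<theta>)) \<le> weight \<theta> * ln (p (cis \<theta>)) + 32 * e"
      by (simp add: right_diff_distrib)
  qed
  also have "\<dots> = (\<integral>\<theta>. weight \<theta> * ln (p (cis \<theta>)) \<partial>angle_measure) + 32 * e"
    using Bochner_Integration.integral_add[OF i2 A.integrable_const[of "32 * e"]] A.prob_space by simp
  also have "\<dots> \<le> K + 16 * (\<integral>z. p z \<partial>\<mu>) + 32 * e"
    using szego_entropy_bounded_below_polynomial[OF K p(1) p_pos] by simp
  finally have 1: "(\<integral>\<theta>. weight \<theta> * ln (g (cis \<theta>)) \<partial>angle_measure) \<le> K + 16 * (\<integral>z. p z \<partial>\<mu>) + 32 * e" .
  have "(\<integral>z. p z \<partial>\<mu>) \<le> (\<integral>z. g z + e \<partial>\<mu>)"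
  proof (rule integral_mono_AE)
    show "AE z in \<mu>. p z \<le> g z + e" using AE_circle p_ge(2) by auto
  qed (intro integrable_continuous continuous_intros cp g)+
  also have "\<dots> = (\<integral>z. g z \<partial>\<mu>) + e"
    using Bochner_Integration.integral_add[OF integrable_continuous[OF g(1)] integrable_const[of e]] prob_space by simp
  finally show "(\<integral>\<theta>. weight \<theta> * ln (g (cis \<theta>)) \<partial>angle_measure) \<le> K + 16 * (\<integral>z. g z \<partial>\<mu>) + \<epsilon>"
    using 1 e(3) by linarith
qed

text \<open>Approximating f - 1 by a nonnegative function and adding 1 back gives a continuous g >=
  1, as the previous bound requires. The errors are 32 e over arc length and 16 e over
  \<mu>.\<close>

lemma szego_entropy_bounded_below_measurable:
  assumes K: "\<And>n. - K \<le> szego_entropy n"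
    and f: "f \<in> borel_measurable borel" "\<And>z. f z \<ge> 1" "\<And>z. f z \<le> C"
  shows "(\<integral>\<theta>. weight \<theta> * ln (f (cis \<theta>)) \<partial>angle_measure) \<le> K + 16 * (\<integral>z. f z \<partial>\<mu>)"
proof (rule field_le_epsilon)
  fix \<epsilon> :: real assume \<epsilon>: "\<epsilon> > 0"
  interpret A: prob_space angle_measure by (rule prob_space_angle_measure)
  define e where "e = \<epsilon> / 48"
  have e: "e > 0" using \<epsilon> by (simp add: e_def)
  have cis: "cis \<in> borel_measurable borel"
    by (intro borel_measurable_continuous_onI continuous_intros)
  then have cisA: "cis \<in> measurable angle_measure borel"
    by (simp add: measurable_angle_measure)
  have D: "prob_space (distr angle_measure borel cis)" "sets (distr angle_measure borel cis) = sets borel"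
    using A.prob_space_distr[OF cisA] by auto
  have f0: "(\<lambda>z. f z - 1) \<in> borel_measurable borel" "\<And>z. 0 \<le> f z - 1" "\<And>z. f z - 1 \<le> C - 1"
    using f by (simp_all add: borel_measurable_diff)
  obtain g0 where g0: "continuous_on UNIV g0" "\<And>x. 0 \<le> g0 x"
    "(\<integral>x. \<bar>(f x - 1) - g0 x\<bar> \<partial>\<mu>) \<le> e" "(\<integral>x. \<bar>(f x - 1) - g0 x\<bar> \<partial>distr angle_measure borel cis) \<le> e"
    by (rule bounded_continuous_approx[OF prob_space_axioms sets_mu D f0 e]) (rule that)
  define g where "g z = 1 + g0 z" for z
  have g: "continuous_on UNIV g" "\<And>z. g z \<ge> 1"
    using g0 by (auto simp: g_def intro!: continuous_intros)
  have gm: "g \<in> borel_measurable borel" by (rule borel_measurable_continuous_onI[OF g(1)])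
  have fm: "f \<in> borel_measurable \<mu>" using f(1) by (simp add: measurable_cong_sets[OF sets_mu refl])
  have norm_f: "norm (f z) \<le> C" for z using f(2,3)[of z] by simp
  have fint: "integrable \<mu> f"
    by (rule integrable_const_bound[OF AE_I2 fm]) (rule norm_f)
  have ig: "integrable \<mu> g" by (rule integrable_continuous[OF g(1)])
  have igd: "integrable \<mu> (\<lambda>z. \<bar>f z - 1 - g0 z\<bar>)"
    by (intro integrable_abs Bochner_Integration.integrable_diff fint integrable_const
        integrable_continuous[OF g0(1)])
  have "(\<integral>z. g z \<partial>\<mu>) \<le> (\<integral>z. f z + \<bar>f z - 1 - g0 z\<bar> \<partial>\<mu>)"
    by (rule integral_mono[OF ig Bochner_Integration.integrable_add[OF fint igd]]) (simp add: g_def)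
  also have "\<dots> = (\<integral>z. f z \<partial>\<mu>) + (\<integral>z. \<bar>f z - 1 - g0 z\<bar> \<partial>\<mu>)"
    by (rule Bochner_Integration.integral_add[OF fint igd])
  finally have 1: "(\<integral>z. g z \<partial>\<mu>) \<le> (\<integral>z. f z \<partial>\<mu>) + e" using g0(3) by linarith
  have fc: "(\<lambda>\<theta>. f (cis \<theta>)) \<in> borel_measurable borel" by (rule measurable_compose[OF cis f(1)])
  have gc: "(\<lambda>\<theta>. g (cis \<theta>)) \<in> borel_measurable borel" by (rule measurable_compose[OF cis gm])
  have Wm: "weight \<in> borel_measurable borel" by (rule borel_measurable_continuous_onI[OF continuous_weight])
  have bound: "integrable angle_measure (\<lambda>\<theta>. weight \<theta> * ln (f (cis \<theta>)))"
  proof (rule A.integrable_const_bound[of _ "16 * C"])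
    show "AE \<theta> in angle_measure. norm (weight \<theta> * ln (f (cis \<theta>))) \<le> 16 * C"
    proof (rule AE_I2)
      fix \<theta>
      have l: "0 \<le> ln (f (cis \<theta>))" "ln (f (cis \<theta>)) \<le> C"
        using f(2,3)[of "cis \<theta>"] order_trans[OF ln_le_self[of "f (cis \<theta>)"], of C] by auto
      have "norm (weight \<theta> * ln (f (cis \<theta>))) = weight \<theta> * ln (f (cis \<theta>))"
        using weight_nonneg l by (simp add: abs_mult)
      also have "\<dots> \<le> 16 * C" using weight_le weight_nonneg l by (intro mult_mono) auto
      finally show "norm (weight \<theta> * ln (f (cis \<theta>))) \<le> 16 * C" .
    qed
    show "(\<lambda>\<theta>. weight \<theta> * ln (f (cis \<theta>))) \<in> borel_measurable angle_measure"
      unfolding measurable_angle_measure using fc Wm by measurable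
  qed
  have idiff: "integrable angle_measure (\<lambda>\<theta>. \<bar>f (cis \<theta>) - g (cis \<theta>)\<bar>)"
  proof -
    have "integrable angle_measure (\<lambda>\<theta>. f (cis \<theta>))"
    proof (rule A.integrable_const_bound[of _ C])
      show "AE \<theta> in angle_measure. norm (f (cis \<theta>)) \<le> C"
      proof (rule AE_I2)
        fix \<theta> show "norm (f (cis \<theta>)) \<le> C" using f(2,3)[of "cis \<theta>"] by simp
      qed
    qed (use fc in \<open>simp add: measurable_angle_measure\<close>)
    moreover have "integrable angle_measure (\<lambda>\<theta>. g (cis \<theta>))"
      by (intro angle_measure_integrable_continuous continuous_on_cis_compose continuous_on_subset[OF g(1)]) auto
    ultimately show ?thesis by (intro integrable_abs Bochner_Integration.integrable_diff)
  qed
  have ig2: "integrable angle_measure (\<lambda>\<theta>. weight \<theta> * ln (g (cis \<theta>)))"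
    by (rule integrable_weight_ln[OF g(1)]) (use g(2) in \<open>auto intro: less_le_trans[of 0 1]\<close>)
  have "(\<integral>\<theta>. weight \<theta> * ln (f (cis \<theta>)) \<partial>angle_measure) \<le>
      (\<integral>\<theta>. weight \<theta> * ln (g (cis \<theta>)) + 32 * \<bar>f (cis \<theta>) - g (cis \<theta>)\<bar> \<partial>angle_measure)"
  proof (rule integral_mono[OF bound])
    show "integrable angle_measure (\<lambda>\<theta>. weight \<theta> * ln (g (cis \<theta>)) + 32 * \<bar>f (cis \<theta>) - g (cis \<theta>)\<bar>)"
      by (intro Bochner_Integration.integrable_add ig2 integrable_mult_right idiff)
    fix \<theta>
    let ?d = "\<bar>f (cis \<theta>) - g (cis \<theta>)\<bar>"
    have "ln (f (cis \<theta>)) - ln (g (cis \<theta>)) \<le> 2 * ?d"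
      using f(2)[of "cis \<theta>"] g(2)[of "cis \<theta>"] by (intro ln_diff_le_two_abs) auto
    then have "weight \<theta> * (ln (f (cis \<theta>)) - ln (g (cis \<theta>))) \<le> weight \<theta> * (2 * ?d)"
      using weight_nonneg by (intro mult_left_mono)
    also have "\<dots> \<le> 16 * (2 * ?d)" using weight_le by (intro mult_right_mono) auto
    finally show "weight \<theta> * ln (f (cis \<theta>)) \<le> weight \<theta> * ln (g (cis \<theta>)) + 32 * ?d"
      by (simp add: right_diff_distrib)
  qed
  also have "\<dots> = (\<integral>\<theta>. weight \<theta> * ln (g (cis \<theta>)) \<partial>angle_measure) + 32 * (\<integral>\<theta>. \<bar>f (cis \<theta>) - g (cis \<theta>)\<bar> \<partial>angle_measure)"
    using Bochner_Integration.integral_add[OF ig2 integrable_mult_right[OF idiff, of 32]] by simp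
  also have "(\<integral>\<theta>. \<bar>f (cis \<theta>) - g (cis \<theta>)\<bar> \<partial>angle_measure) = (\<integral>x. \<bar>(f x - 1) - g0 x\<bar> \<partial>distr angle_measure borel cis)"
    using f(1) gm borel_measurable_continuous_onI[OF g0(1)]
    by (subst integral_distr[OF cisA]) (simp_all add: g_def algebra_simps)
  finally have "(\<integral>\<theta>. weight \<theta> * ln (f (cis \<theta>)) \<partial>angle_measure) \<le> (\<integral>\<theta>. weight \<theta> * ln (g (cis \<theta>)) \<partial>angle_measure) + 32 * e"
    using g0(4) by linarith
  also have "\<dots> \<le> K + 16 * (\<integral>z. g z \<partial>\<mu>) + 32 * e"
    using szego_entropy_bounded_below_continuous[OF K g] by simp
  finally show "(\<integral>\<theta>. weight \<theta> * ln (f (cis \<theta>)) \<partial>angle_measure) \<le> K + 16 * (\<integral>z. f z \<partial>\<mu>) + \<epsilon>"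
    using 1 unfolding e_def by linarith
qed

end

section \<open>The entropy of a measure with a given Lebesgue decomposition\<close>

lemma AE_angle_measure: "AE \<theta> in angle_measure. 0 < \<theta> \<and> \<theta> \<le> 2 * pi"
  unfolding angle_measure_def
proof (rule AE_uniform_measureI)
  show "AE x in lborel. x \<in> {0..2 * pi} \<longrightarrow> 0 < x \<and> x \<le> 2 * pi"
    using AE_lborel_singleton[of 0] by eventually_elim auto
qed simp

lemma cis_borel [measurable]: "cis \<in> borel_measurable borel"
  by (intro borel_measurable_continuous_onI continuous_intros)

lemma weight_borel [measurable]: "weight \<in> borel_measurable borel"
  by (rule borel_measurable_continuous_onI[OF continuous_weight])

text \<open>Inverse of \<open>cis\<close> on (0, 2 pi]: the imaginary part of \<open>Ln\<close> lies
  in (-pi, pi], hence the sign change and the shift by pi. It transports the density from the angle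
  to the circle.\<close>

definition angle_of :: "complex \<Rightarrow> real" where "angle_of z = Im (Ln (- z)) + pi"

lemma angle_of_borel [measurable]: "angle_of \<in> borel_measurable borel"
  unfolding angle_of_def by measurable

lemma angle_of_cis: "0 < \<theta> \<Longrightarrow> \<theta> \<le> 2 * pi \<Longrightarrow> angle_of (cis \<theta>) = \<theta>"
proof -
  assume \<theta>: "0 < \<theta>" "\<theta> \<le> 2 * pi"
  have "- cis \<theta> = cis (\<theta> - pi)" by (simp add: complex_eq_iff cos_diff sin_diff)
  then show ?thesis using \<theta> by (simp add: angle_of_def Ln_cis)
qed

locale opuc_decomposition = opuc +
  fixes w :: "real \<Rightarrow> real" and \<mu>s :: "complex measure"
  assumes decomp: "circle_lebesgue_decomp \<mu> w \<mu>s"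
begin

lemma w_borel [measurable]: "w \<in> borel_measurable borel"
  and w_nonneg: "\<theta> \<in> {0..2 * pi} \<Longrightarrow> 0 \<le> w \<theta>"
  and sets_mus: "sets \<mu>s = sets borel"
  using decomp by (auto simp: circle_lebesgue_decomp_def)

lemma nn_integral_decomp:
  assumes f [measurable]: "f \<in> borel_measurable borel"
  shows "(\<integral>\<^sup>+z. f z \<partial>\<mu>) = (\<integral>\<^sup>+\<theta>. ennreal (w \<theta>) * f (cis \<theta>) \<partial>angle_measure) + (\<integral>\<^sup>+z. f z \<partial>\<mu>s)"
proof -
  let ?D = "density angle_measure (\<lambda>\<theta>. ennreal (w \<theta>))"
  have cis: "cis \<in> measurable ?D borel" by (simp add: measurable_angle_measure cis_borel)
  have "(\<integral>\<^sup>+z. f z \<partial>\<mu>) = (\<integral>\<^sup>+z. f z \<partial>distr ?D borel cis) + (\<integral>\<^sup>+z. f z \<partial>\<mu>s)"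
  proof (rule nn_integral_add_measures)
    show "emeasure \<mu> A = emeasure (distr ?D borel cis) A + emeasure \<mu>s A" if "A \<in> sets \<mu>" for A
      using decomp that by (simp add: circle_lebesgue_decomp_def sets_mu)
  qed (simp_all add: sets_mu sets_mus measurable_cong_sets[OF sets_mu refl])
  also have "(\<integral>\<^sup>+z. f z \<partial>distr ?D borel cis) = (\<integral>\<^sup>+\<theta>. f (cis \<theta>) \<partial>?D)"
    by (rule nn_integral_distr[OF cis]) simp
  also have "\<dots> = (\<integral>\<^sup>+\<theta>. ennreal (w \<theta>) * f (cis \<theta>) \<partial>angle_measure)"
    by (rule nn_integral_density) (simp_all add: measurable_angle_measure)
  finally show ?thesis .
qed

lemma nn_integral_ac_le:
  assumes "f \<in> borel_measurable borel"
  shows "(\<integral>\<^sup>+\<theta>. ennreal (w \<theta>) * f (cis \<theta>) \<partial>angle_measure) \<le> (\<integral>\<^sup>+z. f z \<partial>\<mu>)"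
  unfolding nn_integral_decomp[OF assms] by simp

lemma nn_integral_w_le: "(\<integral>\<^sup>+\<theta>. ennreal (w \<theta>) \<partial>angle_measure) \<le> 1"
  using nn_integral_ac_le[of "\<lambda>_. 1"] emeasure_space_1 by simp

text \<open>Infinite where w vanishes and the weight does not; 0 where both vanish, by the
  convention for zero times infinity.\<close>

definition neg_part :: "real \<Rightarrow> ennreal" where
  "neg_part \<theta> = e2ennreal (- (ereal (weight \<theta>) * ext_ln (w \<theta>)))"

text \<open>The positive part is at most 16 w by ln x <= x, and w has integral at most one, so only
  the negative part can be infinite.\<close>

lemma ext_integral_iff_neg_part:
  "ext_integral angle_measure (\<lambda>\<theta>. ereal ((1 - cos \<theta>) ^ 3 * (1 + cos \<theta>)) * ext_ln (w \<theta>)) > - \<infinity>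
     \<longleftrightarrow> (\<integral>\<^sup>+\<theta>. neg_part \<theta> \<partial>angle_measure) < \<infinity>"
proof -
  let ?P = "\<integral>\<^sup>+\<theta>. e2ennreal (ereal (weight \<theta>) * ext_ln (w \<theta>)) \<partial>angle_measure"
  let ?N = "\<integral>\<^sup>+\<theta>. neg_part \<theta> \<partial>angle_measure"
  have "?P \<le> (\<integral>\<^sup>+\<theta>. 16 * ennreal (w \<theta>) \<partial>angle_measure)"
  proof (rule nn_integral_mono)
    fix \<theta> :: real
    show "e2ennreal (ereal (weight \<theta>) * ext_ln (w \<theta>)) \<le> 16 * ennreal (w \<theta>)"
    proof (cases "w \<theta> \<le> 0")
      case True
      have "ereal (weight \<theta>) * ext_ln (w \<theta>) \<le> 0"
        using True weight_nonneg[of \<theta>] by (simp add: ext_ln_def ereal_mult_le_0_iff)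
      then show ?thesis by (simp add: e2ennreal_neg)
    next
      case False
      have "weight \<theta> * ln (w \<theta>) \<le> weight \<theta> * w \<theta>"
        using False by (intro mult_left_mono ln_le_self weight_nonneg) auto
      also have "\<dots> \<le> 16 * w \<theta>" using False weight_le by (intro mult_right_mono) auto
      finally have "ennreal (weight \<theta> * ln (w \<theta>)) \<le> ennreal (16 * w \<theta>)" by (rule ennreal_leI)
      then show ?thesis using False by (simp add: ext_ln_def ennreal_mult flip: ennreal.abs_eq)
    qed
  qed
  also have "\<dots> = 16 * (\<integral>\<^sup>+\<theta>. ennreal (w \<theta>) \<partial>angle_measure)"
    by (rule nn_integral_cmult) (simp add: measurable_angle_measure)
  also have "\<dots> \<le> 16 * 1" by (intro mult_left_mono nn_integral_w_le) simp
  finally have P: "?P < \<infinity>" by (rule le_less_trans) (use ennreal_less_top[of 16] in simp)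
  have "ext_integral angle_measure (\<lambda>\<theta>. ereal ((1 - cos \<theta>) ^ 3 * (1 + cos \<theta>)) * ext_ln (w \<theta>)) =
     enn2ereal ?P - enn2ereal ?N"
    by (simp add: ext_integral_def neg_part_def weight_def)
  also have "enn2ereal ?P - enn2ereal ?N > - \<infinity> \<longleftrightarrow> ?N < \<infinity>"
    using P by (cases ?P; cases ?N) auto
  finally show ?thesis .
qed

text \<open>Pointwise, -W ln w_n is at most \<open>neg_part\<close> + 16 w / w_n, also where w = 0.
  The last term integrates to at most 16, whence the bound N + 16.\<close>

lemma entropy_finite_imp_szego_entropy_bounded_below:
  assumes "(\<integral>\<^sup>+\<theta>. neg_part \<theta> \<partial>angle_measure) < \<infinity>"
  shows "\<exists>K. \<forall>n. - K \<le> szego_entropy n"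
proof -
  define N where "N = enn2real (\<integral>\<^sup>+\<theta>. neg_part \<theta> \<partial>angle_measure)"
  have N: "(\<integral>\<^sup>+\<theta>. neg_part \<theta> \<partial>angle_measure) = ennreal N"
    using assms by (simp add: N_def less_top)
  have N0: "N \<ge> 0" by (simp add: N_def)
  have "- (N + 16) \<le> szego_entropy n" for n
  proof -
    have bs: "bernstein_szego n \<in> borel_measurable borel"
      by (rule borel_measurable_continuous_onI[OF continuous_bernstein_szego])
    have npm: "neg_part \<in> borel_measurable borel"
      unfolding neg_part_def ext_ln_def by measurable
    have "(\<integral>\<^sup>+\<theta>. ennreal (- (weight \<theta> * ln (bernstein_szego n \<theta>))) \<partial>angle_measure) \<le>
        (\<integral>\<^sup>+\<theta>. neg_part \<theta> + 16 * (ennreal (w \<theta>) * ennreal (1 / bernstein_szego n \<theta>)) \<partial>angle_measure)"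
    proof (rule nn_integral_mono)
      fix \<theta>
      have b: "bernstein_szego n \<theta> > 0" by (rule bernstein_szego_pos)
      show "ennreal (- (weight \<theta> * ln (bernstein_szego n \<theta>))) \<le>
        neg_part \<theta> + 16 * (ennreal (w \<theta>) * ennreal (1 / bernstein_szego n \<theta>))"
      proof (cases "w \<theta> \<le> 0")
        case True
        show ?thesis
        proof (cases "weight \<theta> = 0")
          case True then show ?thesis by simp
        next
          case False
          then have "neg_part \<theta> = \<infinity>"
            using True weight_nonneg[of \<theta>] by (simp add: neg_part_def ext_ln_def less_le e2ennreal_infty)
          then show ?thesis by simp
        qed
      next
        case False
        have "ln (w \<theta> / bernstein_szego n \<theta>) \<le> w \<theta> / bernstein_szego n \<theta>"
          using False b by (intro ln_le_self) simp
        then have "weight \<theta> * (ln (w \<theta>) - ln (bernstein_szego n \<theta>)) \<le> weight \<theta> * (w \<theta> / bernstein_szego n \<theta>)"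
          using False b weight_nonneg by (intro mult_left_mono) (simp_all add: ln_div)
        also have "\<dots> \<le> 16 * (w \<theta> / bernstein_szego n \<theta>)"
          using False b weight_le by (intro mult_right_mono) auto
        finally have "- (weight \<theta> * ln (bernstein_szego n \<theta>)) \<le> - (weight \<theta> * ln (w \<theta>)) + 16 * (w \<theta> * (1 / bernstein_szego n \<theta>))"
          by (simp add: algebra_simps)
        also have "\<dots> \<le> max 0 (- (weight \<theta> * ln (w \<theta>))) + 16 * (w \<theta> * (1 / bernstein_szego n \<theta>))"
          by simp
        finally have "ennreal (- (weight \<theta> * ln (bernstein_szego n \<theta>))) \<le>
            ennreal (max 0 (- (weight \<theta> * ln (w \<theta>))) + 16 * (w \<theta> * (1 / bernstein_szego n \<theta>)))"
          by (rule ennreal_leI)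
        also have "\<dots> = ennreal (- (weight \<theta> * ln (w \<theta>))) + 16 * (ennreal (w \<theta>) * ennreal (1 / bernstein_szego n \<theta>))"
        proof -
          have emax: "ennreal (max 0 x) = ennreal x" for x by (simp add: max_def ennreal_neg)
          have mult: "ennreal (16 * (x * y)) = 16 * (ennreal x * ennreal y)" if "x \<ge> 0" "y \<ge> 0" for x y
            using that by (simp only: ennreal_mult mult_nonneg_nonneg zero_le_numeral ennreal_numeral)
          have nonneg: "w \<theta> \<ge> 0" "1 / bernstein_szego n \<theta> \<ge> 0" using False b by auto
          then have "0 \<le> 16 * (w \<theta> * (1 / bernstein_szego n \<theta>))"
            by (intro mult_nonneg_nonneg) simp_all
          from ennreal_plus[OF max.cobounded1 this] show ?thesis
            unfolding emax mult[OF nonneg] .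
        qed
        also have "ennreal (- (weight \<theta> * ln (w \<theta>))) = neg_part \<theta>"
          using False by (simp add: neg_part_def ext_ln_def flip: ennreal.abs_eq)
        finally show ?thesis .
      qed
    qed
    also have "\<dots> = ennreal N + 16 * (\<integral>\<^sup>+\<theta>. ennreal (w \<theta>) * ennreal (1 / bernstein_szego n \<theta>) \<partial>angle_measure)"
      using bs npm by (simp add: nn_integral_add nn_integral_cmult measurable_angle_measure N)
    also have "(\<integral>\<^sup>+\<theta>. ennreal (w \<theta>) * ennreal (1 / bernstein_szego n \<theta>) \<partial>angle_measure) =
       (\<integral>\<^sup>+\<theta>. ennreal (w \<theta>) * ennreal ((norm (poly (\<psi> n) (cis \<theta>)))\<^sup>2 / h n) \<partial>angle_measure)"
      by (simp add: bernstein_szego_def)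
    also have "\<dots> \<le> (\<integral>\<^sup>+z. ennreal ((norm (poly (\<psi> n) z))\<^sup>2 / h n) \<partial>\<mu>)"
      by (rule nn_integral_ac_le) (intro measurable_compose[OF _ measurable_ennreal]
          borel_measurable_continuous_onI continuous_intros, use h_pos[of n] in simp)
    also have "\<dots> = ennreal (\<integral>z. (norm (poly (\<psi> n) z))\<^sup>2 / h n \<partial>\<mu>)"
      using h_pos[of n] by (intro nn_integral_eq_integral integrable_continuous continuous_intros AE_I2) auto
    also have "(\<integral>z. (norm (poly (\<psi> n) z))\<^sup>2 / h n \<partial>\<mu>) = (\<integral>z. (norm (poly (\<Phi> n) z))\<^sup>2 / h n \<partial>\<mu>)"
      using h_pos[of n] by (intro integral_circle_cong continuous_intros) (auto simp: norm_rev_poly_circle)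
    also have "\<dots> = 1" using h_pos[of n] by (simp add: h_def)
    finally have le: "(\<integral>\<^sup>+\<theta>. ennreal (- (weight \<theta> * ln (bernstein_szego n \<theta>))) \<partial>angle_measure) \<le> ennreal (N + 16)"
      using N0 by (simp add: ennreal_plus add_left_mono mult_left_mono)
    have "(\<integral>\<theta>. - (weight \<theta> * ln (bernstein_szego n \<theta>)) \<partial>angle_measure) \<le> N + 16"
      by (rule integral_real_bounded[OF _ le]) (use N0 in simp)
    then show ?thesis by (simp add: szego_entropy_def)
  qed
  then show ?thesis by blast
qed

text \<open>The test function f has \<mu>-integral at most 3: w f <= w + 1 integrates to at most 2
  over the angle, and the singular part, carried by N where f = 1, has mass at most 1. Hence 48 = 16
  times 3.\<close>

lemma szego_entropy_bounded_below_truncated: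
  assumes K: "\<And>n. - K \<le> szego_entropy n" and e: "e > 0"
  shows "(\<integral>\<^sup>+\<theta>. ennreal (weight \<theta> * max 0 (- ln (w \<theta> + e))) * indicator {0..2 * pi} \<theta> \<partial>angle_measure) \<le> ennreal (K + 48)"
proof -
  interpret A: prob_space angle_measure by (rule prob_space_angle_measure)
  have K0: "K \<ge> 0" using K[of 0] by (simp add: szego_entropy_0)
  obtain N where N: "N \<in> sets borel" "emeasure (distr angle_measure borel cis) N = 0" "emeasure \<mu>s (- N) = 0"
    using decomp by (auto simp: circle_lebesgue_decomp_def)
  \<comment> \<open>The cap C provides the global bound asked of measurable test functions; for
    angles in (0, 2 pi] it is inactive, since w >= 0 there.\<close>
  define C where "C = max 1 (1 / e)"
  define f where "f z = (if z \<in> N then 1 else min C (max 1 (1 / (w (angle_of z) + e))))" for z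
  have C: "C \<ge> 1" by (simp add: C_def)
  have fm: "f \<in> borel_measurable borel" unfolding f_def using N(1) by measurable
  have f1: "f z \<ge> 1" "f z \<le> C" for z using C by (auto simp: f_def)
  have fmu: "f \<in> borel_measurable \<mu>" using fm by (simp add: measurable_cong_sets[OF sets_mu refl])
  have cisA: "cis \<in> measurable angle_measure borel" by (simp add: measurable_angle_measure cis_borel)
  have f_cis: "f (cis \<theta>) = (if cis \<theta> \<in> N then 1 else max 1 (1 / (w \<theta> + e)))" if "0 < \<theta>" "\<theta> \<le> 2 * pi" for \<theta>
  proof -
    have "1 / (w \<theta> + e) \<le> 1 / e"
      using w_nonneg[of \<theta>] that e by (intro divide_left_mono) auto
    then have "max 1 (1 / (w \<theta> + e)) \<le> C" by (auto simp: C_def)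
    then show ?thesis using angle_of_cis[OF that] by (simp add: f_def min_absorb2)
  qed
  have notN: "AE \<theta> in angle_measure. cis \<theta> \<notin> N"
  proof -
    have "AE z in distr angle_measure borel cis. z \<notin> N"
      by (rule AE_not_in) (use N in \<open>simp add: null_sets_def\<close>)
    then show ?thesis using N(1) by (subst (asm) AE_distr_iff[OF cisA]) auto
  qed
  have "(\<integral>\<^sup>+z. ennreal (f z) \<partial>\<mu>) \<le> 3"
  proof -
    have "(\<integral>\<^sup>+\<theta>. ennreal (w \<theta>) * ennreal (f (cis \<theta>)) \<partial>angle_measure) \<le> (\<integral>\<^sup>+\<theta>. ennreal (w \<theta>) + 1 \<partial>angle_measure)"
    proof (rule nn_integral_mono_AE)
      show "AE \<theta> in angle_measure. ennreal (w \<theta>) * ennreal (f (cis \<theta>)) \<le> ennreal (w \<theta>) + 1"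
        using AE_angle_measure
      proof eventually_elim
        case (elim \<theta>)
        have w0: "w \<theta> \<ge> 0" using w_nonneg[of \<theta>] elim by simp
        have "f (cis \<theta>) \<le> max 1 (1 / (w \<theta> + e))" using f_cis elim by auto
        then have "w \<theta> * f (cis \<theta>) \<le> w \<theta> * max 1 (1 / (w \<theta> + e))" using w0 by (rule mult_left_mono)
        also have "\<dots> \<le> w \<theta> + 1" using w0 e by (auto simp: max_def field_simps)
        finally have "ennreal (w \<theta> * f (cis \<theta>)) \<le> ennreal (w \<theta> + 1)" by (rule ennreal_leI)
        then show ?case using w0 f1(1)[of "cis \<theta>"] by (simp add: ennreal_mult ennreal_plus)
      qed
    qed
    also have "\<dots> = (\<integral>\<^sup>+\<theta>. ennreal (w \<theta>) \<partial>angle_measure) + 1"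
      using A.emeasure_space_1 by (subst nn_integral_add) (simp_all add: measurable_angle_measure)
    also have "\<dots> \<le> 1 + 1" by (intro add_right_mono nn_integral_w_le)
    finally have 1: "(\<integral>\<^sup>+\<theta>. ennreal (w \<theta>) * ennreal (f (cis \<theta>)) \<partial>angle_measure) \<le> 1 + 1" .
    have "(\<integral>\<^sup>+z. ennreal (f z) \<partial>\<mu>s) = (\<integral>\<^sup>+z. 1 \<partial>\<mu>s)"
    proof (rule nn_integral_cong_AE, rule AE_I[of _ _ "- N"])
      show "{x \<in> space \<mu>s. ennreal (f x) \<noteq> 1} \<subseteq> - N" by (auto simp: f_def)
      show "- N \<in> sets \<mu>s" using N(1) by (simp add: sets_mus borel_comp)
    qed (rule N(3))
    also have "\<dots> \<le> (\<integral>\<^sup>+z. 1 \<partial>\<mu>)" using nn_integral_decomp[of "\<lambda>_. 1"] by simp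
    also have "\<dots> = 1" using emeasure_space_1 by simp
    finally have 2: "(\<integral>\<^sup>+z. ennreal (f z) \<partial>\<mu>s) \<le> 1" .
    have "(\<integral>\<^sup>+z. ennreal (f z) \<partial>\<mu>) \<le> (1 + 1) + 1"
      unfolding nn_integral_decomp[OF measurable_compose[OF fm measurable_ennreal]]
      by (intro add_mono 1 2)
    then show ?thesis by simp
  qed
  then have "(\<integral>z. f z \<partial>\<mu>) \<le> 3" by (intro integral_real_bounded) simp_all
  then have bound: "(\<integral>\<theta>. weight \<theta> * ln (f (cis \<theta>)) \<partial>angle_measure) \<le> K + 48"
    using szego_entropy_bounded_below_measurable[OF K fm f1] by simp
  have pos: "0 \<le> weight \<theta> * ln (f (cis \<theta>))" for \<theta>
    using weight_nonneg f1(1)[of "cis \<theta>"] by (intro mult_nonneg_nonneg) auto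
  have int: "integrable angle_measure (\<lambda>\<theta>. weight \<theta> * ln (f (cis \<theta>)))"
  proof (rule A.integrable_const_bound[of _ "16 * C"])
    show "AE \<theta> in angle_measure. norm (weight \<theta> * ln (f (cis \<theta>))) \<le> 16 * C"
    proof (rule AE_I2)
      fix \<theta>
      have l: "0 \<le> ln (f (cis \<theta>))" "ln (f (cis \<theta>)) \<le> C"
        using f1[of "cis \<theta>"] order_trans[OF ln_le_self[of "f (cis \<theta>)"], of C] by auto
      have "weight \<theta> * ln (f (cis \<theta>)) \<le> 16 * C" using weight_le weight_nonneg l by (intro mult_mono) auto
      then show "norm (weight \<theta> * ln (f (cis \<theta>))) \<le> 16 * C" using pos[of \<theta>] by simp
    qed
    show "(\<lambda>\<theta>. weight \<theta> * ln (f (cis \<theta>))) \<in> borel_measurable angle_measure"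
      unfolding measurable_angle_measure using fm by measurable
  qed
  have "(\<integral>\<^sup>+\<theta>. ennreal (weight \<theta> * max 0 (- ln (w \<theta> + e))) * indicator {0..2 * pi} \<theta> \<partial>angle_measure) \<le>
      (\<integral>\<^sup>+\<theta>. ennreal (weight \<theta> * ln (f (cis \<theta>))) \<partial>angle_measure)"
  proof (rule nn_integral_mono_AE)
    show "AE \<theta> in angle_measure. ennreal (weight \<theta> * max 0 (- ln (w \<theta> + e))) * indicator {0..2 * pi} \<theta>
        \<le> ennreal (weight \<theta> * ln (f (cis \<theta>)))"
      using AE_angle_measure notN
    proof eventually_elim
      case (elim \<theta>)
      have p: "w \<theta> + e > 0" using w_nonneg[of \<theta>] elim e by (auto intro: add_nonneg_pos)
      have "ln (max 1 (1 / (w \<theta> + e))) = max 0 (- ln (w \<theta> + e))"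
        using p by (auto simp: max_def ln_div)
      then show ?case using f_cis elim by (simp add: indicator_def)
    qed
  qed
  also have "\<dots> = ennreal (\<integral>\<theta>. weight \<theta> * ln (f (cis \<theta>)) \<partial>angle_measure)"
    by (rule nn_integral_eq_integral[OF int]) (use pos in auto)
  also have "\<dots> \<le> ennreal (K + 48)" using bound by (rule ennreal_leI)
  finally show ?thesis .
qed

text \<open>Monotone convergence along e = 1 / (k + 1). Where w = 0 and the weight is positive, the
  truncated integrands grow like ln (k + 1), matching the infinite value of
  \<open>neg_part\<close>.\<close>

lemma szego_entropy_bounded_below_imp_entropy_finite:
  assumes K: "\<And>n. - K \<le> szego_entropy n"
  shows "(\<integral>\<^sup>+\<theta>. neg_part \<theta> \<partial>angle_measure) < \<infinity>"
proof -
  \<comment> \<open>The indicator secures monotonicity in k: w is known to be nonnegative only on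
    [0, 2 pi].\<close>
  define F where "F k \<theta> = ennreal (weight \<theta> * max 0 (- ln (w \<theta> + 1 / real (Suc k)))) * indicator {0..2 * pi} \<theta>"
    for k :: nat and \<theta> :: real
  have Fm: "F k \<in> borel_measurable angle_measure" for k
    unfolding F_def measurable_angle_measure by measurable
  have inc: "incseq F"
  proof (intro incseq_SucI le_funI)
    fix k :: nat and \<theta> :: real
    show "F k \<theta> \<le> F (Suc k) \<theta>"
    proof (cases "\<theta> \<in> {0..2 * pi}")
      case True
      have "ln (w \<theta> + 1 / real (Suc (Suc k))) \<le> ln (w \<theta> + 1 / real (Suc k))"
        using w_nonneg[OF True] by (subst ln_le_cancel_iff) (auto intro!: add_nonneg_pos divide_left_mono)
      then show ?thesis
        using weight_nonneg True unfolding F_def by (intro mult_right_mono ennreal_leI mult_left_mono) auto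
    qed (simp add: F_def)
  qed
  have "(\<integral>\<^sup>+\<theta>. neg_part \<theta> \<partial>angle_measure) \<le> (\<integral>\<^sup>+\<theta>. (SUP k. F k \<theta>) \<partial>angle_measure)"
  proof (rule nn_integral_mono_AE)
    show "AE \<theta> in angle_measure. neg_part \<theta> \<le> (SUP k. F k \<theta>)"
      using AE_angle_measure
    proof eventually_elim
      case (elim \<theta>)
      then have w0: "w \<theta> \<ge> 0" and ind: "\<theta> \<in> {0..2 * pi}" using w_nonneg[of \<theta>] by auto
      have lim0: "(\<lambda>k. w \<theta> + 1 / real (Suc k)) \<longlonglongrightarrow> w \<theta>"
        using tendsto_add[OF tendsto_const LIMSEQ_Suc[OF lim_1_over_n]] by simp
      show "neg_part \<theta> \<le> (SUP k. F k \<theta>)"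
      proof (cases "w \<theta> = 0")
        case False
        then have wp: "w \<theta> > 0" using w0 by simp
        have "(\<lambda>k. ennreal (weight \<theta> * max 0 (- ln (w \<theta> + 1 / real (Suc k))))) \<longlonglongrightarrow> ennreal (weight \<theta> * max 0 (- ln (w \<theta>)))"
          using wp by (intro tendsto_ennrealI tendsto_intros lim0) auto
        then have "(\<lambda>k. F k \<theta>) \<longlonglongrightarrow> ennreal (weight \<theta> * max 0 (- ln (w \<theta>)))"
          using ind by (simp add: F_def)
        then have "ennreal (weight \<theta> * max 0 (- ln (w \<theta>))) \<le> (SUP k. F k \<theta>)"
          by (rule LIMSEQ_le_const2) (intro exI allI impI SUP_upper UNIV_I)
        moreover have "neg_part \<theta> \<le> ennreal (weight \<theta> * max 0 (- ln (w \<theta>)))"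
        proof -
          have "neg_part \<theta> = ennreal (weight \<theta> * - ln (w \<theta>))"
            using wp by (simp add: neg_part_def ext_ln_def flip: ennreal.abs_eq)
          also have "\<dots> \<le> ennreal (weight \<theta> * max 0 (- ln (w \<theta>)))"
            by (intro ennreal_leI mult_left_mono weight_nonneg) simp
          finally show ?thesis .
        qed
        ultimately show ?thesis by simp
      next
        case True
        show ?thesis
        proof (cases "weight \<theta> = 0")
          case True
          then show ?thesis by (simp add: neg_part_def flip: zero_ereal_def)
        next
          case False
          then have W: "weight \<theta> > 0" using weight_nonneg[of \<theta>] by simp
          have "(SUP k. F k \<theta>) = \<top>"
          proof (rule ennreal_SUP_eq_top)
            fix m :: nat
            obtain k :: nat where k: "exp (real m / weight \<theta>) \<le> real k" using real_arch_simple by blast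
            then have "exp (real m / weight \<theta>) \<le> real (Suc k)" by simp
            then have "real m / weight \<theta> \<le> ln (real (Suc k))" by (simp add: ln_ge_iff)
            then have "real m \<le> weight \<theta> * ln (real (Suc k))" using W by (simp add: field_simps)
            also have "ln (real (Suc k)) = - ln (w \<theta> + 1 / real (Suc k))" by (simp add: \<open>w \<theta> = 0\<close> ln_div)
            also have "weight \<theta> * - ln (w \<theta> + 1 / real (Suc k)) \<le> weight \<theta> * max 0 (- ln (w \<theta> + 1 / real (Suc k)))"
              using W by (intro mult_left_mono) auto
            finally have "ennreal (real m) \<le> F k \<theta>" using ind by (simp add: F_def ennreal_leI)
            then show "\<exists>i\<in>UNIV. of_nat m \<le> F i \<theta>" by (auto simp: ennreal_of_nat_eq_real_of_nat)
          qed
          then show ?thesis by (simp only: top_greatest)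
        qed
      qed
    qed
  qed
  also have "\<dots> = (SUP k. integral\<^sup>N angle_measure (F k))"
    by (rule nn_integral_monotone_convergence_SUP[OF inc Fm])
  also have "\<dots> \<le> ennreal (K + 48)"
    unfolding F_def by (intro SUP_least szego_entropy_bounded_below_truncated[OF K]) simp
  also have "\<dots> < \<infinity>" by simp
  finally show ?thesis .
qed

lemma entropy_finite_iff_szego_entropy_bounded_below:
  "ext_integral angle_measure (\<lambda>\<theta>. ereal ((1 - cos \<theta>) ^ 3 * (1 + cos \<theta>)) * ext_ln (w \<theta>)) > - \<infinity>
     \<longleftrightarrow> (\<exists>K. \<forall>n. - K \<le> szego_entropy n)"
  unfolding ext_integral_iff_neg_part
  using entropy_finite_imp_szego_entropy_bounded_below szego_entropy_bounded_below_imp_entropy_finite by blast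

end

theorem theorem4p60:
  fixes \<mu> \<mu>s :: "complex measure" and w :: "real \<Rightarrow> real"
    and \<Phi> :: "nat \<Rightarrow> complex poly" and \<alpha> :: "nat \<Rightarrow> complex"
  assumes "circle_prob_measure \<mu>"
    and "infinite (measure_supp \<mu>)"
    and "circle_lebesgue_decomp \<mu> w \<mu>s"
    and "monic_orthogonal_polys \<mu> \<Phi>"
    and "\<alpha> = verblunsky \<Phi>"
    and "in_ell 6 \<alpha>"
    and "in_ell 3 (shift_minus_one \<alpha>)"
  shows "ext_integral angle_measure
           (\<lambda>\<theta>. ereal ((1 - cos \<theta>) ^ 3 * (1 + cos \<theta>)) * ext_ln (w \<theta>)) > - \<infinity>
         \<longleftrightarrow> in_ell 2 ((shift_minus_one ^^ 3) (shift_plus_one \<alpha>))"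
proof -
  interpret O: opuc_decomposition \<mu> \<Phi> w \<mu>s
    by unfold_locales (use assms in auto)
  interpret E: ell6_sequence \<alpha>
    by unfold_locales (use assms O.alpha_less_1 in auto)
  have \<alpha>: "verblunsky \<Phi> = \<alpha>" using assms(5) by simp
  \<comment> \<open>Off by one: \<open>b 0\<close>, ..., \<open>b 3\<close> take the places of b1,
    ..., b4 in \<open>sum_rule_iff\<close>.\<close>
  define b where "b k n = fps_nth (O.schur n) k" for k n
  note Mo = Moebius_fps_coeffs[OF O.schur_Moebius, unfolded \<alpha>]
  define c1 where "c1 n = - \<alpha> n * b 0 n" for n
  define c2 where "c2 n = - \<alpha> n * b 1 n - (\<alpha> n)\<^sup>2 * (b 0 n)\<^sup>2 / 2" for n
  define c3 where "c3 n = - \<alpha> n * b 2 n - (\<alpha> n)\<^sup>2 * b 0 n * b 1 n - \<alpha> n ^ 3 * b 0 n ^ 3 / 3" for n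
  define c4 where "c4 n = - \<alpha> n * b 3 n - (\<alpha> n)\<^sup>2 * (b 0 n * b 2 n + (b 1 n)\<^sup>2 / 2)
      - \<alpha> n ^ 3 * (b 0 n)\<^sup>2 * b 1 n - \<alpha> n ^ 4 * b 0 n ^ 4 / 4" for n
  \<comment> \<open>16 times the entropy increment; the signs come from -2 Re (-4 c1 - 4 c2 + 4 c3 -
    c4).\<close>
  define D where "D n = 10 * ln (1 - (norm (\<alpha> n))\<^sup>2)
      + 8 * Re (c1 n) + 8 * Re (c2 n) - 8 * Re (c3 n) + 2 * Re (c4 n)" for n
  have szego_entropy_Suc: "O.szego_entropy (Suc n) - O.szego_entropy n = D n / 16" for n
  proof -
    obtain G where
      G: "fps_deriv G * (1 - fps_const (\<alpha> n) * fps_X * O.schur n) = - fps_deriv (fps_const (\<alpha> n) * fps_X * O.schur n)"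
      and szego_entropy: "O.szego_entropy (Suc n) - O.szego_entropy n = 10 / 16 * ln (1 - (norm (\<alpha> n))\<^sup>2) -
        2 * Re (- 4 * fps_nth G 1 - 4 * fps_nth G 2 + 4 * fps_nth G 3 - fps_nth G 4) / 16"
      using O.szego_entropy_Suc[of n, unfolded \<alpha>] by blast
    have "fps_nth G 1 = c1 n" "fps_nth G 2 = c2 n" "fps_nth G 3 = c3 n" "fps_nth G 4 = c4 n"
      unfolding c1_def c2_def c3_def c4_def b_def by (rule log_fps_coeffs[OF G])+
    then show ?thesis unfolding szego_entropy D_def by (simp add: field_simps)
  qed
  have szego_entropy_sum: "O.szego_entropy N = (\<Sum>n<N. D n) / 16" for N
  proof (induction N)
    case (Suc N)
    then show ?case using szego_entropy_Suc[of N] by (simp add: add_divide_distrib)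
  qed (simp add: O.szego_entropy_0)
  have "(\<exists>K. \<forall>N. - K \<le> O.szego_entropy N) \<longleftrightarrow> (\<exists>K. \<forall>N. - K \<le> (\<Sum>n<N. D n))"
  proof
    assume "\<exists>K. \<forall>N. - K \<le> O.szego_entropy N"
    then obtain K where "\<And>N. - K \<le> O.szego_entropy N" by blast
    then have "- (16 * K) \<le> (\<Sum>n<N. D n)" for N unfolding szego_entropy_sum by (simp add: field_simps)
    then show "\<exists>K. \<forall>N. - K \<le> (\<Sum>n<N. D n)" by blast
  next
    assume "\<exists>K. \<forall>N. - K \<le> (\<Sum>n<N. D n)"
    then obtain K where "\<And>N. - K \<le> (\<Sum>n<N. D n)" by blast
    then have "- (K / 16) \<le> O.szego_entropy N" for N unfolding szego_entropy_sum by (simp add: field_simps)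
    then show "\<exists>K. \<forall>N. - K \<le> O.szego_entropy N" by blast
  qed
  also have "\<dots> \<longleftrightarrow> in_ell 2 ((shift_minus_one ^^ 3) (shift_plus_one \<alpha>))"
    by (rule E.sum_rule_iff[OF _ _ _ _ c1_def c2_def c3_def c4_def D_def])
      (use Mo in \<open>simp_all add: b_def\<close>)
  finally show ?thesis unfolding O.entropy_finite_iff_szego_entropy_bounded_below .
qed

end
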